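(* Let $G$ be the Engel group. The following isomorphisms hold: 1. $\big(\Omega^{7,-3}_c(G)\big)'\cong\mathcal D'(G)$; 2. $\mathscr C_{3,1}^{1,0}(G)\cong\{T_1\theta_1+T_2\theta_2\in\mathcal D'(G)\otimes\bigwedge^{1,0}\mathfrak g^*\mid(X_2X_1-X_3)T_2=X_2^2T_1\}$; 3. $\mathscr C_{2,3}^{4,-2}(G)\cong\mathcal D'(G)\otimes\operatorname{span}_{\mathbb R}\{\theta_1\wedge\theta_4\}=\mathcal D'(G)\otimes E_{2,3}^{4,-2}(G)$; 4. $\mathscr C_{1,2}^{6,-3}(G)\cong\mathcal D'(G)\otimes\bigwedge^{6,-3}\mathfrak g^*=\mathcal D'(G)\otimes E_{1,2}^{6,-3}(G)$; 5. $\big(\mathcal C^\infty_c(G)\big)'\cong\mathcal D'(G)\otimes\bigwedge^4\mathfrak g^*$; 6. $\mathscr C_{2,1}^{1,0}(G)\cong\mathcal D'(G)\otimes\bigwedge^{1,0}\mathfrak g^*=\mathcal D'(G)\otimes E_{2,1}^{1,0}(G)$; 7. $\mathscr C_{3,2}^{3,-1}(G)\cong\mathcal D'(G)\otimes\operatorname{span}_{\mathbb R}\{\theta_2\wedge\theta_3\}=\mathcal D'(G)\otimes E_{3,2}^{3,-1}(G)$; 8. $\mathscr C_{1,3}^{6,-3}(G)\cong\big(\mathcal D'(G)\otimes\bigwedge^{6,-3}\mathfrak g^*\big)\big/\{T_1\,\theta_1\wedge\theta_3\wedge\theta_4+T_2\,\theta_2\wedge\theta_3\wedge\theta_4\mid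 X_2(T_1)=X_1(T_2)\}$. Here $\mathcal D'(G):=\big(\mathcal C_c^\infty(G)\big)'$ and the vector fields $X_i$ are understood in the distributional sense.
   Context: **Engel group.** $G$ is the connected, simply connected Lie group whose Lie algebra $\mathfrak g$ has a basis $X_1,X_2,X_3,X_4$ with only non-zero brackets $[X_1,X_2]=X_3$, $[X_1,X_3]=X_4$. The $X_i$ are regarded as left-invariant vector fields, and $\theta_1,\dots,\theta_4$ is the dual basis of left-invariant 1-forms ($d\theta_1=d\theta_2=0$, $d\theta_3=-\theta_1\wedge\theta_2$, $d\theta_4=-\theta_1\wedge\theta_3$). $n=4$ and $Q=7$ are the topological and homogeneous dimensions. **Weights.** $\theta_1,\theta_2,\theta_3,\theta_4$ have weights $1,1,2,3$; weights add under wedge products. $\bigwedge^{p,q}\mathfrak g^*$ is the span of the left-invariant $(p+q)$-forms $\theta_{i_1}\wedge\dots\wedge\theta_{i_{p+q}}$ of weight $p$, so $\bigwedge^{1,0}\mathfrak g^*=\operatorname{span}_{\mathbb R}\{\theta_1,\theta_2\}$ and $\bigwedge^{6,-3}\mathfrak g^*=\operatorname{span}_{\mathbb R}\{\theta_1\wedge\theta_3\wedge\theta_4,\theta_2\wedge\theta_3\wedge\theta_4\}$. $\Omega^{p,q}(G)=\mathcal C^\infty(G)\otimes\bigwedge^{p,q}\mathfrak g^*$ and $\Omega_c^{p,q}(G)=\mathcal C_c^\infty(G)\otimes\bigwedge^{p,q}\mathfrak g^*$; $\Omega_c^k(G)$ is the space of compactly supported smooth $k$-forms. The exterior differential splits as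 $d=d_0+d_1+d_2+d_3$ with $d_i\colon\Omega^{p,k-p}(G)\to\Omega^{p+i,k+1-p-i}(G)$; for $f$ smooth and $\xi$ left-invariant, $d_0(f\xi)=f\,d\xi$, $d_1(f\xi)=X_1f\,\theta_1\wedge\xi+X_2f\,\theta_2\wedge\xi$, $d_2(f\xi)=X_3f\,\theta_3\wedge\xi$, $d_3(f\xi)=X_4f\,\theta_4\wedge\xi$. **Cycles, boundaries and the spectral spaces $E_{r,l}$.** For $r\ge1$, a form $\alpha\in\Omega^{p,k-p}(G)$ lies in $Z_r^{p,k-p}(G)$ iff $d_0\alpha=0$ and there are $z_{p+j}\in\Omega^{p+j,k-p-j}(G)$, $1\le j\le r-1$, with $d_m\alpha=\sum_{i=0}^{m-1}d_iz_{p+m-i}$ for $1\le m\le r-1$. It lies in $B_r^{p,k-p}(G)$ iff there are $c_{p-j}\in\Omega^{p-j,k-1-p+j}(G)$, $0\le j\le r-1$, with $\alpha=\sum_{j=0}^{r-1}d_jc_{p-j}$ and $0=\sum_{j=i}^{r-1}d_{j-i}c_{p-j}$ for $1\le i\le r-1$. One always has $B_l^{p,k-p}(G)\subseteq Z_r^{p,k-p}(G)$, and $E_{r,l}^{p,k-p}(G):=Z_r^{p,k-p}(G)/B_l^{p,k-p}(G)$. In items 3, 4, 6, 7 these are the $\mathcal C^\infty(G)$-modules $E_{2,3}^{4,-2}(G)=\mathcal C^\infty(G)\otimes\operatorname{span}_{\mathbb R}\{\theta_1\wedge\theta_4\}$, $E_{1,2}^{6,-3}(G)=\Omega^{6,-3}(G)$,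 $E_{2,1}^{1,0}(G)=\Omega^{1,0}(G)$, and $E_{3,2}^{3,-1}(G)=\Omega^{3,-1}(G)/(\mathcal C^\infty(G)\,\theta_1\wedge\theta_3)$, identified with $\mathcal C^\infty(G)\otimes\operatorname{span}_{\mathbb R}\{\theta_2\wedge\theta_3\}$; in the expressions $\mathcal D'(G)\otimes E_{r,l}^{p,k-p}(G)$ the tensor product is read over $\mathcal C^\infty(G)$ (i.e. smooth coefficients are replaced by distributions), while all other tensor products are over $\mathbb R$. **Compactly supported versions.** $Z_r^{p,k-p}(G)\cap\Omega_c^k(G)$ and $B_r^{p,k-p}(G)\cap\Omega_c^k(G)$ are notations for the spaces obtained from the same definitions with $\alpha$ and all the auxiliary forms $z_{p+j}$, $c_{p-j}$ required to be compactly supported. **Test forms and currents.** $\mathscr D_{r,l}^{p,k-p}(G):=\big(Z_r^{p,k-p}(G)\cap\Omega_c^k(G)\big)\big/\big(B_l^{p,k-p}(G)\cap\Omega_c^k(G)\big)$, where the numerator carries the subspace topology from $\Omega_c^{p,k-p}(G)$ with its usual LF topology and the quotient carries the quotient topology. The space of $(r,l)$-spectral currents of bidegree $(p,k-p)$ is $\mathscr C_{r,l}^{p,k-p}(G):=\big(\mathscr D_{l,r}^{Q-p,\,n-k-(Q-p)}(G)\big)'$. A prime denotes the continuous dual. *)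

theory Defs
  imports "HOL-Analysis.Analysis" "HOL-Library.Function_Algebras"
begin

section \<open>Real vector spaces\<close>

text \<open>Functions into a real vector space form a real vector space pointwise; the additive
  structure is the one of \<^theory>\<open>HOL-Library.Function_Algebras\<close>.\<close>

instantiation "fun" :: (type, real_vector) real_vector
begin

definition scaleR_fun_def: "c *\<^sub>R f = (\<lambda>x. c *\<^sub>R f x)"

instance
  by standard (simp_all add: scaleR_fun_def plus_fun_def scaleR_add_right scaleR_add_left)

end

text \<open>Quotient spaces have cosets as vectors, so vector spaces are given by explicit carriers
  and operations. \<open>subsp V\<close> is a subspace \<open>V\<close> of an ambient type, \<open>quot V W\<close> is \<open>V / W\<close>.\<close>

record 'a rvs =
  carr :: "'a set"
  vadd :: "'a \<Rightarrow> 'a \<Rightarrow> 'a"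
  vscale :: "real \<Rightarrow> 'a \<Rightarrow> 'a"

definition subsp :: "'a::real_vector set \<Rightarrow> 'a rvs" where
  "subsp V = \<lparr>carr = V, vadd = (+), vscale = (*\<^sub>R)\<rparr>"

definition coset :: "'a::real_vector set \<Rightarrow> 'a \<Rightarrow> 'a set" where
  "coset W a = {a + w | w. w \<in> W}"

definition quot :: "'a::real_vector set \<Rightarrow> 'a set \<Rightarrow> 'a set rvs" where
  "quot V W = \<lparr>carr = coset W ` V,
               vadd = (\<lambda>A B. {a + b | a b. a \<in> A \<and> b \<in> B}),
               vscale = (\<lambda>c A. {c *\<^sub>R a + w | a w. a \<in> A \<and> w \<in> W})\<rparr>"

definition linear_iso :: "'a rvs \<Rightarrow> 'b rvs \<Rightarrow> ('a \<Rightarrow> 'b) \<Rightarrow> bool" where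
  "linear_iso A B \<Phi> \<longleftrightarrow> bij_betw \<Phi> (carr A) (carr B) \<and>
     (\<forall>x\<in>carr A. \<forall>y\<in>carr A. \<Phi> (vadd A x y) = vadd B (\<Phi> x) (\<Phi> y)) \<and>
     (\<forall>c. \<forall>x\<in>carr A. \<Phi> (vscale A c x) = vscale B c (\<Phi> x))"

text \<open>The continuous dual of \<open>A\<close> with respect to a topology \<open>X\<close> on its carrier. A functional is
  represented by its extension by zero outside the carrier, so that the dual is a subspace of
  a function type.\<close>

definition dual :: "'a rvs \<Rightarrow> 'a topology \<Rightarrow> ('a \<Rightarrow> real) set" where
  "dual A X = {T. (\<forall>x\<in>carr A. \<forall>y\<in>carr A. T (vadd A x y) = T x + T y) \<and>
                  (\<forall>c. \<forall>x\<in>carr A. T (vscale A c x) = c * T x) \<and>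
                  continuous_map X euclideanreal T \<and>
                  (\<forall>x. x \<notin> carr A \<longrightarrow> T x = 0)}"

definition quotient_topology :: "'a topology \<Rightarrow> ('a \<Rightarrow> 'b) \<Rightarrow> 'b topology" where
  "quotient_topology X \<pi> =
     topology (\<lambda>U. U \<subseteq> \<pi> ` topspace X \<and> openin X {x \<in> topspace X. \<pi> x \<in> U})"

lemma openin_quotient_topology:
  "openin (quotient_topology X \<pi>) U \<longleftrightarrow>
     U \<subseteq> \<pi> ` topspace X \<and> openin X {x \<in> topspace X. \<pi> x \<in> U}"
proof -
  have "istopology (\<lambda>U. U \<subseteq> \<pi> ` topspace X \<and> openin X {x \<in> topspace X. \<pi> x \<in> U})"
    unfolding istopology_def
  proof (intro conjI allI impI)
    fix S T
    assume "S \<subseteq> \<pi> ` topspace X \<and> openin X {x \<in> topspace X. \<pi> x \<in> S}"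
      and "T \<subseteq> \<pi> ` topspace X \<and> openin X {x \<in> topspace X. \<pi> x \<in> T}"
    moreover have "{x \<in> topspace X. \<pi> x \<in> S \<inter> T}
        = {x \<in> topspace X. \<pi> x \<in> S} \<inter> {x \<in> topspace X. \<pi> x \<in> T}" by auto
    ultimately show "S \<inter> T \<subseteq> \<pi> ` topspace X" and "openin X {x \<in> topspace X. \<pi> x \<in> S \<inter> T}"
      by auto
  next
    fix \<K>
    assume *: "\<forall>K\<in>\<K>. K \<subseteq> \<pi> ` topspace X \<and> openin X {x \<in> topspace X. \<pi> x \<in> K}"
    then show "\<Union>\<K> \<subseteq> \<pi> ` topspace X" by blast
    have "{x \<in> topspace X. \<pi> x \<in> \<Union>\<K>} = (\<Union>K\<in>\<K>. {x \<in> topspace X. \<pi> x \<in> K})" by auto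
    then show "openin X {x \<in> topspace X. \<pi> x \<in> \<Union>\<K>}" using * by auto
  qed
  then show ?thesis by (simp add: quotient_topology_def)
qed

lemma topspace_quotient_topology: "topspace (quotient_topology X \<pi>) = \<pi> ` topspace X"
proof -
  have "{x \<in> topspace X. \<pi> x \<in> \<pi> ` topspace X} = topspace X" by auto
  then have "openin (quotient_topology X \<pi>) (\<pi> ` topspace X)"
    by (simp add: openin_quotient_topology)
  then show ?thesis
    by (metis openin_quotient_topology openin_subset openin_topspace subset_antisym)
qed

lemma quotient_map_quotient_topology: "quotient_map X (quotient_topology X \<pi>) \<pi>"
  by (auto simp: quotient_map_def openin_quotient_topology topspace_quotient_topology)

section \<open>The Engel group\<close>

text \<open>The Lie algebra is \<open>real^4\<close> with basis \<open>X\<^sub>i = axis i 1\<close>; the simply connected group is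
  modelled in exponential coordinates of the first kind, with the Baker-Campbell-Hausdorff
  product (which terminates because the algebra has step 3). In these coordinates the
  exponential map is the identity. Note that \<open>4 = 0\<close> in the index type \<open>4\<close>.\<close>

type_synonym pt = "real^4"

definition lie_bracket :: "pt \<Rightarrow> pt \<Rightarrow> pt" where
  "lie_bracket x y = (\<chi> i. if i = 3 then x$1 * y$2 - x$2 * y$1
                          else if i = 4 then x$1 * y$3 - x$3 * y$1 else 0)"

definition engel_mult :: "pt \<Rightarrow> pt \<Rightarrow> pt" where
  "engel_mult x y = x + y + (1/2) *\<^sub>R lie_bracket x y
     + (1/12) *\<^sub>R lie_bracket x (lie_bracket x y)
     - (1/12) *\<^sub>R lie_bracket y (lie_bracket x y)"

lemma lie_bracket_basis:
  "lie_bracket (axis 1 1) (axis 2 1) = axis 3 1"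
  "lie_bracket (axis 1 1) (axis 3 1) = axis 4 1"
  "lie_bracket (axis 1 1) (axis 4 1) = 0"
  "lie_bracket (axis 2 1) (axis 3 1) = 0"
  "lie_bracket (axis 2 1) (axis 4 1) = 0"
  "lie_bracket (axis 3 1) (axis 4 1) = 0"
  by (simp_all add: lie_bracket_def vec_eq_iff forall_4 axis_def)

lemma engel_group_laws:
  "engel_mult (engel_mult x y) z = engel_mult x (engel_mult y z)"
  "engel_mult 0 x = x" "engel_mult x 0 = x"
  "engel_mult (- x) x = 0" "engel_mult x (- x) = 0"
  by (simp_all add: engel_mult_def lie_bracket_def vec_eq_iff forall_4 field_simps)

text \<open>The left-invariant vector field with value \<open>axis i 1\<close> at the identity.\<close>

definition X :: "4 \<Rightarrow> (pt \<Rightarrow> 'b::real_normed_vector) \<Rightarrow> pt \<Rightarrow> 'b" where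
  "X i f = (\<lambda>x. vector_derivative (\<lambda>t. f (engel_mult x (t *\<^sub>R axis i 1))) (at 0))"

section \<open>Smooth functions, test functions, distributions\<close>

fun partials :: "4 list \<Rightarrow> (pt \<Rightarrow> 'b::real_normed_vector) \<Rightarrow> pt \<Rightarrow> 'b" where
  "partials [] f = f"
| "partials (i # is) f = (\<lambda>x. frechet_derivative (partials is f) (at x) (axis i 1))"

text \<open>All iterated partial derivatives exist and are (Frechet) differentiable, hence continuous.\<close>

definition smooth :: "(pt \<Rightarrow> 'b::real_normed_vector) \<Rightarrow> bool" where
  "smooth f \<longleftrightarrow> (\<forall>is. partials is f differentiable_on UNIV)"

definition test_on :: "pt set \<Rightarrow> 'b::real_normed_vector set \<Rightarrow> (pt \<Rightarrow> 'b) set" where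
  "test_on K S = {\<phi>. smooth \<phi> \<and> range \<phi> \<subseteq> S \<and> closure {x. \<phi> x \<noteq> 0} \<subseteq> K}"

definition test :: "'b::real_normed_vector set \<Rightarrow> (pt \<Rightarrow> 'b) set" where
  "test S = {\<phi>. smooth \<phi> \<and> range \<phi> \<subseteq> S \<and> compact (closure {x. \<phi> x \<noteq> 0})}"

text \<open>For compact \<open>K\<close>: the Frechet topology of uniform convergence of all derivatives.\<close>

definition frechet_topology :: "pt set \<Rightarrow> 'b::real_normed_vector set \<Rightarrow> (pt \<Rightarrow> 'b) topology" where
  "frechet_topology K S = topology_generated_by
     {{\<psi> \<in> test_on K S. \<forall>x. norm (partials is \<psi> x - partials is \<phi> x) < \<epsilon>} | is \<phi> \<epsilon>.
        \<phi> \<in> test_on K S \<and> \<epsilon> > 0}"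

text \<open>The locally convex inductive limit topology: a base at \<open>0\<close> is given by the convex balanced
  sets whose trace on every \<open>test_on K S\<close>, \<open>K\<close> compact, is open.\<close>

definition LF_nhds0 :: "'b::real_normed_vector set \<Rightarrow> (pt \<Rightarrow> 'b) set set" where
  "LF_nhds0 S = {W. W \<subseteq> test S \<and> convex W \<and> (\<forall>c. \<bar>c\<bar> \<le> 1 \<longrightarrow> (\<forall>\<phi>\<in>W. c *\<^sub>R \<phi> \<in> W)) \<and>
                   (\<forall>K. compact K \<longrightarrow> openin (frechet_topology K S) (W \<inter> test_on K S))}"

definition LF_topology :: "'b::real_normed_vector set \<Rightarrow> (pt \<Rightarrow> 'b) topology" where
  "LF_topology S = topology_generated_by {(+) \<phi> ` W | \<phi> W. \<phi> \<in> test S \<and> W \<in> LF_nhds0 S}"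

abbreviation Cinf :: "(pt \<Rightarrow> real) set" where
  "Cinf \<equiv> {f. smooth f}"

abbreviation Ccinf :: "(pt \<Rightarrow> real) set" where
  "Ccinf \<equiv> test UNIV"

type_synonym distr = "(pt \<Rightarrow> real) \<Rightarrow> real"

definition Distr :: "distr set" where
  "Distr = dual (subsp Ccinf) (LF_topology UNIV)"

text \<open>The action of the vector fields on distributions: they are divergence free with respect
  to the Haar (Lebesgue) measure, so their formal adjoints are their negatives.\<close>

definition Xd :: "4 \<Rightarrow> distr \<Rightarrow> distr" where
  "Xd i T = (\<lambda>\<phi>. if \<phi> \<in> Ccinf then - T (X i \<phi>) else 0)"

definition distr_mult :: "(pt \<Rightarrow> real) \<Rightarrow> distr \<Rightarrow> distr" where
  "distr_mult f T = (\<lambda>\<phi>. if \<phi> \<in> Ccinf then T (\<lambda>x. f x * \<phi> x) else 0)"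

section \<open>Left-invariant forms\<close>

text \<open>The exterior algebra of the dual Lie algebra is \<open>real^(4 set)\<close>: the basis vector \<open>\<theta> I\<close> is
  the wedge product of the \<open>\<theta>\<^sub>i\<close>, \<open>i \<in> I\<close>, in the order \<open>1 < 2 < 3 < 4\<close>. Since \<open>4 = 0\<close> in the
  index type, that order is not the order of the type and is spelled out.\<close>

type_synonym ext = "real^(4 set)"

definition \<theta> :: "4 set \<Rightarrow> ext" where
  "\<theta> I = axis I 1"

definition prec :: "4 \<Rightarrow> 4 \<Rightarrow> bool" where
  "prec i j \<longleftrightarrow> (i, j) \<in> {(1,2), (1,3), (1,4), (2,3), (2,4), (3,4)}"

definition wedge :: "ext \<Rightarrow> ext \<Rightarrow> ext" where
  "wedge \<xi> \<eta> = (\<Sum>I\<in>UNIV. \<Sum>J\<in>UNIV. if I \<inter> J = {}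
     then ((-1) ^ card {(i, j). i \<in> I \<and> j \<in> J \<and> prec j i} * \<xi>$I * \<eta>$J) *\<^sub>R \<theta> (I \<union> J) else 0)"

definition weight :: "4 \<Rightarrow> nat" where
  "weight i = (if i = 3 then 2 else if i = 4 then 3 else 1)"

text \<open>Index sets of the monomials of weight \<open>p\<close> and degree \<open>p + q\<close>, and their span.\<close>

definition bideg :: "int \<Rightarrow> int \<Rightarrow> 4 set set" where
  "bideg p q = {I. int (\<Sum>i\<in>I. weight i) = p \<and> int (card I) = p + q}"

definition Lam :: "int \<Rightarrow> int \<Rightarrow> ext set" where
  "Lam p q = span (\<theta> ` bideg p q)"

text \<open>The exterior derivative of the \<open>\<theta>\<^sub>i\<close>, extended to left-invariant forms as an antiderivation.\<close>

definition dtheta :: "4 \<Rightarrow> ext" where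
  "dtheta i = (if i = 3 then - \<theta> {1, 2} else if i = 4 then - \<theta> {1, 3} else 0)"

definition dinv :: "ext \<Rightarrow> ext" where
  "dinv \<xi> = (\<Sum>I\<in>UNIV. \<xi>$I *\<^sub>R
     (\<Sum>i\<in>I. (-1) ^ card {j \<in> I. prec j i} *\<^sub>R wedge (dtheta i) (\<theta> (I - {i}))))"

section \<open>Differential forms and the spectral spaces\<close>

text \<open>A form is identified with its coefficient function in the left-invariant frame.\<close>

type_synonym form = "pt \<Rightarrow> ext"

definition Om :: "int \<Rightarrow> int \<Rightarrow> form set" where
  "Om p q = {\<alpha>. smooth \<alpha> \<and> range \<alpha> \<subseteq> Lam p q}"

definition Omc :: "int \<Rightarrow> int \<Rightarrow> form set" where
  "Omc p q = test (Lam p q)"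

definition d :: "nat \<Rightarrow> form \<Rightarrow> form" where
  "d m \<alpha> = (if m = 0 then (\<lambda>x. dinv (\<alpha> x))
            else (\<lambda>x. \<Sum>i | weight i = m. wedge (\<theta> {i}) (X i \<alpha> x)))"

text \<open>Cycles and boundaries, for \<open>F = Om\<close> and for the compactly supported version \<open>F = Omc\<close>.
  The auxiliary forms \<open>z j\<close> and \<open>c j\<close> have weights \<open>p + j\<close> and \<open>p - j\<close> respectively.\<close>

definition Zr :: "(int \<Rightarrow> int \<Rightarrow> form set) \<Rightarrow> nat \<Rightarrow> int \<Rightarrow> int \<Rightarrow> form set" where
  "Zr F r p q = {\<alpha> \<in> F p q. d 0 \<alpha> = 0 \<and>
     (\<exists>z. (\<forall>j\<in>{1..r-1}. z j \<in> F (p + int j) (q - int j)) \<and>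
          (\<forall>m\<in>{1..r-1}. d m \<alpha> = (\<Sum>i\<in>{0..m-1}. d i (z (m - i)))))}"

definition Br :: "(int \<Rightarrow> int \<Rightarrow> form set) \<Rightarrow> nat \<Rightarrow> int \<Rightarrow> int \<Rightarrow> form set" where
  "Br F r p q = {\<alpha> \<in> F p q.
     \<exists>c. (\<forall>j\<in>{0..r-1}. c j \<in> F (p - int j) (q - 1 + int j)) \<and>
         \<alpha> = (\<Sum>j\<in>{0..r-1}. d j (c j)) \<and>
         (\<forall>i\<in>{1..r-1}. 0 = (\<Sum>j\<in>{i..r-1}. d (j - i) (c j)))}"

definition E :: "nat \<Rightarrow> nat \<Rightarrow> int \<Rightarrow> int \<Rightarrow> form set rvs" where
  "E r l p q = quot (Zr Om r p q) (Br Om l p q)"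

definition Dtest :: "nat \<Rightarrow> nat \<Rightarrow> int \<Rightarrow> int \<Rightarrow> form set rvs" where
  "Dtest r l p q = quot (Zr Omc r p q) (Br Omc l p q)"

definition Dtest_topology :: "nat \<Rightarrow> nat \<Rightarrow> int \<Rightarrow> int \<Rightarrow> form set topology" where
  "Dtest_topology r l p q =
     quotient_topology (subtopology (LF_topology (Lam p q)) (Zr Omc r p q)) (coset (Br Omc l p q))"

text \<open>Spectral currents of bidegree \<open>(p, q)\<close>, where \<open>q = k - p\<close>; here \<open>Q = 7\<close> and \<open>n = 4\<close>.\<close>

definition Cur :: "nat \<Rightarrow> nat \<Rightarrow> int \<Rightarrow> int \<Rightarrow> (form set \<Rightarrow> real) set" where
  "Cur r l p q = dual (Dtest l r (7 - p) (4 - (p + q) - (7 - p)))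
                      (Dtest_topology l r (7 - p) (4 - (p + q) - (7 - p)))"

section \<open>Forms with distributional coefficients\<close>

text \<open>\<open>DF M\<close> is the tensor product over the reals of \<open>Distr\<close> with the span of the \<open>\<theta> I\<close>, \<open>I \<in> M\<close>;
  its element \<open>T\<close> stands for the sum of the \<open>T I \<otimes> \<theta> I\<close>.\<close>

definition DF :: "4 set set \<Rightarrow> (4 set \<Rightarrow> distr) set" where
  "DF M = {T. (\<forall>I\<in>M. T I \<in> Distr) \<and> (\<forall>I. I \<notin> M \<longrightarrow> T I = 0)}"

text \<open>The value at a test form \<open>\<beta>\<close>, i.e. the integral of \<open>T \<and> \<beta>\<close>: the product of \<open>T I \<otimes> \<theta> I\<close>
  and \<open>\<phi> \<theta> J\<close> contributes \<open>T I \<phi>\<close> times the coefficient of \<open>\<theta> I \<and> \<theta> J\<close> along the volume form.\<close>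

definition pairing :: "(4 set \<Rightarrow> distr) \<Rightarrow> form \<Rightarrow> real" where
  "pairing T \<beta> = (\<Sum>I\<in>UNIV. \<Sum>J\<in>UNIV. (wedge (\<theta> I) (\<theta> J))${1, 2, 3, 4} * T I (\<lambda>x. \<beta> x $ J))"

text \<open>The tensor product over \<open>Cinf\<close> of \<open>Distr\<close> and \<open>E r l p q\<close>: the real vector space freely
  generated by the pairs, modulo the bilinearity and balancing relations.\<close>

definition form_mult :: "form set \<Rightarrow> (pt \<Rightarrow> real) \<Rightarrow> form set \<Rightarrow> form set" where
  "form_mult B f A = {(\<lambda>x. f x *\<^sub>R \<alpha> x) + b | \<alpha> b. \<alpha> \<in> A \<and> b \<in> B}"

definition pure :: "'a \<Rightarrow> 'b \<Rightarrow> 'a \<times> 'b \<Rightarrow> real" where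
  "pure a b = (\<lambda>y. if y = (a, b) then 1 else 0)"

definition tensor_free :: "nat \<Rightarrow> nat \<Rightarrow> int \<Rightarrow> int \<Rightarrow> (distr \<times> form set \<Rightarrow> real) set" where
  "tensor_free r l p q = span {pure T A | T A. T \<in> Distr \<and> A \<in> carr (E r l p q)}"

definition tensor_rels :: "nat \<Rightarrow> nat \<Rightarrow> int \<Rightarrow> int \<Rightarrow> (distr \<times> form set \<Rightarrow> real) set" where
  "tensor_rels r l p q = span
     ({pure (S + T) A - pure S A - pure T A | S T A.
         S \<in> Distr \<and> T \<in> Distr \<and> A \<in> carr (E r l p q)} \<union>
      {pure T (vadd (E r l p q) A A') - pure T A - pure T A' | T A A'.
         T \<in> Distr \<and> A \<in> carr (E r l p q) \<and> A' \<in> carr (E r l p q)} \<union>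
      {pure (c *\<^sub>R T) A - c *\<^sub>R pure T A | c T A. T \<in> Distr \<and> A \<in> carr (E r l p q)} \<union>
      {pure (distr_mult f T) A - pure T (form_mult (Br Om l p q) f A) | f T A.
         f \<in> Cinf \<and> T \<in> Distr \<and> A \<in> carr (E r l p q)})"

definition tensor_E :: "nat \<Rightarrow> nat \<Rightarrow> int \<Rightarrow> int \<Rightarrow> (distr \<times> form set \<Rightarrow> real) set rvs" where
  "tensor_E r l p q = quot (tensor_free r l p q) (tensor_rels r l p q)"

text \<open>The class of \<open>\<Sum>I\<in>M. T I \<otimes> [\<theta> I]\<close>.\<close>

definition to_tensor_E ::
    "nat \<Rightarrow> nat \<Rightarrow> int \<Rightarrow> int \<Rightarrow> 4 set set \<Rightarrow> (4 set \<Rightarrow> distr) \<Rightarrow> (distr \<times> form set \<Rightarrow> real) set" where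
  "to_tensor_E r l p q M T = coset (tensor_rels r l p q)
     (\<Sum>I\<in>M. pure (T I) (coset (Br Om l p q) (\<lambda>x. \<theta> I)))"

section \<open>The isomorphisms\<close>

text \<open>Isomorphy of a space of distributional forms with a space of currents always refers to the
  isomorphism induced by the pairing; the bare existence of a linear bijection would carry no
  information, all these spaces having the same algebraic dimension.\<close>

definition represents_currents ::
    "(4 set \<Rightarrow> distr) set \<Rightarrow> nat \<Rightarrow> nat \<Rightarrow> int \<Rightarrow> int \<Rightarrow> bool" where
  "represents_currents V r l p q \<longleftrightarrow>
     (\<exists>\<Phi>. linear_iso (subsp V) (subsp (Cur r l p q)) \<Phi> \<and>
       (\<forall>T\<in>V. \<forall>\<beta>\<in>Zr Omc l (7 - p) (4 - (p + q) - (7 - p)).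
          \<Phi> T (coset (Br Omc r (7 - p) (4 - (p + q) - (7 - p))) \<beta>) = pairing T \<beta>))"

definition quot_represents_currents ::
    "(4 set \<Rightarrow> distr) set \<Rightarrow> (4 set \<Rightarrow> distr) set \<Rightarrow> nat \<Rightarrow> nat \<Rightarrow> int \<Rightarrow> int \<Rightarrow> bool" where
  "quot_represents_currents V W r l p q \<longleftrightarrow>
     (\<exists>\<Phi>. linear_iso (quot V W) (subsp (Cur r l p q)) \<Phi> \<and>
       (\<forall>T\<in>V. \<forall>\<beta>\<in>Zr Omc l (7 - p) (4 - (p + q) - (7 - p)).
          \<Phi> (coset W T) (coset (Br Omc r (7 - p) (4 - (p + q) - (7 - p))) \<beta>) = pairing T \<beta>))"

end

theory Submission
  imports Defs
begin

text \<open>A linear functional on a space of test forms is continuous iff on every compact set it is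
  bounded by finitely many derivatives, so functionals on test forms decompose into distributional
  coefficients. By the Hahn-Banach theorem every functional on a space of compactly supported cycles
  extends to all test forms; currents are therefore distributional forms annihilating the boundaries,
  modulo those annihilating the cycles, and the isomorphisms reduce to computing cycles and boundaries
  in the left-invariant frame. Only the last one needs analysis: a compactly supported cycle
  \<open>a \<theta>\<^sub>1 + b \<theta>\<^sub>2\<close> in \<open>Z\<^sub>3\<close> is the horizontal gradient of the test function \<open>u\<close> obtained by
  integrating \<open>b\<close> along the flow of \<open>X\<^sub>2\<close>. Indeed \<open>X\<^sub>2\<^sup>2 (a - X\<^sub>1 u) = 0\<close>, and \<open>a - X\<^sub>1 u\<close> vanishes far out
  on every flow line; outside a ball \<open>u\<close> has zero horizontal gradient, hence is constant there.\<close>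

section \<open>Calculus of smooth functions\<close>

text \<open>Each cycle space carries only the subspace topology and is treated through extension to
  all test forms, not through a structure theorem of its own. The LF topology is given by convex
  sets without seminorms, so Hahn-Banach is used in the form that keeps a functional at most 1 on a
  convex set. In the bidegrees that occur, all cycle and boundary spaces but two are spanned by
  monomials over the coefficient functions. One exception is the boundaries of order 3 in bidegree
  (6,-3): they are parametrised by one function, and transposing this parametrisation gives the
  equation of item 2. The other is the cycles of order 3 in bidegree (1,0). Item 8 divides by the
  annihilator of these cycles, while X_2 T_1 = X_1 T_2 tests only against gradients of test
  functions; the two agree because every such cycle has a potential that is compactly supported
  itself. The brackets decide this: [X_1,X_2] = X_3 and [X_2,X_3] = 0 make gradients satisfy the
  cycle condition X_2^2 a - X_2 X_1 b + X_3 b = 0, and X_3, X_4 are brackets, so zero horizontal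
  gradient on an open set means zero differential there.\<close>

definition pd :: "4 \<Rightarrow> (pt \<Rightarrow> 'b::real_normed_vector) \<Rightarrow> pt \<Rightarrow> 'b" where
  "pd i f = (\<lambda>x. frechet_derivative f (at x) (axis i 1))"

lemma partials_Cons: "partials (i # is) f = pd i (partials is f)"
  by (simp add: pd_def)

lemma partials_append: "partials (is @ js) f = partials is (partials js f)"
  by (induction "is") (simp_all add: partials_Cons del: partials.simps(2))

text \<open>The head of the list is the derivative taken last. Splitting off the one taken first is
  what the induction in \<open>partials_mult_bound\<close> needs.\<close>

lemma partials_snoc: "partials (is @ [i]) f = partials is (pd i f)"
  by (simp add: partials_append pd_def)

declare partials.simps(2) [simp del] partials_Cons [simp]

lemma pd_eqI: "(f has_derivative f') (at x) \<Longrightarrow> pd i f x = f' (axis i 1)"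
  by (simp add: pd_def frechet_derivative_at[symmetric])

lemma smooth_partials: "smooth f \<Longrightarrow> smooth (partials is f)"
  unfolding smooth_def by (metis partials_append)

lemma smooth_pd: "smooth f \<Longrightarrow> smooth (pd i f)"
  using smooth_partials[of f "[i]"] by simp

lemma smooth_differentiable: "smooth f \<Longrightarrow> f differentiable (at x)"
  unfolding smooth_def differentiable_on_def by (metis UNIV_I partials.simps(1))

lemma smooth_continuous: "smooth f \<Longrightarrow> continuous_on S f"
  by (meson smooth_differentiable continuous_at_imp_continuous_on differentiable_imp_continuous_within)

text \<open>Since \<open>partials\<close> differentiates one step at a time, a class closed under
  every \<open>pd i\<close> contains all iterated partials of its members. No formula for higher
  derivatives has to be written down.\<close>

lemma smooth_coinduct:
  assumes "f \<in> A" and step: "\<And>g. g \<in> A \<Longrightarrow> (\<forall>x. g differentiable (at x)) \<and> (\<forall>i. pd i g \<in> A)"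
  shows "smooth f"
proof -
  have "partials is f \<in> A" for "is"
    by (induction "is") (use assms in auto)
  then show ?thesis
    using step unfolding smooth_def differentiable_on_def by blast
qed

lemma axis_expansion4: "(h::pt) = (\<Sum>i\<in>UNIV. h $ i *\<^sub>R axis i 1)"
  by (simp add: vec_eq_iff axis_def if_distrib cong: if_cong)

lemma has_derivative_axes:
  assumes "(f has_derivative f') (at x)"
  shows "f' h = (\<Sum>i\<in>UNIV. h $ i *\<^sub>R pd i f x)"
proof -
  have "linear f'" using assms has_derivative_linear by blast
  then have "f' h = (\<Sum>i\<in>UNIV. h $ i *\<^sub>R f' (axis i 1))"
    by (subst axis_expansion4) (simp add: linear_sum linear_scale)
  then show ?thesis by (simp add: pd_eqI[OF assms])
qed

lemma has_derivative_pd: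
  assumes "f differentiable (at x)"
  shows "(f has_derivative (\<lambda>h. \<Sum>i\<in>UNIV. h $ i *\<^sub>R pd i f x)) (at x)"
proof -
  obtain f' where f': "(f has_derivative f') (at x)" using assms differentiable_def by blast
  then show ?thesis using has_derivative_axes[OF f'] by (metis (no_types, lifting) ext)
qed

lemmas smooth_has_derivative = has_derivative_pd[OF smooth_differentiable]

subsection \<open>Functions depending on a parameter\<close>

text \<open>The following classes are closed under partial derivatives in \<open>x\<close>, so their members are
  smooth by coinduction, also after integration over the parameter \<open>t\<close>.\<close>

inductive_set poly_fun :: "(real \<Rightarrow> pt \<Rightarrow> real) set" where
  const: "(\<lambda>t x. c) \<in> poly_fun"
| par: "(\<lambda>t x. t) \<in> poly_fun"
| coord: "(\<lambda>t x. x $ j) \<in> poly_fun"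
| add: "\<lbrakk>h \<in> poly_fun; k \<in> poly_fun\<rbrakk> \<Longrightarrow> (\<lambda>t x. h t x + k t x) \<in> poly_fun"
| mult: "\<lbrakk>h \<in> poly_fun; k \<in> poly_fun\<rbrakk> \<Longrightarrow> (\<lambda>t x. h t x * k t x) \<in> poly_fun"

inductive_set par_fun :: "(real \<Rightarrow> pt \<Rightarrow> pt) \<Rightarrow> (real \<Rightarrow> pt \<Rightarrow> real) set" for \<Psi> where
  poly: "h \<in> poly_fun \<Longrightarrow> h \<in> par_fun \<Psi>"
| comp: "smooth g \<Longrightarrow> (\<lambda>t x. g (\<Psi> t x)) \<in> par_fun \<Psi>"
| add: "\<lbrakk>h \<in> par_fun \<Psi>; k \<in> par_fun \<Psi>\<rbrakk> \<Longrightarrow> (\<lambda>t x. h t x + k t x) \<in> par_fun \<Psi>"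
| mult: "\<lbrakk>h \<in> par_fun \<Psi>; k \<in> par_fun \<Psi>\<rbrakk> \<Longrightarrow> (\<lambda>t x. h t x * k t x) \<in> par_fun \<Psi>"

lemma sum_par_fun: "finite I \<Longrightarrow> (\<And>i. i \<in> I \<Longrightarrow> h i \<in> par_fun \<Psi>) \<Longrightarrow> (\<lambda>t x. \<Sum>i\<in>I. h i t x) \<in> par_fun \<Psi>"
  by (induction I rule: finite_induct) (auto intro: par_fun.intros poly_fun.intros)

lemma poly_fun_derivative:
  assumes "h \<in> poly_fun"
  shows "continuous_on UNIV (\<lambda>p. h (fst p) (snd p)) \<and>
    (\<exists>dh. (\<forall>i. dh i \<in> poly_fun) \<and>
       (\<forall>t x. (h t has_derivative (\<lambda>v. \<Sum>i\<in>UNIV. v $ i * dh i t x)) (at x)))"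
  using assms
proof induction
  case (const c)
  show ?case
    by (intro conjI exI[of _ "\<lambda>i t x. 0"]) (auto intro!: continuous_intros poly_fun.intros)
next
  case par
  show ?case
    by (intro conjI exI[of _ "\<lambda>i t x. 0"]) (auto intro!: continuous_intros poly_fun.intros)
next
  case (coord j)
  show ?case
    by (intro conjI exI[of _ "\<lambda>i t x. if i = j then 1 else 0"])
       (auto intro!: continuous_intros poly_fun.intros bounded_linear_imp_has_derivative bounded_linear_vec_nth
          simp: if_distrib cong: if_cong)
next
  case (add h k)
  then obtain dh dk where "\<forall>i. dh i \<in> poly_fun" "\<forall>i. dk i \<in> poly_fun"
    "\<forall>t x. (h t has_derivative (\<lambda>v. \<Sum>i\<in>UNIV. v $ i * dh i t x)) (at x)"
    "\<forall>t x. (k t has_derivative (\<lambda>v. \<Sum>i\<in>UNIV. v $ i * dk i t x)) (at x)" by blast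
  with add show ?case
    by (intro conjI exI[of _ "\<lambda>i t x. dh i t x + dk i t x"])
       (auto intro!: continuous_intros poly_fun.intros derivative_eq_intros
          simp: algebra_simps sum.distrib)
next
  case (mult h k)
  then obtain dh dk where "\<forall>i. dh i \<in> poly_fun" "\<forall>i. dk i \<in> poly_fun"
    "\<forall>t x. (h t has_derivative (\<lambda>v. \<Sum>i\<in>UNIV. v $ i * dh i t x)) (at x)"
    "\<forall>t x. (k t has_derivative (\<lambda>v. \<Sum>i\<in>UNIV. v $ i * dk i t x)) (at x)" by blast
  with mult show ?case
    by (intro conjI exI[of _ "\<lambda>i t x. h t x * dk i t x + dh i t x * k t x"])
       (auto intro!: continuous_intros poly_fun.intros derivative_eq_intros
          simp: algebra_simps sum.distrib sum_distrib_left)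
qed

text \<open>Both conjuncts serve the parameter integral: differentiation under the integral sign
  asks for joint continuity, and a gradient in the same class lets the step be repeated.\<close>

lemma par_fun_derivative:
  assumes \<Psi>: "\<And>j. (\<lambda>t x. \<Psi> t x $ j) \<in> poly_fun" and "h \<in> par_fun \<Psi>"
  shows "continuous_on UNIV (\<lambda>p. h (fst p) (snd p)) \<and>
    (\<exists>dh. (\<forall>i. dh i \<in> par_fun \<Psi>) \<and>
       (\<forall>t x. (h t has_derivative (\<lambda>v. \<Sum>i\<in>UNIV. v $ i * dh i t x)) (at x)))"
  using assms(2)
proof induction
  case (poly h)
  obtain dh where dh: "\<And>i. dh i \<in> poly_fun"
    "\<And>t x. (h t has_derivative (\<lambda>v. \<Sum>i\<in>UNIV. v $ i * dh i t x)) (at x)"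
    and cont: "continuous_on UNIV (\<lambda>p. h (fst p) (snd p))"
    using poly_fun_derivative[OF poly] by blast
  show ?case
    by (intro conjI exI[of _ dh] allI cont dh(2) par_fun.poly[OF dh(1)])
next
  case (comp g)
  \<comment> \<open>The components of \<open>\<Psi>\<close> have polynomial partials, so the chain
    rule yields polynomials times compositions with \<open>\<Psi>\<close> and stays in the
    class.\<close>
  have "\<forall>j. \<exists>dh. (\<forall>i. dh i \<in> poly_fun) \<and>
      (\<forall>t x. ((\<lambda>x. \<Psi> t x $ j) has_derivative (\<lambda>v. \<Sum>i\<in>UNIV. v $ i * dh i t x)) (at x))"
    using poly_fun_derivative[OF \<Psi>] by blast
  from choice[OF this] obtain c where c: "\<And>j i. c j i \<in> poly_fun"
    "\<And>j t x. ((\<lambda>x. \<Psi> t x $ j) has_derivative (\<lambda>v. \<Sum>i\<in>UNIV. v $ i * c j i t x)) (at x)"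
    by blast
  have "continuous_on UNIV (\<lambda>p. \<chi> j. \<Psi> (fst p) (snd p) $ j)"
    by (rule continuous_on_vec_lambda) (use poly_fun_derivative[OF \<Psi>] in auto)
  then have cont: "continuous_on UNIV (\<lambda>p. g (\<Psi> (fst p) (snd p)))"
    using continuous_on_compose2[OF smooth_continuous[OF comp, of UNIV]] by fastforce
  have der\<Psi>: "(\<Psi> t has_derivative (\<lambda>v. \<chi> j. \<Sum>i\<in>UNIV. v $ i * c j i t x)) (at x)" for t x
    by (subst has_derivative_componentwise_within) (auto simp: Basis_vec_def inner_axis c(2))
  have "(\<Sum>j\<in>UNIV. (\<Sum>i\<in>UNIV. v $ i * c j i t x) * pd j g (\<Psi> t x))
      = (\<Sum>i\<in>UNIV. v $ i * (\<Sum>j\<in>UNIV. c j i t x * pd j g (\<Psi> t x)))" for v :: pt and t x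
    unfolding sum_distrib_left sum_distrib_right by (subst sum.swap) (simp add: ac_simps)
  then have der: "((\<lambda>x. g (\<Psi> t x)) has_derivative
      (\<lambda>v. \<Sum>i\<in>UNIV. v $ i * (\<Sum>j\<in>UNIV. c j i t x * pd j g (\<Psi> t x)))) (at x)" for t x
    using has_derivative_compose[OF der\<Psi> smooth_has_derivative[OF comp], of t x] by simp
  have "(\<lambda>t x. \<Sum>j\<in>UNIV. c j i t x * pd j g (\<Psi> t x)) \<in> par_fun \<Psi>" for i
    by (intro sum_par_fun par_fun.mult par_fun.poly c par_fun.comp smooth_pd comp) auto
  then show ?case
    by (intro conjI cont exI[of _ "\<lambda>i t x. \<Sum>j\<in>UNIV. c j i t x * pd j g (\<Psi> t x)"]) (auto simp: der)
next
  case (add h k)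
  then obtain dh dk where "\<forall>i. dh i \<in> par_fun \<Psi>" "\<forall>i. dk i \<in> par_fun \<Psi>"
    "\<forall>t x. (h t has_derivative (\<lambda>v. \<Sum>i\<in>UNIV. v $ i * dh i t x)) (at x)"
    "\<forall>t x. (k t has_derivative (\<lambda>v. \<Sum>i\<in>UNIV. v $ i * dk i t x)) (at x)" by blast
  with add show ?case
    by (intro conjI exI[of _ "\<lambda>i t x. dh i t x + dk i t x"])
       (auto intro!: continuous_intros par_fun.add par_fun.mult derivative_eq_intros
          simp: algebra_simps sum.distrib)
next
  case (mult h k)
  then obtain dh dk where "\<forall>i. dh i \<in> par_fun \<Psi>" "\<forall>i. dk i \<in> par_fun \<Psi>"
    "\<forall>t x. (h t has_derivative (\<lambda>v. \<Sum>i\<in>UNIV. v $ i * dh i t x)) (at x)"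
    "\<forall>t x. (k t has_derivative (\<lambda>v. \<Sum>i\<in>UNIV. v $ i * dk i t x)) (at x)" by blast
  with mult show ?case
    by (intro conjI exI[of _ "\<lambda>i t x. h t x * dk i t x + dh i t x * k t x"])
       (auto intro!: continuous_intros par_fun.add par_fun.mult derivative_eq_intros
          simp: algebra_simps sum.distrib sum_distrib_left)
qed

lemma has_derivative_pd_sum:
  assumes "(f has_derivative (\<lambda>v. \<Sum>i\<in>UNIV. v $ i * (a i::real))) (at x)"
  shows "pd i f x = a i"
proof -
  have "(\<Sum>j\<in>UNIV. axis i 1 $ j * a j) = (\<Sum>j\<in>UNIV. if j = i then a j else 0)"
    by (rule sum.cong) (auto simp: axis_def)
  then show ?thesis using pd_eqI[OF assms, of i] by simp
qed

lemma smooth_par_fun: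
  assumes \<Psi>: "\<And>j. (\<lambda>t x. \<Psi> t x $ j) \<in> poly_fun" and "h \<in> par_fun \<Psi>"
  shows "smooth (h t)"
proof (rule smooth_coinduct[where A = "{h t | h. h \<in> par_fun \<Psi>}"], use assms in blast)
  fix g assume "g \<in> {h t | h. h \<in> par_fun \<Psi>}"
  then obtain h where h: "h \<in> par_fun \<Psi>" "g = h t" by blast
  obtain dh where dh: "\<And>i. dh i \<in> par_fun \<Psi>"
    "\<And>t x. (h t has_derivative (\<lambda>v. \<Sum>i\<in>UNIV. v $ i * dh i t x)) (at x)"
    using par_fun_derivative[OF \<Psi> h(1)] by blast
  have "pd i g = dh i t" for i
    using has_derivative_pd_sum[OF dh(2)] h(2) by (metis ext)
  then show "(\<forall>x. g differentiable (at x)) \<and> (\<forall>i. pd i g \<in> {h t | h. h \<in> par_fun \<Psi>})"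
    using dh h(2) differentiable_def by blast
qed

lemma par_fun_integrable:
  assumes "\<And>j. (\<lambda>t x. \<Psi> t x $ j) \<in> poly_fun" "k \<in> par_fun \<Psi>"
  shows "(\<lambda>t. k t y) integrable_on {0..1}"
proof -
  have "continuous_on UNIV (\<lambda>p. k (fst p) (snd p))"
    using par_fun_derivative[OF assms] by blast
  moreover have "continuous_on {0..1::real} (\<lambda>t. (t, y))" by (intro continuous_intros)
  ultimately have "continuous_on {0..1} (\<lambda>t. k t y)"
    using continuous_on_compose2[of UNIV "\<lambda>p. k (fst p) (snd p)" "{0..1}" "\<lambda>t. (t, y)"] by simp
  then show ?thesis by (rule integrable_continuous_real)
qed

lemma par_fun_integral_derivative:
  assumes \<Psi>: "\<And>j. (\<lambda>t x. \<Psi> t x $ j) \<in> poly_fun" and h: "h \<in> par_fun \<Psi>"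
    and dh: "\<And>i. dh i \<in> par_fun \<Psi>"
    "\<And>t x. (h t has_derivative (\<lambda>v. \<Sum>i\<in>UNIV. v $ i * dh i t x)) (at x)"
  shows "((\<lambda>x. integral {0..1} (\<lambda>t. h t x)) has_derivative
           (\<lambda>v. \<Sum>i\<in>UNIV. v $ i * integral {0..1} (\<lambda>t. dh i t x))) (at x)"
proof -
  have cont: "continuous_on S (\<lambda>p. k (fst p) (snd p))" if "k \<in> par_fun \<Psi>" for k S
    using par_fun_derivative[OF \<Psi> that] continuous_on_subset by blast
  have int: "(\<lambda>t. k t x) integrable_on {0..1}" if "k \<in> par_fun \<Psi>" for k x
    by (rule par_fun_integrable[OF \<Psi> that])
  \<comment> \<open>\<open>leibniz_rule\<close> wants the derivative as a continuous family of
    bounded linear maps. The \<open>b i\<close> are the coordinate functionals in that type, and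
    \<open>F\<close> assembles the gradient from them.\<close>
  define b where "b = (\<lambda>i::4. Blinfun (\<lambda>v::pt. v $ i))"
  have b: "blinfun_apply (b i) v = v $ i" for i v
    unfolding b_def by (subst bounded_linear_Blinfun_apply) (auto intro: bounded_linear_vec_nth)
  define F where "F = (\<lambda>x t. \<Sum>i\<in>UNIV. dh i t x *\<^sub>R b i)"
  have F: "blinfun_apply (F x t) v = (\<Sum>i\<in>UNIV. v $ i * dh i t x)" for x t v
    by (simp add: F_def b blinfun.sum_left blinfun.scaleR_left mult.commute)
  have cF: "continuous_on (UNIV \<times> cbox 0 1) (\<lambda>(x, t). F x t)"
  proof -
    have "continuous_on (UNIV \<times> cbox 0 1) (\<lambda>p. dh i (snd p) (fst p))" for i
    proof -
      have "continuous_on (UNIV \<times> cbox 0 1) (\<lambda>p::pt \<times> real. (snd p, fst p))"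
        by (intro continuous_intros)
      from continuous_on_compose2[OF cont[OF dh(1)[of i], of UNIV] this] show ?thesis by simp
    qed
    then show ?thesis
      unfolding F_def case_prod_unfold by (intro continuous_intros)
  qed
  have "((\<lambda>x. integral (cbox 0 1) (h' x)) has_derivative integral (cbox 0 1) (F x)) (at x within UNIV)"
    if h': "h' = (\<lambda>x t. h t x)" for h'
  proof (rule leibniz_rule[OF _ _ cF UNIV_I convex_UNIV])
    fix y t
    have "blinfun_apply (F y t) = (\<lambda>v. \<Sum>i\<in>UNIV. v $ i * dh i t y)" using F by blast
    then show "((\<lambda>x. h' x t) has_derivative blinfun_apply (F y t)) (at y)"
      using dh(2)[of t y] h' by simp
    show "h' y integrable_on cbox 0 1" using int[OF h, of y] by (simp add: h')
  qed
  moreover have "blinfun_apply (integral (cbox 0 1) (F x)) v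
      = (\<Sum>i\<in>UNIV. v $ i * integral {0..1} (\<lambda>t. dh i t x))" for v
  proof -
    have "continuous_on (cbox 0 1) (\<lambda>t::real. (x, t))" by (intro continuous_intros)
    from continuous_on_compose2[OF cF this] have "continuous_on (cbox 0 1) (F x)" by auto
    then have "F x integrable_on cbox 0 1" by (rule integrable_continuous)
    then have "blinfun_apply (integral (cbox 0 1) (F x)) v = integral (cbox 0 1) (\<lambda>t. F x t v)"
      by (rule blinfun_apply_integral)
    also have "\<dots> = integral {0..1} (\<lambda>t. \<Sum>i\<in>UNIV. v $ i * dh i t x)"
      by (simp add: F)
    also have "\<dots> = (\<Sum>i\<in>UNIV. v $ i * integral {0..1} (\<lambda>t. dh i t x))"
    proof -
      have "(\<lambda>t. v $ i * dh i t x) integrable_on {0..1}" for i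
        using integrable_on_cmult_left[OF int[OF dh(1)[of i], of x]] by simp
      then show ?thesis by (simp add: integral_sum)
    qed
    finally show ?thesis .
  qed
  then have "blinfun_apply (integral (cbox 0 1) (F x))
      = (\<lambda>v. \<Sum>i\<in>UNIV. v $ i * integral {0..1} (\<lambda>t. dh i t x))" by blast
  ultimately show ?thesis by simp
qed

lemma smooth_par_fun_integral:
  assumes \<Psi>: "\<And>j. (\<lambda>t x. \<Psi> t x $ j) \<in> poly_fun" and "h \<in> par_fun \<Psi>"
  shows "smooth (\<lambda>x. integral {0..1} (\<lambda>t. h t x))"
proof (rule smooth_coinduct[where A = "{\<lambda>x. integral {0..1} (\<lambda>t. h t x) | h. h \<in> par_fun \<Psi>}"], use assms in blast)
  let ?A = "{\<lambda>x. integral {0..1} (\<lambda>t. h t x) | h. h \<in> par_fun \<Psi>}"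
  fix g assume "g \<in> ?A"
  then obtain h where h: "h \<in> par_fun \<Psi>" "g = (\<lambda>x. integral {0..1} (\<lambda>t. h t x))" by blast
  obtain dh where dh: "\<And>i. dh i \<in> par_fun \<Psi>"
    "\<And>t x. (h t has_derivative (\<lambda>v. \<Sum>i\<in>UNIV. v $ i * dh i t x)) (at x)"
    using par_fun_derivative[OF \<Psi> h(1)] by blast
  note D = par_fun_integral_derivative[OF \<Psi> h(1) dh, folded h(2)]
  have "pd i g = (\<lambda>x. integral {0..1} (\<lambda>t. dh i t x))" for i
    using has_derivative_pd_sum[OF D] by blast
  then show "(\<forall>x. g differentiable (at x)) \<and> (\<forall>i. pd i g \<in> ?A)"
    using dh D differentiable_def by blast
qed

subsection \<open>Closure properties of smooth functions\<close>

lemma smooth_const: "smooth (\<lambda>x. c)"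
proof (rule smooth_coinduct[where A="{(\<lambda>x. c), (\<lambda>x. 0)}"])
  fix g :: "pt \<Rightarrow> 'a" assume "g \<in> {(\<lambda>x. c), (\<lambda>x. 0)}"
  then obtain a where "g = (\<lambda>x. a)" by blast
  then show "(\<forall>x. g differentiable (at x)) \<and> (\<forall>i. pd i g \<in> {(\<lambda>x. c), (\<lambda>x. 0)})"
    by (simp add: pd_def)
qed simp

text \<open>\<open>\<Psi>\<close> is the family \<open>\<lambda>t x. x\<close>, constant in
  \<open>t\<close>; the repeated product rule is then already contained in the closure of
  \<open>par_fun\<close>.\<close>

lemma smooth_mult:
  fixes f g :: "pt \<Rightarrow> real"
  assumes "smooth f" "smooth g"
  shows "smooth (\<lambda>x. f x * g x)"
  using smooth_par_fun[of "\<lambda>t x. x", OF poly_fun.coord par_fun.mult[OF par_fun.comp par_fun.comp], OF assms]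
  by simp

lemma smooth_coord: "smooth (\<lambda>x. x $ j)"
  using smooth_par_fun[of "\<lambda>t x. x", OF poly_fun.coord par_fun.poly[OF poly_fun.coord]] .

lemma pd_add:
  assumes "f differentiable (at x)" "g differentiable (at x)"
  shows "pd i (\<lambda>x. f x + g x) x = pd i f x + pd i g x"
  by (subst pd_eqI[OF has_derivative_add[OF assms[unfolded frechet_derivative_works]]])
     (simp add: pd_def)

lemma pd_mult:
  fixes f g :: "pt \<Rightarrow> real"
  assumes "f differentiable (at x)" "g differentiable (at x)"
  shows "pd i (\<lambda>x. f x * g x) x = f x * pd i g x + pd i f x * g x"
  by (subst pd_eqI[OF has_derivative_mult[OF assms[unfolded frechet_derivative_works]]])
     (simp add: pd_def)

lemma pd_const: "pd i (\<lambda>x. c) = (\<lambda>x. 0)"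
  by (simp add: pd_def)

lemma pd_coord: "pd i (\<lambda>x. x $ j) = (\<lambda>x. if i = j then 1 else 0)"
proof
  fix x show "pd i (\<lambda>x. x $ j) x = (if i = j then 1 else 0)"
    by (subst pd_eqI[OF bounded_linear_imp_has_derivative[OF bounded_linear_vec_nth]]) (simp add: axis_def)
qed

lemma pd_linear:
  assumes "bounded_linear L" "f differentiable (at x)"
  shows "pd i (\<lambda>x. L (f x)) x = L (pd i f x)"
  by (subst pd_eqI[OF bounded_linear.has_derivative[OF assms(1) assms(2)[unfolded frechet_derivative_works]]])
     (simp add: pd_def)

lemma partials_linear:
  assumes "bounded_linear L" "smooth f"
  shows "partials is (\<lambda>x. L (f x)) = (\<lambda>x. L (partials is f x))"
  by (induction "is")
     (use pd_linear[OF assms(1) smooth_differentiable[OF smooth_partials[OF assms(2)]]] in auto)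

lemma smooth_linear:
  assumes "bounded_linear L" "smooth f"
  shows "smooth (\<lambda>x. L (f x))"
  unfolding smooth_def partials_linear[OF assms]
  using smooth_differentiable[OF smooth_partials[OF assms(2)]] bounded_linear.has_derivative[OF assms(1)]
  unfolding differentiable_on_def differentiable_def by blast

lemma partials_add:
  assumes "smooth f" "smooth g"
  shows "partials is (\<lambda>x. f x + g x) = (\<lambda>x. partials is f x + partials is g x)"
proof (induction "is")
  case (Cons i "is")
  show ?case
    unfolding partials_Cons Cons
    by (rule ext pd_add smooth_differentiable smooth_partials assms)+
qed simp

lemma smooth_add:
  assumes "smooth f" "smooth g"
  shows "smooth (\<lambda>x. f x + g x)"
  unfolding smooth_def partials_add[OF assms] differentiable_on_def
  by (intro allI ballI differentiable_add smooth_differentiable smooth_partials assms)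

lemma smooth_scaleR: "smooth f \<Longrightarrow> smooth (\<lambda>x. c *\<^sub>R f x)"
  by (rule smooth_linear[OF bounded_linear_scaleR_right])

lemma partials_scaleR: "smooth f \<Longrightarrow> partials is (\<lambda>x. c *\<^sub>R f x) = (\<lambda>x. c *\<^sub>R partials is f x)"
  by (rule partials_linear[OF bounded_linear_scaleR_right])

lemma smooth_uminus: "smooth f \<Longrightarrow> smooth (\<lambda>x. - f x)"
  using smooth_scaleR[of f "-1"] by simp

lemma smooth_diff: "smooth f \<Longrightarrow> smooth g \<Longrightarrow> smooth (\<lambda>x. f x - g x)"
  using smooth_add[of f "\<lambda>x. - g x"] smooth_uminus[of g] by simp

lemma partials_diff:
  assumes "smooth f" "smooth g"
  shows "partials is (\<lambda>x. f x - g x) = (\<lambda>x. partials is f x - partials is g x)"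
  using partials_add[OF assms(1) smooth_scaleR[OF assms(2), of "-1"]] partials_scaleR[OF assms(2), of "is" "-1"]
  by simp

lemma smooth_sum: "finite I \<Longrightarrow> (\<And>i. i \<in> I \<Longrightarrow> smooth (f i)) \<Longrightarrow> smooth (\<lambda>x. \<Sum>i\<in>I. f i x)"
  by (induction I rule: finite_induct) (auto intro: smooth_const smooth_add)

lemmas smooth_intros = smooth_add smooth_diff smooth_uminus smooth_mult smooth_coord smooth_const
  smooth_pd smooth_scaleR

section \<open>Test functions and the LF topology\<close>

lemma pd_zero_outside:
  assumes "closed K" "\<And>x. x \<notin> K \<Longrightarrow> f x = 0" "x \<notin> K"
  shows "pd i f x = 0"
proof -
  have "((\<lambda>x. 0) has_derivative (\<lambda>h. 0)) (at x)" by simp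
  then have "(f has_derivative (\<lambda>h. 0)) (at x)"
    by (rule has_derivative_transform_within_open[of _ _ _ _ "- K"]) (use assms in auto)
  then show ?thesis by (rule pd_eqI)
qed

lemma partials_zero_outside:
  assumes "closed K" "\<And>x. x \<notin> K \<Longrightarrow> f x = 0" "x \<notin> K"
  shows "partials is f x = 0"
  using assms(3)
proof (induction "is" arbitrary: x)
  case (Cons i "is")
  then show ?case using pd_zero_outside[OF assms(1), of "partials is f"] by simp
qed (use assms(2) in simp)

lemma test_on_iff:
  assumes "closed K"
  shows "\<phi> \<in> test_on K S \<longleftrightarrow> smooth \<phi> \<and> range \<phi> \<subseteq> S \<and> (\<forall>x. x \<notin> K \<longrightarrow> \<phi> x = 0)"
proof -
  have "closure {x. \<phi> x \<noteq> 0} \<subseteq> K \<longleftrightarrow> (\<forall>x. x \<notin> K \<longrightarrow> \<phi> x = 0)"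
    using closure_minimal[OF _ assms, of "{x. \<phi> x \<noteq> 0}"] closure_subset[of "{x. \<phi> x \<noteq> 0}"]
    by (auto simp: subset_iff)
  then show ?thesis by (simp add: test_on_def)
qed

lemma test_eq_test_on: "\<phi> \<in> test S \<longleftrightarrow> (\<exists>K. compact K \<and> \<phi> \<in> test_on K S)"
proof -
  have "compact (closure A)" if "compact K" "closure A \<subseteq> K" for A K :: "pt set"
    using compact_Int_closed[OF that(1), of "closure A"] that(2) by (simp add: Int_absorb1)
  then show ?thesis unfolding test_def test_on_def by blast
qed

lemma test_iff:
  "\<phi> \<in> test S \<longleftrightarrow> smooth \<phi> \<and> range \<phi> \<subseteq> S \<and> (\<exists>K. compact K \<and> (\<forall>x. x \<notin> K \<longrightarrow> \<phi> x = 0))"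
proof -
  have "compact K \<and> \<phi> \<in> test_on K S \<longleftrightarrow>
      compact K \<and> smooth \<phi> \<and> range \<phi> \<subseteq> S \<and> (\<forall>x. x \<notin> K \<longrightarrow> \<phi> x = 0)" for K
    using test_on_iff[OF compact_imp_closed] by blast
  then show ?thesis unfolding test_eq_test_on by blast
qed

lemma testI:
  "\<lbrakk>smooth \<phi>; \<And>x. \<phi> x \<in> S; compact K; \<And>x. x \<notin> K \<Longrightarrow> \<phi> x = 0\<rbrakk> \<Longrightarrow> \<phi> \<in> test S"
  unfolding test_iff by blast

lemma subspace_test_on:
  assumes "subspace S" "closed K"
  shows "subspace (test_on K S)"
proof (rule subspaceI)
  show "0 \<in> test_on K S"
    using subspace_0[OF assms(1)] smooth_const[of 0] by (auto simp: test_on_iff[OF assms(2)] zero_fun_def)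
next
  fix \<phi> \<psi> assume "\<phi> \<in> test_on K S" "\<psi> \<in> test_on K S"
  then show "\<phi> + \<psi> \<in> test_on K S"
    using smooth_add[of \<phi> \<psi>] subspace_add[OF assms(1)]
    by (auto simp: test_on_iff[OF assms(2)] plus_fun_def image_subset_iff)
next
  fix c \<phi> assume "\<phi> \<in> test_on K S"
  then show "c *\<^sub>R \<phi> \<in> test_on K S"
    using smooth_scaleR[of \<phi> c] subspace_scale[OF assms(1)]
    by (auto simp: test_on_iff[OF assms(2)] scaleR_fun_def image_subset_iff)
qed

lemma test_on_mono: "K \<subseteq> K' \<Longrightarrow> test_on K S \<subseteq> test_on K' S"
  by (auto simp: test_on_def)

lemma test_on_subset_test: "compact K \<Longrightarrow> test_on K S \<subseteq> test S"
  by (auto simp: test_eq_test_on)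

lemma subspace_test:
  assumes "subspace S"
  shows "subspace (test S)"
proof (rule subspaceI)
  show "0 \<in> test S"
    using subspace_0[OF subspace_test_on[OF assms closed_empty]] by (auto simp: test_eq_test_on)
next
  fix \<phi> \<psi> assume "\<phi> \<in> test S" "\<psi> \<in> test S"
  then obtain K L where K: "compact K" "\<phi> \<in> test_on K S" and L: "compact L" "\<psi> \<in> test_on L S"
    by (auto simp: test_eq_test_on)
  then have "\<phi> + \<psi> \<in> test_on (K \<union> L) S"
    using subspace_add[OF subspace_test_on[OF assms]] test_on_mono[of K "K \<union> L" S]
      test_on_mono[of L "K \<union> L" S] by (meson Un_upper1 Un_upper2 compact_Un compact_imp_closed subsetD)
  then show "\<phi> + \<psi> \<in> test S" using K L compact_Un by (auto simp: test_eq_test_on)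
next
  fix c \<phi> assume "\<phi> \<in> test S"
  then show "c *\<^sub>R \<phi> \<in> test S"
    by (meson test_eq_test_on subspace_scale subspace_test_on assms compact_imp_closed)
qed

lemma partials_bounded:
  assumes "\<phi> \<in> test S" "finite L"
  shows "\<exists>B>0. \<forall>is\<in>L. \<forall>x. norm (partials is \<phi> x) \<le> B"
proof -
  obtain K where K: "compact K" "smooth \<phi>" "\<And>x. x \<notin> K \<Longrightarrow> \<phi> x = 0"
    using assms(1) by (auto simp: test_iff)
  have "\<exists>b. \<forall>x. norm (partials is \<phi> x) \<le> b" for "is"
  proof -
    have "bounded (partials is \<phi> ` K)"
      using K by (intro compact_imp_bounded compact_continuous_image smooth_continuous smooth_partials)
    then obtain b where "b > 0" "\<forall>x\<in>K. norm (partials is \<phi> x) \<le> b"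
      by (auto simp: bounded_pos)
    moreover have "partials is \<phi> x = 0" if "x \<notin> K" for x
      using partials_zero_outside[of K \<phi>] K that compact_imp_closed by blast
    ultimately show ?thesis by (metis norm_zero order_less_imp_le)
  qed
  then obtain b where b: "\<And>is x. norm (partials is \<phi> x) \<le> b is" by metis
  have "norm (partials is \<phi> x) \<le> 1 + (\<Sum>is\<in>L. \<bar>b is\<bar>)" if "is \<in> L" for "is" x
    using b[of "is" x] member_le_sum[of "is" L "\<lambda>is. \<bar>b is\<bar>"] that assms(2) by force
  moreover have "1 + (\<Sum>is\<in>L. \<bar>b is\<bar>) > 0" by (simp add: add_pos_nonneg sum_nonneg)
  ultimately show ?thesis by blast
qed

section \<open>Basic neighbourhoods in the Frechet and LF topologies\<close>

abbreviation small_on :: "4 list set \<Rightarrow> real \<Rightarrow> (pt \<Rightarrow> 'b::real_normed_vector) \<Rightarrow> bool" where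
  "small_on L \<delta> \<phi> \<equiv> \<forall>is\<in>L. \<forall>x. norm (partials is \<phi> x) < \<delta>"

abbreviation close_on ::
    "4 list set \<Rightarrow> real \<Rightarrow> (pt \<Rightarrow> 'b::real_normed_vector) \<Rightarrow> (pt \<Rightarrow> 'b) \<Rightarrow> bool" where
  "close_on L \<delta> \<psi> \<phi> \<equiv> \<forall>is\<in>L. \<forall>x. norm (partials is \<psi> x - partials is \<phi> x) < \<delta>"

text \<open>The subbasic sets are balls for a single derivative around arbitrary centres. They give
  a neighbourhood base because finitely many conditions merge into one \<open>L\<close> and
  \<open>\<delta>\<close>, and because each member of a ball is the centre of a smaller ball inside
  it.\<close>

lemma frechet_openin_iff:
  assumes K: "compact K"
  shows "openin (frechet_topology K S) A \<longleftrightarrow> A \<subseteq> test_on K S \<and>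
     (\<forall>\<phi>\<in>A. \<exists>L \<delta>. finite L \<and> \<delta> > 0 \<and> (\<forall>\<psi>\<in>test_on K S.
        close_on L \<delta> \<psi> \<phi> \<longrightarrow> \<psi> \<in> A))"
    (is "_ \<longleftrightarrow> ?R A")
proof
  assume "openin (frechet_topology K S) A"
  then have "generate_topology_on {{\<psi> \<in> test_on K S. \<forall>x. norm (partials is \<psi> x - partials is \<phi> x) < \<epsilon>} | is \<phi> \<epsilon>.
        \<phi> \<in> test_on K S \<and> \<epsilon> > 0} A"
    unfolding frechet_topology_def openin_topology_generated_by_iff .
  then show "?R A"
  proof induction
    case Empty
    then show ?case by simp
  next
    case (Int A B)
    show ?case
    proof (intro conjI ballI)
      fix \<phi> assume \<phi>: "\<phi> \<in> A \<inter> B"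
      obtain L \<delta> where 1: "finite L" "\<delta> > 0" "\<forall>\<psi>\<in>test_on K S.
        close_on L \<delta> \<psi> \<phi> \<longrightarrow> \<psi> \<in> A"
        using Int.IH(1) \<phi> by blast
      obtain L' \<delta>' where 2: "finite L'" "\<delta>' > 0" "\<forall>\<psi>\<in>test_on K S.
        close_on L' \<delta>' \<psi> \<phi> \<longrightarrow> \<psi> \<in> B"
        using Int.IH(2) \<phi> by blast
      show "\<exists>L \<delta>. finite L \<and> \<delta> > 0 \<and> (\<forall>\<psi>\<in>test_on K S.
        close_on L \<delta> \<psi> \<phi> \<longrightarrow> \<psi> \<in> A \<inter> B)"
        by (rule exI[of _ "L \<union> L'"], rule exI[of _ "min \<delta> \<delta>'"]) (use 1 2 in auto)
    qed (use Int in auto)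
  next
    case (UN \<K>)
    show ?case
    proof (intro conjI ballI)
      fix \<phi> assume "\<phi> \<in> \<Union>\<K>"
      then obtain A where A: "A \<in> \<K>" "\<phi> \<in> A" by blast
      with UN.IH[OF A(1)] show "\<exists>L \<delta>. finite L \<and> \<delta> > 0 \<and> (\<forall>\<psi>\<in>test_on K S.
        close_on L \<delta> \<psi> \<phi> \<longrightarrow> \<psi> \<in> \<Union>\<K>)" 
        by (meson UnionI)
    qed (use UN.IH in blast)
  next
    case (Basis A)
    then obtain "is" \<phi> \<epsilon> where A: "A = {\<psi> \<in> test_on K S. \<forall>x. norm (partials is \<psi> x - partials is \<phi> x) < \<epsilon>}"
      "\<phi> \<in> test_on K S" "\<epsilon> > 0" by blast
    show ?case
    proof (intro conjI ballI)
      fix \<psi> assume \<psi>: "\<psi> \<in> A"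
      note D = test_on_iff[OF compact_imp_closed[OF K], of _ S]
      have zero: "partials is \<zeta> x = 0" if "\<zeta> \<in> test_on K S" "x \<notin> K" for \<zeta> x
        using partials_zero_outside[of K \<zeta> x "is"] that D compact_imp_closed[OF K] by blast
      \<comment> \<open>A pointwise strict bound leaves no margin by itself. On the compact
        \<open>K\<close> the maximum is attained, hence below \<open>\<epsilon>\<close>, and outside
        \<open>K\<close> both functions vanish; \<open>\<epsilon> - m\<close> then serves as
        radius.\<close>
      have "\<exists>m<\<epsilon>. \<forall>x\<in>K. norm (partials is \<psi> x - partials is \<phi> x) \<le> m"
      proof (cases "K = {}")
        case True
        then show ?thesis using A(3) by auto
      next
        case False
        have "smooth \<psi>" "smooth \<phi>" using \<psi> A D by auto
        then have "continuous_on K (\<lambda>x. norm (partials is \<psi> x - partials is \<phi> x))"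
          by (intro continuous_intros smooth_continuous smooth_partials)
        from continuous_attains_sup[OF K False this] show ?thesis
          using \<psi> A(1) by blast
      qed
      then obtain m where m: "m < \<epsilon>" "\<And>x. x \<in> K \<Longrightarrow> norm (partials is \<psi> x - partials is \<phi> x) \<le> m" by blast
      have "\<zeta> \<in> A" if \<zeta>: "\<zeta> \<in> test_on K S" "\<forall>x. norm (partials is \<zeta> x - partials is \<psi> x) < \<epsilon> - m" for \<zeta>
      proof -
        have "norm (partials is \<zeta> x - partials is \<phi> x) < \<epsilon>" for x
        proof (cases "x \<in> K")
          case True
          have "norm (partials is \<zeta> x - partials is \<phi> x)
              \<le> norm (partials is \<zeta> x - partials is \<psi> x) + norm (partials is \<psi> x - partials is \<phi> x)"
            using norm_triangle_ineq[of "partials is \<zeta> x - partials is \<psi> x" "partials is \<psi> x - partials is \<phi> x"]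
            by simp
          with m(2)[OF True] \<zeta>(2) show ?thesis by (smt (verit))
        qed (use zero \<zeta>(1) A(2,3) in auto)
        then show ?thesis using A(1) \<zeta>(1) by blast
      qed
      then show "\<exists>L \<delta>. finite L \<and> \<delta> > 0 \<and> (\<forall>\<zeta>\<in>test_on K S.
        close_on L \<delta> \<zeta> \<psi> \<longrightarrow> \<zeta> \<in> A)"
        by (intro exI[of _ "{is}"] exI[of _ "\<epsilon> - m"]) (use m(1) in auto)
    qed (use A in auto)
  qed
next
  assume R: "?R A"
  let ?N = "\<lambda>is \<phi> \<delta>. {\<psi> \<in> test_on K S. \<forall>x. norm (partials is \<psi> x - partials is \<phi> x) < \<delta>}"
  show "openin (frechet_topology K S) A"
  proof (subst openin_subopen, intro ballI)
    fix \<phi> assume \<phi>: "\<phi> \<in> A"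
    then obtain L \<delta> where L: "finite L" "\<delta> > 0" "\<forall>\<psi>\<in>test_on K S.
        close_on L \<delta> \<psi> \<phi> \<longrightarrow> \<psi> \<in> A"
      using R by blast
    have \<phi>': "\<phi> \<in> test_on K S" using R \<phi> by blast
    \<comment> \<open>Inserting the empty list keeps the index set nonempty; over an empty
      \<open>L\<close> the intersection would be the whole type instead of
      \<open>test_on K S\<close>.\<close>
    have "openin (frechet_topology K S) (?N is \<phi> \<delta>)" for "is"
      unfolding frechet_topology_def openin_topology_generated_by_iff
      using \<phi>' L(2) by (intro generate_topology_on.Basis) blast
    then have "openin (frechet_topology K S) (\<Inter>is\<in>insert [] L. ?N is \<phi> \<delta>)"
      using L(1) by (intro openin_Inter) (auto simp del: partials.simps)
    moreover have "\<phi> \<in> (\<Inter>is\<in>insert [] L. ?N is \<phi> \<delta>)" using \<phi>' L(2) by auto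
    moreover have "(\<Inter>is\<in>insert [] L. ?N is \<phi> \<delta>) \<subseteq> A" using L(3) by auto
    ultimately show "\<exists>T. openin (frechet_topology K S) T \<and> \<phi> \<in> T \<and> T \<subseteq> A" by blast
  qed
qed

text \<open>The support of \<open>\<phi>\<close> may leave \<open>K\<close>, so the trace of
  \<open>W\<close> is used on a larger compact set containing both. Differences of translated
  functions do not see \<open>\<phi>\<close>, hence the same \<open>L\<close> and
  \<open>\<delta>\<close> work.\<close>

lemma translate_frechet_open:
  assumes S: "subspace S" and \<phi>: "\<phi> \<in> test S" and W: "W \<in> LF_nhds0 S" and K: "compact K"
  shows "openin (frechet_topology K S) ((+) \<phi> ` W \<inter> test_on K S)"
  unfolding frechet_openin_iff[OF K]
proof (intro conjI ballI)
  fix \<psi> assume \<psi>: "\<psi> \<in> (+) \<phi> ` W \<inter> test_on K S"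
  obtain K0 where K0: "compact K0" "\<phi> \<in> test_on K0 S" using \<phi> by (auto simp: test_eq_test_on)
  let ?K = "K \<union> K0"
  have cK: "compact ?K" using K K0 compact_Un by blast
  have diff: "\<zeta> - \<phi> \<in> test_on ?K S" if "\<zeta> \<in> test_on K S" for \<zeta>
    using subspace_diff[OF subspace_test_on[OF S compact_imp_closed[OF cK]]] that K0
      test_on_mono[of K ?K S] test_on_mono[of K0 ?K S] by blast
  have "openin (frechet_topology ?K S) (W \<inter> test_on ?K S)"
    using W cK by (auto simp: LF_nhds0_def)
  moreover have "\<psi> - \<phi> \<in> W \<inter> test_on ?K S" using \<psi> diff by auto
  ultimately obtain L \<delta> where L: "finite L" "\<delta> > 0" "\<forall>\<zeta>\<in>test_on ?K S.
     (\<forall>is\<in>L. \<forall>x. norm (partials is \<zeta> x - partials is (\<psi> - \<phi>) x) < \<delta>) \<longrightarrow> \<zeta> \<in> W \<inter> test_on ?K S"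
    unfolding frechet_openin_iff[OF cK] by blast
  have sm: "smooth \<zeta>" if "\<zeta> \<in> test_on K S" for \<zeta>
    using that by (simp add: test_on_def)
  have s\<phi>: "smooth \<phi>" using \<phi> by (simp add: test_def)
  have "\<zeta> \<in> (+) \<phi> ` W \<inter> test_on K S"
    if \<zeta>: "\<zeta> \<in> test_on K S" "close_on L \<delta> \<zeta> \<psi>" for \<zeta>
  proof -
    have "partials is (\<zeta> - \<phi>) x - partials is (\<psi> - \<phi>) x = partials is \<zeta> x - partials is \<psi> x" for "is" x
      using partials_diff[OF sm[OF \<zeta>(1)] s\<phi>] partials_diff[OF sm s\<phi>, of \<psi>] \<psi>
      by (simp add: fun_diff_def)
    then have "\<zeta> - \<phi> \<in> W" using L(3) diff[OF \<zeta>(1)] \<zeta>(2) by auto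
    then have "\<phi> + (\<zeta> - \<phi>) \<in> (+) \<phi> ` W" by blast
    then show ?thesis using \<zeta>(1) by simp
  qed
  then show "\<exists>L \<delta>. finite L \<and> \<delta> > 0 \<and> (\<forall>\<zeta>\<in>test_on K S.
      close_on L \<delta> \<zeta> \<psi> \<longrightarrow> \<zeta> \<in> (+) \<phi> ` W \<inter> test_on K S)"
    using L(1,2) by blast
qed simp

text \<open>Convexity and open traces pass to translates and to finite intersections, so they
  survive the generation of the topology from a subbase; balancedness is lost under
  translation.\<close>

lemma LF_open_convex_nhd:
  assumes S: "subspace S" and U: "openin (LF_topology S) U" and "\<phi> \<in> U"
  shows "\<exists>W\<subseteq>U. \<phi> \<in> W \<and> convex W \<and> (\<forall>K. compact K \<longrightarrow> openin (frechet_topology K S) (W \<inter> test_on K S))"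
proof -
  have "generate_topology_on {(+) \<phi> ` W | \<phi> W. \<phi> \<in> test S \<and> W \<in> LF_nhds0 S} U"
    using U unfolding LF_topology_def openin_topology_generated_by_iff .
  then show ?thesis using assms(3)
  proof (induction arbitrary: \<phi>)
    case (Int A B)
    obtain V where V: "V \<subseteq> A" "\<phi> \<in> V" "convex V"
      "\<forall>K. compact K \<longrightarrow> openin (frechet_topology K S) (V \<inter> test_on K S)"
      using Int.IH(1)[of \<phi>] Int.prems by blast
    obtain W where W: "W \<subseteq> B" "\<phi> \<in> W" "convex W"
      "\<forall>K. compact K \<longrightarrow> openin (frechet_topology K S) (W \<inter> test_on K S)"
      using Int.IH(2)[of \<phi>] Int.prems by blast
    have "V \<inter> W \<inter> C = (V \<inter> C) \<inter> (W \<inter> C)" for C by blast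
    then show ?case using V W by (intro exI[of _ "V \<inter> W"]) (auto intro: convex_Int)
  next
    case (UN \<K>)
    then show ?case by (meson UnionE Union_upper order_trans)
  next
    case (Basis A)
    then obtain \<psi> W where "A = (+) \<psi> ` W" "\<psi> \<in> test S" "W \<in> LF_nhds0 S" by blast
    then show ?case using Basis translate_frechet_open[OF S]
      by (intro exI[of _ A]) (auto simp: LF_nhds0_def convex_translation)
  qed simp
qed

lemma topspace_LF_topology:
  assumes "subspace S"
  shows "topspace (LF_topology S) = test S"
proof -
  have "openin (frechet_topology K S) (test S \<inter> test_on K S)" if "compact K" for K
    unfolding frechet_openin_iff[OF that] using test_on_subset_test[OF that, of S]
    by (auto intro!: exI[of _ "{}"] exI[of _ "1::real"])
  then have "test S \<in> LF_nhds0 S"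
    using subspace_test[OF assms] by (auto simp: LF_nhds0_def subspace_imp_convex subspace_scale)
  then have "(+) 0 ` test S \<in> {(+) \<phi> ` W | \<phi> W. \<phi> \<in> test S \<and> W \<in> LF_nhds0 S}"
    using subspace_0[OF subspace_test[OF assms]] by blast
  moreover have "(+) \<phi> ` W \<subseteq> test S" if "\<phi> \<in> test S" "W \<in> LF_nhds0 S" for \<phi> W
    using that subspace_add[OF subspace_test[OF assms]] by (auto simp: LF_nhds0_def)
  ultimately show ?thesis
    unfolding LF_topology_def topology_generated_by_topspace by auto
qed

section \<open>Linear functionals on test forms and their continuity\<close>

definition linear_on :: "'a::real_vector set \<Rightarrow> ('a \<Rightarrow> real) \<Rightarrow> bool" where
  "linear_on V T \<longleftrightarrow> (\<forall>x\<in>V. \<forall>y\<in>V. T (x + y) = T x + T y) \<and> (\<forall>c. \<forall>x\<in>V. T (c *\<^sub>R x) = c * T x)"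

lemma linear_onD:
  assumes "linear_on V T"
  shows "\<lbrakk>x \<in> V; y \<in> V\<rbrakk> \<Longrightarrow> T (x + y) = T x + T y" "x \<in> V \<Longrightarrow> T (c *\<^sub>R x) = c * T x"
  using assms by (auto simp: linear_on_def)

lemma linear_on_diff: "\<lbrakk>linear_on V T; subspace V; x \<in> V; y \<in> V\<rbrakk> \<Longrightarrow> T (x - y) = T x - T y"
  using linear_onD(1)[of V T "x - y" y] by (simp add: subspace_diff)

lemma linear_on_0: "\<lbrakk>linear_on V T; subspace V\<rbrakk> \<Longrightarrow> T 0 = 0"
  using linear_onD(2)[of V T 0 0] by (simp add: subspace_0)

lemma linear_on_minus: "\<lbrakk>linear_on V T; x \<in> V\<rbrakk> \<Longrightarrow> T (- x) = - T x"
  using linear_onD(2)[of V T x "-1"] by simp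

text \<open>The usual estimate by finitely many derivative seminorms, written as a bound by 1 on a
  basic neighbourhood of zero; \<open>bounded_on_testsD\<close> rescales it to any bound.\<close>

definition bounded_on_tests :: "'b::real_normed_vector set \<Rightarrow> ((pt \<Rightarrow> 'b) \<Rightarrow> real) \<Rightarrow> bool" where
  "bounded_on_tests S T \<longleftrightarrow> (\<forall>K. compact K \<longrightarrow> (\<exists>L \<delta>. finite L \<and> \<delta> > 0 \<and>
     (\<forall>\<phi>\<in>test_on K S. small_on L \<delta> \<phi> \<longrightarrow> \<bar>T \<phi>\<bar> \<le> 1)))"

lemma partials_zero: "partials is (\<lambda>x. 0) = (\<lambda>x. 0)" "partials is 0 = (\<lambda>x. 0)"
  by (induction "is") (auto simp: pd_const zero_fun_def)

lemma bounded_on_testsD: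
  assumes "bounded_on_tests S T" "linear_on (test S) T" "subspace S" "compact K" "\<epsilon> > 0"
  shows "\<exists>L \<delta>. finite L \<and> \<delta> > 0 \<and>
     (\<forall>\<phi>\<in>test_on K S. small_on L \<delta> \<phi> \<longrightarrow> \<bar>T \<phi>\<bar> \<le> \<epsilon>)"
proof -
  obtain L \<delta> where L: "finite L" "\<delta> > 0"
     "\<forall>\<phi>\<in>test_on K S. small_on L \<delta> \<phi> \<longrightarrow> \<bar>T \<phi>\<bar> \<le> 1"
    using assms(1,4) unfolding bounded_on_tests_def by blast
  have "\<bar>T \<phi>\<bar> \<le> \<epsilon>" if \<phi>: "\<phi> \<in> test_on K S" "\<forall>is\<in>L. \<forall>x. norm (partials is \<phi> x) < \<delta> * \<epsilon>" for \<phi>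
  proof -
    have sm: "smooth \<phi>" using \<phi>(1) by (simp add: test_on_def)
    have "norm (partials is ((1/\<epsilon>) *\<^sub>R \<phi>) x) < \<delta>" if "is \<in> L" for "is" x
      using \<phi>(2) that assms(5) by (simp add: scaleR_fun_def partials_scaleR[OF sm] field_simps)
    moreover have "(1/\<epsilon>) *\<^sub>R \<phi> \<in> test_on K S"
      using subspace_scale[OF subspace_test_on[OF assms(3) compact_imp_closed[OF assms(4)]]] \<phi>(1) by blast
    ultimately have "\<bar>T ((1/\<epsilon>) *\<^sub>R \<phi>)\<bar> \<le> 1" using L(3) by blast
    moreover have "T ((1/\<epsilon>) *\<^sub>R \<phi>) = (1/\<epsilon>) * T \<phi>"
      using linear_onD(2)[OF assms(2)] \<phi>(1) test_on_subset_test[OF assms(4)] by blast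
    ultimately show ?thesis using assms(5) by (simp add: abs_mult field_simps)
  qed
  then show ?thesis using L(1,2) assms(5) by (intro exI[of _ L] exI[of _ "\<delta> * \<epsilon>"]) auto
qed

text \<open>In one direction the preimage of (-1, 1) contains a convex neighbourhood, whose trace on
  \<open>K\<close> gives the estimate. In the other the strips
  \<open>\<bar>T \<psi>\<bar> < \<epsilon>\<close> belong to \<open>LF_nhds0\<close>, and their
  translates fit into the preimage of any open set.\<close>

lemma LF_continuous_iff:
  assumes S: "subspace S" and T: "linear_on (test S) T"
  shows "continuous_map (LF_topology S) euclideanreal T \<longleftrightarrow> bounded_on_tests S T"
proof
  assume cont: "continuous_map (LF_topology S) euclideanreal T"
  let ?U = "{\<phi> \<in> topspace (LF_topology S). T \<phi> \<in> {-1<..<1}}"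
  have "openin (LF_topology S) ?U"
    using cont by (rule openin_continuous_map_preimage) simp
  moreover have "0 \<in> ?U"
    using linear_on_0[OF T subspace_test[OF S]] subspace_0[OF subspace_test[OF S]] topspace_LF_topology[OF S] by auto
  ultimately obtain W where W: "W \<subseteq> ?U" "0 \<in> W"
    "\<forall>K. compact K \<longrightarrow> openin (frechet_topology K S) (W \<inter> test_on K S)"
    using LF_open_convex_nhd[OF S] by meson
  show "bounded_on_tests S T"
    unfolding bounded_on_tests_def
  proof (intro allI impI)
    fix K :: "pt set" assume K: "compact K"
    have "0 \<in> W \<inter> test_on K S"
      using W(2) subspace_0[OF subspace_test_on[OF S compact_imp_closed[OF K]]] by blast
    moreover have "openin (frechet_topology K S) (W \<inter> test_on K S)" using W(3) K by blast
    ultimately obtain L \<delta> where L: "finite L" "\<delta> > 0" "\<forall>\<psi>\<in>test_on K S.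
        close_on L \<delta> \<psi> 0 \<longrightarrow> \<psi> \<in> W \<inter> test_on K S"
      unfolding frechet_openin_iff[OF K] by blast
    have "\<bar>T \<phi>\<bar> \<le> 1" if "\<phi> \<in> test_on K S" "small_on L \<delta> \<phi>" for \<phi>
    proof -
      have "\<phi> \<in> W" using L(3) that by (simp add: partials_zero)
      then show ?thesis using W(1) by auto
    qed
    then
    show "\<exists>L \<delta>. finite L \<and> \<delta> > 0 \<and>
     (\<forall>\<phi>\<in>test_on K S. small_on L \<delta> \<phi> \<longrightarrow> \<bar>T \<phi>\<bar> \<le> 1)"
      using L(1,2) by blast
  qed
next
  assume B: "bounded_on_tests S T"
  show "continuous_map (LF_topology S) euclideanreal T"
    unfolding continuous_map_def
  proof (intro conjI allI impI)
    fix U :: "real set" assume U: "openin euclideanreal U"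
    show "openin (LF_topology S) {\<phi> \<in> topspace (LF_topology S). T \<phi> \<in> U}"
    proof (subst openin_subopen, intro ballI)
      fix \<phi> assume "\<phi> \<in> {\<phi> \<in> topspace (LF_topology S). T \<phi> \<in> U}"
      then have \<phi>: "\<phi> \<in> test S" "T \<phi> \<in> U" by (auto simp: topspace_LF_topology[OF S])
      obtain \<epsilon> where \<epsilon>: "\<epsilon> > 0" "\<And>y. \<bar>y - T \<phi>\<bar> < \<epsilon> \<Longrightarrow> y \<in> U"
        using U \<phi>(2) unfolding open_openin[symmetric] open_dist dist_real_def by blast
      let ?W = "{\<psi> \<in> test S. \<bar>T \<psi>\<bar> < \<epsilon>}"
      have "?W \<in> LF_nhds0 S"
        unfolding LF_nhds0_def
      proof (rule CollectI, intro conjI allI impI ballI)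
        show "convex ?W"
        proof (rule convexI)
          fix \<psi> \<zeta> and u v :: real
          assume *: "\<psi> \<in> ?W" "\<zeta> \<in> ?W" "0 \<le> u" "0 \<le> v" "u + v = 1"
          then have m: "u *\<^sub>R \<psi> \<in> test S" "v *\<^sub>R \<zeta> \<in> test S"
            using subspace_scale[OF subspace_test[OF S]] by auto
          then have "T (u *\<^sub>R \<psi> + v *\<^sub>R \<zeta>) = u * T \<psi> + v * T \<zeta>"
            using * by (simp add: linear_onD[OF T])
          moreover have "\<bar>u * T \<psi> + v * T \<zeta>\<bar> < \<epsilon>"
          proof (rule order_le_less_trans)
            show "\<bar>u * T \<psi> + v * T \<zeta>\<bar> \<le> u * \<bar>T \<psi>\<bar> + v * \<bar>T \<zeta>\<bar>"
              by (rule order_trans[OF abs_triangle_ineq]) (use * in \<open>simp add: abs_mult\<close>)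
            show "u * \<bar>T \<psi>\<bar> + v * \<bar>T \<zeta>\<bar> < \<epsilon>"
              using convex_bound_lt[of "\<bar>T \<psi>\<bar>" \<epsilon> "\<bar>T \<zeta>\<bar>" u v] * by simp
          qed
          ultimately show "u *\<^sub>R \<psi> + v *\<^sub>R \<zeta> \<in> ?W"
            using m subspace_add[OF subspace_test[OF S]] by auto
        qed
        fix c :: real and \<psi> assume "\<bar>c\<bar> \<le> 1" "\<psi> \<in> ?W"
        then show "c *\<^sub>R \<psi> \<in> ?W"
          using subspace_scale[OF subspace_test[OF S]] mult_left_le_one_le[of "\<bar>T \<psi>\<bar>" "\<bar>c\<bar>"]
          by (auto simp: linear_onD[OF T] abs_mult)
      next
        fix K :: "pt set" assume K: "compact K"
        note KS = subspace_test_on[OF S compact_imp_closed[OF K]]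
        show "openin (frechet_topology K S) (?W \<inter> test_on K S)"
          unfolding frechet_openin_iff[OF K]
        proof (intro conjI ballI)
          fix \<psi> assume \<psi>: "\<psi> \<in> ?W \<inter> test_on K S"
          \<comment> \<open>Half of the room below \<open>\<epsilon>\<close>: changing
            \<open>T \<psi>\<close> by at most \<open>e\<close> keeps the inequality strict.\<close>
          define e where "e = (\<epsilon> - \<bar>T \<psi>\<bar>) / 2"
          have e: "e > 0" using \<psi> by (simp add: e_def)
          obtain L \<delta> where L: "finite L" "\<delta> > 0"
            "\<forall>\<phi>\<in>test_on K S. small_on L \<delta> \<phi> \<longrightarrow> \<bar>T \<phi>\<bar> \<le> e"
            using bounded_on_testsD[OF B T S K e] by blast
          have "\<zeta> \<in> ?W \<inter> test_on K S"
            if \<zeta>: "\<zeta> \<in> test_on K S" "close_on L \<delta> \<zeta> \<psi>" for \<zeta>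
          proof -
            have "smooth \<zeta>" "smooth \<psi>" using \<zeta>(1) \<psi> by (auto simp: test_on_def)
            then have "\<bar>T (\<zeta> - \<psi>)\<bar> \<le> e"
              using L(3) subspace_diff[OF KS \<zeta>(1), of \<psi>] \<psi> \<zeta>(2) by (simp add: fun_diff_def partials_diff)
            moreover have "T (\<zeta> - \<psi>) = T \<zeta> - T \<psi>"
              using linear_on_diff[OF T subspace_test[OF S]] \<zeta>(1) \<psi> test_on_subset_test[OF K] by blast
            ultimately have "\<bar>T \<zeta> - T \<psi>\<bar> \<le> (\<epsilon> - \<bar>T \<psi>\<bar>) / 2" "\<bar>T \<psi>\<bar> < \<epsilon>"
              using \<psi> by (auto simp: e_def)
            then have "\<bar>T \<zeta>\<bar> < \<epsilon>"
              using abs_triangle_ineq2[of "T \<zeta>" "T \<psi>"] by argo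
            then show ?thesis using \<zeta>(1) test_on_subset_test[OF K] by blast
          qed
          then show "\<exists>L \<delta>. finite L \<and> \<delta> > 0 \<and> (\<forall>\<zeta>\<in>test_on K S.
            close_on L \<delta> \<zeta> \<psi> \<longrightarrow> \<zeta> \<in> ?W \<inter> test_on K S)"
            using L(1,2) by blast
        qed simp
      qed auto
      then have "openin (LF_topology S) ((+) \<phi> ` ?W)"
        unfolding LF_topology_def openin_topology_generated_by_iff
        using \<phi>(1) by (intro generate_topology_on.Basis) blast
      moreover have "\<phi> \<in> (+) \<phi> ` ?W"
        using subspace_0[OF subspace_test[OF S]] linear_on_0[OF T subspace_test[OF S]] \<epsilon>(1)
        by (intro image_eqI[of _ _ 0]) auto
      moreover have "(+) \<phi> ` ?W \<subseteq> {\<phi> \<in> topspace (LF_topology S). T \<phi> \<in> U}"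
        using \<phi>(1) \<epsilon>(2) subspace_add[OF subspace_test[OF S]]
        by (auto simp: topspace_LF_topology[OF S] linear_onD[OF T])
      ultimately show "\<exists>V. openin (LF_topology S) V \<and> \<phi> \<in> V \<and> V \<subseteq> {\<phi> \<in> topspace (LF_topology S). T \<phi> \<in> U}"
        by blast
    qed
  qed simp
qed

lemma dual_LF_iff:
  assumes "subspace S"
  shows "T \<in> dual (subsp (test S)) (LF_topology S) \<longleftrightarrow>
    linear_on (test S) T \<and> bounded_on_tests S T \<and> (\<forall>\<phi>. \<phi> \<notin> test S \<longrightarrow> T \<phi> = 0)"
  using LF_continuous_iff[OF assms, of T]
  by (auto simp: dual_def subsp_def linear_on_def)

section \<open>Extension of functionals and duals of quotients\<close>

lemma subspace_Union_chain:
  assumes "\<C> \<noteq> {}" "subset.chain A \<C>" "\<And>G. G \<in> A \<Longrightarrow> subspace G"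
  shows "subspace (\<Union>\<C>)"
proof (rule subspaceI)
  have C: "\<C> \<subseteq> A" "\<And>G H. G \<in> \<C> \<Longrightarrow> H \<in> \<C> \<Longrightarrow> G \<subseteq> H \<or> H \<subseteq> G"
    using assms(2) by (auto simp: subset_chain_def)
  then show "0 \<in> \<Union>\<C>" using assms(1,3) subspace_0 by fast
  show "c *\<^sub>R x \<in> \<Union>\<C>" if "x \<in> \<Union>\<C>" for c x
    using that C(1) assms(3) by (meson UnionE UnionI subsetD subspace_scale)
  show "x + y \<in> \<Union>\<C>" if "x \<in> \<Union>\<C>" "y \<in> \<Union>\<C>" for x y
  proof -
    obtain G H where GH: "x \<in> G" "G \<in> \<C>" "y \<in> H" "H \<in> \<C>" using \<open>x \<in> \<Union>\<C>\<close> \<open>y \<in> \<Union>\<C>\<close> by blast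
    then consider "G \<subseteq> H" | "H \<subseteq> G" using C(2) by blast
    then show ?thesis
    proof cases
      case 1
      then show ?thesis using GH subspace_add[OF assms(3), of H x y] C(1) by blast
    next
      case 2
      then show ?thesis using GH subspace_add[OF assms(3), of G x y] C(1) by blast
    qed
  qed
qed

text \<open>The geometric form of the Hahn-Banach theorem. Partial extensions are subspaces \<open>G\<close> of
  \<open>V \<times> \<real>\<close> such that \<open>r \<le> 1\<close> whenever \<open>(x, r) \<in> G\<close> and \<open>x \<in> W\<close>; since \<open>0 \<in> W\<close>, this already forces
  \<open>G\<close> to be the graph of a function.\<close>

lemma convex_separation_step:
  fixes G :: "('a::real_vector \<times> real) set"
  assumes G: "subspace G" and W: "convex W" and le: "\<And>x r. (x, r) \<in> G \<Longrightarrow> x \<in> W \<Longrightarrow> r \<le> 1"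
    and x0: "\<exists>\<epsilon>>0. \<epsilon> *\<^sub>R x0 \<in> W" "\<exists>\<epsilon>>0. \<epsilon> *\<^sub>R (- x0) \<in> W"
  shows "\<exists>a. \<forall>y r c. (y, r) \<in> G \<longrightarrow> y + c *\<^sub>R x0 \<in> W \<longrightarrow> r + c * a \<le> 1"
proof -
  \<comment> \<open>For a value \<open>a\<close> at \<open>x0\<close>, the requirement
    \<open>r + c * a \<le> 1\<close> bounds \<open>a\<close> from above by the elements of
    \<open>U\<close> (positive coefficients) and from below by those of \<open>V\<close> (negative
    coefficients, with \<open>c\<close> replaced by its absolute value).\<close>
  define U where "U = {(1 - r) / c | y r c. (y, r) \<in> G \<and> c > 0 \<and> y + c *\<^sub>R x0 \<in> W}"
  define V where "V = {(r - 1) / c | y r c. (y, r) \<in> G \<and> c > 0 \<and> y - c *\<^sub>R x0 \<in> W}"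
  have G0: "(0, 0) \<in> G" using subspace_0[OF G] by (simp add: zero_prod_def)
  have "U \<noteq> {}" "V \<noteq> {}"
    using x0 G0 unfolding U_def V_def by force+
  have VU: "v \<le> u" if "u \<in> U" "v \<in> V" for u v
  proof -
    obtain y r c where 1: "u = (1 - r) / c" "(y, r) \<in> G" "c > 0" "y + c *\<^sub>R x0 \<in> W"
      using \<open>u \<in> U\<close> unfolding U_def by blast
    obtain y' r' c' where 2: "v = (r' - 1) / c'" "(y', r') \<in> G" "c' > 0" "y' - c' *\<^sub>R x0 \<in> W"
      using \<open>v \<in> V\<close> unfolding V_def by blast
    \<comment> \<open>The weights are chosen so that the multiples of \<open>x0\<close> cancel. What
      remains lies in \<open>W\<close> and is the first component of an element of \<open>G\<close>,
      so \<open>le\<close> applies.\<close>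
    have "(c' / (c + c')) *\<^sub>R (y + c *\<^sub>R x0) + (c / (c + c')) *\<^sub>R (y' - c' *\<^sub>R x0) \<in> W"
      using 1 2 by (intro convexD[OF W]) (simp_all add: add.commute flip: add_divide_distrib)
    moreover have "(c' / (c + c')) *\<^sub>R (y, r) + (c / (c + c')) *\<^sub>R (y', r') \<in> G"
      using 1 2 by (intro subspace_add[OF G] subspace_scale[OF G])
    ultimately have "c' / (c + c') * r + c / (c + c') * r' \<le> 1"
      by (intro le[of "(c' / (c + c')) *\<^sub>R y + (c / (c + c')) *\<^sub>R y'"])
         (auto simp: algebra_simps mult.commute)
    then have "(c' * r + c * r') / (c + c') \<le> 1" by (simp add: add_divide_distrib)
    then have "c' * r + c * r' \<le> c + c'" using 1 2 by (simp add: pos_divide_le_eq)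
    moreover have "c * u = 1 - r" "c' * v = r' - 1" using 1 2 by auto
    ultimately have "c * (c' * v) \<le> c' * (c * u)" by (simp only:) (simp add: algebra_simps)
    then have "(c * c') * v \<le> (c * c') * u" by (simp add: ac_simps)
    then show ?thesis using 1 2 by (simp only: mult_le_cancel_left_pos mult_pos_pos)
  qed
  define a where "a = Sup V"
  have a1: "v \<le> a" if "v \<in> V" for v
  proof -
    obtain u where "u \<in> U" using \<open>U \<noteq> {}\<close> by blast
    then have "bdd_above V" using VU by (meson bdd_aboveI)
    then show ?thesis unfolding a_def using that by (rule cSup_upper[rotated])
  qed
  have a2: "a \<le> u" if "u \<in> U" for u
    unfolding a_def using that VU \<open>V \<noteq> {}\<close> by (intro cSup_least) auto
  have "r + c * a \<le> 1" if "(y, r) \<in> G" "y + c *\<^sub>R x0 \<in> W" for y r c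
  proof -
    consider "c = 0" | "c > 0" | "c < 0" by linarith
    then show ?thesis
    proof cases
      case 1
      then show ?thesis using le that by simp
    next
      case 2
      then have "a \<le> (1 - r) / c" by (intro a2) (use that in \<open>auto simp: U_def\<close>)
      then show ?thesis using 2 by (simp add: field_simps)
    next
      case 3
      then have "(r - 1) / (- c) \<in> V"
        unfolding V_def using that by (intro CollectI exI[of _ y] exI[of _ r] exI[of _ "- c"]) simp
      then have "(r - 1) / (- c) \<le> a" by (rule a1)
      then show ?thesis using 3 by (simp add: field_simps)
    qed
  qed
  then show ?thesis by blast
qed

text \<open>Zorn's lemma on the partial extensions, ordered by inclusion:
  \<open>convex_separation_step\<close> shows that a maximal one is defined on all of
  \<open>V\<close>. The hypothesis \<open>absorbing\<close> takes the place of an interior point;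
  applied to a vector and its negative it makes the admissible values bounded on both sides.\<close>

lemma convex_dominated_extension:
  fixes V Z :: "'a::real_vector set"
  assumes V: "subspace V" and Z: "subspace Z" "Z \<subseteq> V" and W: "convex W"
    and absorbing: "\<And>x. x \<in> V \<Longrightarrow> \<exists>\<epsilon>>0. \<epsilon> *\<^sub>R x \<in> W"
    and u: "linear_on Z u" "\<And>x. x \<in> Z \<Longrightarrow> x \<in> W \<Longrightarrow> u x \<le> 1"
  shows "\<exists>T. linear_on V T \<and> (\<forall>x\<in>Z. T x = u x) \<and> (\<forall>x\<in>V. x \<in> W \<longrightarrow> T x \<le> 1)"
proof -
  define G0 where "G0 = (\<lambda>x. (x, u x)) ` Z"
  define \<A> where "\<A> = {G. subspace G \<and> G0 \<subseteq> G \<and> fst ` G \<subseteq> V \<and> (\<forall>x r. (x, r) \<in> G \<longrightarrow> x \<in> W \<longrightarrow> r \<le> 1)}"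
  have "subspace G0"
    unfolding G0_def
  proof (rule subspaceI)
    show "0 \<in> (\<lambda>x. (x, u x)) ` Z"
      using subspace_0[OF Z(1)] linear_on_0[OF u(1) Z(1)] by (auto simp: zero_prod_def intro!: image_eqI[of _ _ 0])
  next
    fix p q assume "p \<in> (\<lambda>x. (x, u x)) ` Z" "q \<in> (\<lambda>x. (x, u x)) ` Z"
    then obtain x y where "x \<in> Z" "y \<in> Z" "p = (x, u x)" "q = (y, u y)" by blast
    then show "p + q \<in> (\<lambda>x. (x, u x)) ` Z"
      using linear_onD(1)[OF u(1)] subspace_add[OF Z(1)] by (auto intro!: image_eqI[of _ _ "x + y"])
  next
    fix c p assume "p \<in> (\<lambda>x. (x, u x)) ` Z"
    then obtain x where "x \<in> Z" "p = (x, u x)" by blast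
    then show "c *\<^sub>R p \<in> (\<lambda>x. (x, u x)) ` Z"
      using linear_onD(2)[OF u(1)] subspace_scale[OF Z(1)] by (auto intro!: image_eqI[of _ _ "c *\<^sub>R x"])
  qed
  then have "G0 \<in> \<A>" using Z u(2) by (auto simp: \<A>_def G0_def)
  moreover have "\<Union>\<C> \<in> \<A>" if C: "\<C> \<noteq> {}" "subset.chain \<A> \<C>" for \<C>
  proof -
    have "subspace (\<Union>\<C>)" using subspace_Union_chain[OF C] by (simp add: \<A>_def)
    moreover have "\<C> \<subseteq> \<A>" using C(2) by (simp add: subset_chain_def)
    ultimately show ?thesis using C(1) unfolding \<A>_def by blast
  qed
  ultimately obtain G where G: "G \<in> \<A>" and max: "\<And>H. H \<in> \<A> \<Longrightarrow> G \<subseteq> H \<Longrightarrow> H = G"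
    using subset_Zorn_nonempty[of \<A>] by blast
  have sG: "subspace G" and G0G: "G0 \<subseteq> G" and GV: "fst ` G \<subseteq> V"
    and le: "\<And>x r. (x, r) \<in> G \<Longrightarrow> x \<in> W \<Longrightarrow> r \<le> 1"
    using G by (auto simp: \<A>_def)
  have dom: "\<exists>r. (x0, r) \<in> G" if x0: "x0 \<in> V" for x0
  proof -
    obtain a where a: "\<And>y r c. (y, r) \<in> G \<Longrightarrow> y + c *\<^sub>R x0 \<in> W \<Longrightarrow> r + c * a \<le> 1"
      using convex_separation_step[OF sG W _ absorbing[OF x0] absorbing[OF subspace_neg[OF V x0]]] le by blast
    \<comment> \<open>No case distinction on \<open>x0\<close>: the enlarged subspace is admissible
      again, so maximality forces \<open>H = G\<close> and \<open>x0\<close> is in the domain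
      already.\<close>
    define H where "H = {p + c *\<^sub>R (x0, a) | p c. p \<in> G}"
    have "H = {p + q | p q. p \<in> G \<and> q \<in> span {(x0, a)}}"
      unfolding H_def span_singleton by blast
    then have "subspace H" using subspace_sums[OF sG subspace_span] by simp
    moreover have GH: "G \<subseteq> H" unfolding H_def by (force intro: exI[of _ "0::real"])
    moreover have "fst (p + c *\<^sub>R (x0, a)) \<in> V" if "p \<in> G" for p c
      using GV that subspace_add[OF V _ subspace_scale[OF V x0, of c], of "fst p"] by auto
    then have "fst ` H \<subseteq> V" unfolding H_def by blast
    moreover have "r \<le> 1" if xr: "(x, r) \<in> H" "x \<in> W" for x r
    proof -
      obtain y s c where "(y, s) \<in> G" "x = y + c *\<^sub>R x0" "r = s + c * a"
        using xr(1) unfolding H_def by auto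
      then show ?thesis using a xr(2) by blast
    qed
    ultimately have "H \<in> \<A>" using G0G unfolding \<A>_def by blast
    then have "H = G" using max GH by blast
    moreover have "(x0, a) \<in> H"
      unfolding H_def using subspace_0[OF sG] by (force intro!: exI[of _ 0] exI[of _ "1::real"])
    ultimately show ?thesis by blast
  qed
  obtain \<epsilon> where "\<epsilon> > 0" "\<epsilon> *\<^sub>R (0::'a) \<in> W" using absorbing[OF subspace_0[OF V]] by blast
  then have W0: "0 \<in> W" by simp
  have zero: "r = 0" if "(0, r) \<in> G" for r
  proof -
    have "t * r \<le> 1" for t
      using subspace_scale[OF sG that, of t] le[OF _ W0] by simp
    \<comment> \<open>For \<open>r\<close> different from 0 this multiple would give 2 \<le>
      1.\<close>
    from this[of "2 / r"] show ?thesis by (cases "r = 0") auto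
  qed
  define T where "T = (\<lambda>x. THE r. (x, r) \<in> G)"
  have TG: "T x = r" if "(x, r) \<in> G" for x r
    unfolding T_def
  proof (rule the_equality)
    show "(x, r) \<in> G" by (rule that)
    fix s assume "(x, s) \<in> G"
    then show "s = r" using zero[of "s - r"] subspace_diff[OF sG _ that] by fastforce
  qed
  then have GT: "(x, T x) \<in> G" if "x \<in> V" for x using dom[OF that] by auto
  have "linear_on V T"
    unfolding linear_on_def
  proof (intro conjI ballI allI)
    fix x y assume "x \<in> V" "y \<in> V"
    then show "T (x + y) = T x + T y" using TG subspace_add[OF sG GT GT] by fastforce
  next
    fix c x assume "x \<in> V"
    then show "T (c *\<^sub>R x) = c * T x" using TG subspace_scale[OF sG GT, of x c] by fastforce
  qed
  moreover have "T x = u x" if "x \<in> Z" for x using TG G0G that by (auto simp: G0_def)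
  ultimately show ?thesis using le GT by blast
qed

text \<open>Continuity for the subspace topology provides an open \<open>U\<close> such that
  \<open>u\<close> lies between -1 and 1 on \<open>U \<inter> Z\<close>. A convex \<open>W\<close>
  inside \<open>U\<close> turns this into \<open>u \<le> 1\<close> on \<open>W \<inter> Z\<close>,
  the kind of domination that Hahn-Banach preserves, and the open traces of \<open>W\<close> turn it
  back into continuity.\<close>

lemma LF_functional_extension:
  assumes S: "subspace S" and Z: "subspace Z" "Z \<subseteq> test S" and u: "linear_on Z u"
    and cont: "continuous_map (subtopology (LF_topology S) Z) euclideanreal u"
  shows "\<exists>T. linear_on (test S) T \<and> bounded_on_tests S T \<and> (\<forall>x\<in>Z. T x = u x)"
proof -
  note top = topspace_LF_topology[OF S] and sub = subspace_test[OF S]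
  have "openin (subtopology (LF_topology S) Z) {x \<in> topspace (subtopology (LF_topology S) Z). u x \<in> {-1<..<1}}"
    using cont by (rule openin_continuous_map_preimage) simp
  then obtain U where U: "openin (LF_topology S) U"
    "{x \<in> topspace (subtopology (LF_topology S) Z). u x \<in> {-1<..<1}} = U \<inter> Z"
    unfolding openin_subtopology by blast
  have UZ: "U \<inter> Z = {x \<in> Z. -1 < u x \<and> u x < 1}" using U(2) Z(2) top by (auto simp: topspace_subtopology)
  have "0 \<in> U \<inter> Z" unfolding UZ using linear_on_0[OF u Z(1)] subspace_0[OF Z(1)] by simp
  then have "0 \<in> U" by blast
  from LF_open_convex_nhd[OF S U(1) this] obtain W where W: "W \<subseteq> U" "0 \<in> W" "convex W"
    and W': "\<forall>K. compact K \<longrightarrow> openin (frechet_topology K S) (W \<inter> test_on K S)"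
    by blast
  have nhd: "\<exists>L \<delta>. finite L \<and> \<delta> > 0 \<and>
      (\<forall>\<psi>\<in>test_on K S. small_on L \<delta> \<psi> \<longrightarrow> \<psi> \<in> W)" if K: "compact K" for K
  proof -
    have "0 \<in> W \<inter> test_on K S"
      using W(2) subspace_0[OF subspace_test_on[OF S compact_imp_closed[OF K]]] by blast
    with W'[rule_format, OF K] obtain L \<delta> where "finite L" "\<delta> > 0" "\<forall>\<psi>\<in>test_on K S.
        close_on L \<delta> \<psi> 0 \<longrightarrow> \<psi> \<in> W \<inter> test_on K S"
      unfolding frechet_openin_iff[OF K] by blast
    then show ?thesis by (intro exI[of _ L] exI[of _ \<delta>]) (simp add: partials_zero)
  qed
  have absorbing: "\<exists>\<epsilon>>0. \<epsilon> *\<^sub>R \<phi> \<in> W" if \<phi>: "\<phi> \<in> test S" for \<phi>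
  proof -
    obtain K where K: "compact K" "\<phi> \<in> test_on K S" using \<phi> by (auto simp: test_eq_test_on)
    obtain L \<delta> where L: "finite L" "\<delta> > 0"
      "\<forall>\<psi>\<in>test_on K S. small_on L \<delta> \<psi> \<longrightarrow> \<psi> \<in> W"
      using nhd[OF K(1)] by blast
    obtain B where B: "B > 0" "\<forall>is\<in>L. \<forall>x. norm (partials is \<phi> x) \<le> B"
      using partials_bounded[OF \<phi> L(1)] by blast
    have sm: "smooth \<phi>" using \<phi> by (simp add: test_def)
    \<comment> \<open>The factor 2 makes the bound strict, since \<open>B\<close> itself may be
      attained.\<close>
    have "norm (partials is ((\<delta> / (2 * B)) *\<^sub>R \<phi>) x) < \<delta>" if "is \<in> L" for "is" x
    proof -
      have "(\<delta> / (2 * B)) * norm (partials is \<phi> x) \<le> (\<delta> / (2 * B)) * B"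
        using B L(2) that by (intro mult_left_mono) auto
      also have "\<dots> < \<delta>" using B L(2) by simp
      finally show ?thesis using B(1) L(2) by (simp add: scaleR_fun_def partials_scaleR[OF sm])
    qed
    then have "(\<delta> / (2 * B)) *\<^sub>R \<phi> \<in> W"
      using L(3) subspace_scale[OF subspace_test_on[OF S compact_imp_closed[OF K(1)]] K(2)] by blast
    moreover have "\<delta> / (2 * B) > 0" using B(1) L(2) by simp
    ultimately show ?thesis by blast
  qed
  obtain T where T: "linear_on (test S) T" "\<forall>x\<in>Z. T x = u x" "\<forall>x\<in>test S. x \<in> W \<longrightarrow> T x \<le> 1"
  proof -
    have "u x \<le> 1" if "x \<in> Z" "x \<in> W" for x
    proof -
      have "x \<in> U \<inter> Z" using that W(1) by blast
      then show ?thesis unfolding UZ by simp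
    qed
    from convex_dominated_extension[OF sub Z W(3) absorbing u this] show thesis
      using that by blast
  qed
  have "bounded_on_tests S T"
    unfolding bounded_on_tests_def
  proof (intro allI impI)
    fix K :: "pt set" assume K: "compact K"
    obtain L \<delta> where L: "finite L" "\<delta> > 0"
      "\<forall>\<psi>\<in>test_on K S. small_on L \<delta> \<psi> \<longrightarrow> \<psi> \<in> W"
      using nhd[OF K(1)] by blast
    have "\<bar>T \<psi>\<bar> \<le> 1" if \<psi>: "\<psi> \<in> test_on K S" "small_on L \<delta> \<psi>" for \<psi>
    proof -
      have t: "\<psi> \<in> test S" using \<psi>(1) test_on_subset_test[OF K] by blast
      then have "smooth \<psi>" by (simp add: test_def)
      then have "norm (partials is (- \<psi>) x) = norm (partials is \<psi> x)" for "is" x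
        using partials_scaleR[of \<psi> "is" "-1"] by (simp add: fun_Compl_def)
      \<comment> \<open>Domination bounds \<open>T\<close> from above only, and \<open>W\<close> may
        fail to be symmetric. Smallness of derivatives is symmetric, so both signs of
        \<open>\<psi>\<close> lie in \<open>W\<close> and the bound becomes two-sided.\<close>
      then have "- \<psi> \<in> W"
        using L(3) \<psi> subspace_neg[OF subspace_test_on[OF S compact_imp_closed[OF K(1)]] \<psi>(1)] by simp
      moreover have "\<psi> \<in> W" using L(3) \<psi> by blast
      moreover have "T (- \<psi>) = - T \<psi>" using linear_on_minus[OF T(1) t] .
      ultimately have "T \<psi> \<le> 1" "- T \<psi> \<le> 1"
        using T(3) t subspace_neg[OF sub t] by metis+
      then show ?thesis by linarith
    qed
    then show "\<exists>L \<delta>. finite L \<and> \<delta> > 0 \<and>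
     (\<forall>\<phi>\<in>test_on K S. small_on L \<delta> \<phi> \<longrightarrow> \<bar>T \<phi>\<bar> \<le> 1)"
      using L(1,2) by blast
  qed
  then show ?thesis using T by blast
qed

subsection \<open>Quotients\<close>

lemma coset_eq_iff:
  assumes "subspace B"
  shows "coset B a = coset B b \<longleftrightarrow> a - b \<in> B"
proof
  assume "coset B a = coset B b"
  moreover have "a \<in> coset B a" using subspace_0[OF assms] by (force simp: coset_def)
  ultimately show "a - b \<in> B" by (auto simp: coset_def)
next
  assume ab: "a - b \<in> B"
  have sub: "coset B x \<subseteq> coset B y" if "x - y \<in> B" for x y
  proof
    fix z assume "z \<in> coset B x"
    then obtain w where "w \<in> B" "z = x + w" by (auto simp: coset_def)
    then have "z = y + ((x - y) + w)" "(x - y) + w \<in> B" using that subspace_add[OF assms] by auto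
    then show "z \<in> coset B y" unfolding coset_def by blast
  qed
  have "b - a \<in> B" using subspace_neg[OF assms ab] by simp
  then show "coset B a = coset B b" using ab sub by blast
qed

lemma quot_simps:
  assumes W: "subspace W"
  shows "carr (quot V W) = coset W ` V"
    "vadd (quot V W) (coset W x) (coset W y) = coset W (x + y)"
    "vscale (quot V W) c (coset W x) = coset W (c *\<^sub>R x)"
proof -
  show "carr (quot V W) = coset W ` V" by (simp add: quot_def)
  have "{a + b | a b. a \<in> coset W x \<and> b \<in> coset W y} = coset W (x + y)"
  proof (intro set_eqI iffI)
    fix z assume "z \<in> {a + b | a b. a \<in> coset W x \<and> b \<in> coset W y}"
    then obtain v w where "v \<in> W" "w \<in> W" "z = (x + v) + (y + w)" by (auto simp: coset_def)
    then show "z \<in> coset W (x + y)"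
      using subspace_add[OF W] by (auto simp: coset_def algebra_simps intro!: exI[of _ "v + w"])
  next
    fix z assume "z \<in> coset W (x + y)"
    then obtain w where "w \<in> W" "z = (x + w) + (y + 0)" by (auto simp: coset_def algebra_simps)
    then show "z \<in> {a + b | a b. a \<in> coset W x \<and> b \<in> coset W y}"
      using subspace_0[OF W] unfolding coset_def by blast
  qed
  then show "vadd (quot V W) (coset W x) (coset W y) = coset W (x + y)" by (simp add: quot_def)
  have "{c *\<^sub>R a + w | a w. a \<in> coset W x \<and> w \<in> W} = coset W (c *\<^sub>R x)"
  proof (intro set_eqI iffI)
    fix z assume "z \<in> {c *\<^sub>R a + w | a w. a \<in> coset W x \<and> w \<in> W}"
    then obtain v w where "v \<in> W" "w \<in> W" "z = c *\<^sub>R x + (c *\<^sub>R v + w)"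
      by (auto simp: coset_def algebra_simps)
    then show "z \<in> coset W (c *\<^sub>R x)"
      using subspace_add[OF W subspace_scale[OF W]] by (auto simp: coset_def)
  next
    fix z assume "z \<in> coset W (c *\<^sub>R x)"
    then obtain w where "w \<in> W" "z = c *\<^sub>R (x + 0) + w" by (auto simp: coset_def)
    then show "z \<in> {c *\<^sub>R a + w | a w. a \<in> coset W x \<and> w \<in> W}"
      using subspace_0[OF W] unfolding coset_def by blast
  qed
  then show "vscale (quot V W) c (coset W x) = coset W (c *\<^sub>R x)" by (simp add: quot_def)
qed

text \<open>First isomorphism theorem for the carrier-based encoding: \<open>\<Xi>\<close> has to be
  linear on \<open>P\<close> only, and \<open>ker\<close> makes the representative chosen in
  \<open>\<Phi>\<close> immaterial.\<close>

lemma linear_iso_quot_lift: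
  fixes \<Xi> :: "'a::real_vector \<Rightarrow> 'b::real_vector"
  assumes W: "subspace W" and onto: "\<Xi> ` P = D"
    and add: "\<And>x y. \<lbrakk>x \<in> P; y \<in> P\<rbrakk> \<Longrightarrow> x + y \<in> P \<and> \<Xi> (x + y) = \<Xi> x + \<Xi> y"
    and scale: "\<And>c x. x \<in> P \<Longrightarrow> c *\<^sub>R x \<in> P \<and> \<Xi> (c *\<^sub>R x) = c *\<^sub>R \<Xi> x"
    and ker: "\<And>x y. \<lbrakk>x \<in> P; y \<in> P\<rbrakk> \<Longrightarrow> \<Xi> x = \<Xi> y \<longleftrightarrow> x - y \<in> W"
  shows "\<exists>\<Phi>. linear_iso (quot P W) (subsp D) \<Phi> \<and> (\<forall>x\<in>P. \<Phi> (coset W x) = \<Xi> x)"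
proof -
  define \<Phi> where "\<Phi> A = \<Xi> (SOME x. x \<in> P \<and> A = coset W x)" for A
  have \<Phi>: "\<Phi> (coset W x) = \<Xi> x" if "x \<in> P" for x
  proof -
    have "\<exists>y. y \<in> P \<and> coset W x = coset W y" using that by blast
    from someI_ex[OF this] show ?thesis
      unfolding \<Phi>_def using that coset_eq_iff[OF W] ker by metis
  qed
  have "bij_betw \<Phi> (coset W ` P) D"
    unfolding bij_betw_def
  proof
    show "inj_on \<Phi> (coset W ` P)"
    proof (rule inj_onI)
      fix A B assume "A \<in> coset W ` P" "B \<in> coset W ` P" and eq: "\<Phi> A = \<Phi> B"
      then obtain x y where "x \<in> P" "y \<in> P" "A = coset W x" "B = coset W y" by blast
      then show "A = B" using eq by (simp add: \<Phi> ker coset_eq_iff[OF W])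
    qed
    have "\<Phi> ` coset W ` P = \<Xi> ` P" unfolding image_image by (rule image_cong) (auto simp: \<Phi>)
    then show "\<Phi> ` coset W ` P = D" using onto by simp
  qed
  then have "linear_iso (quot P W) (subsp D) \<Phi>"
    unfolding linear_iso_def quot_simps(1)[OF W]
    using add scale by (auto simp: quot_simps[OF W] subsp_def \<Phi>)
  then show ?thesis using \<Phi> by blast
qed

text \<open>Independent of the chosen representative only if \<open>f\<close> is additive and vanishes on \<open>B\<close>.\<close>

definition induced :: "'a::real_vector set \<Rightarrow> 'a set \<Rightarrow> ('a \<Rightarrow> real) \<Rightarrow> 'a set \<Rightarrow> real" where
  "induced Z B f A = (if A \<in> coset B ` Z then f (SOME z. z \<in> Z \<and> A = coset B z) else 0)"

lemma induced_coset:
  assumes "subspace Z" "subspace B" "linear_on Z f" "\<And>b. b \<in> B \<Longrightarrow> f b = 0" "z \<in> Z"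
  shows "induced Z B f (coset B z) = f z"
proof -
  have ex: "\<exists>y. y \<in> Z \<and> coset B z = coset B y" using assms(5) by blast
  define y where "y = (SOME y. y \<in> Z \<and> coset B z = coset B y)"
  have y: "y \<in> Z" "coset B z = coset B y"
    using someI_ex[OF ex] unfolding y_def by blast+
  then have "f (z - y) = 0" using coset_eq_iff[OF assms(2)] assms(4) by blast
  then have "f y = f z" using linear_on_diff[OF assms(3,1,5) y(1)] by simp
  then show ?thesis unfolding induced_def y_def using assms(5) by simp
qed

text \<open>\<open>coset B\<close> is a quotient map by construction of the topology, so continuity
  on the quotient is continuity of the pullback; the algebraic conditions pull back by
  \<open>quot_simps\<close>.\<close>

lemma dual_quotient_iff:
  fixes Z B :: "(pt \<Rightarrow> 'b::real_normed_vector) set"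
  assumes Z: "subspace Z" and B: "subspace B" "B \<subseteq> Z" and top: "topspace Y = Z"
  shows "T \<in> dual (quot Z B) (quotient_topology Y (coset B)) \<longleftrightarrow>
    linear_on Z (T \<circ> coset B) \<and> continuous_map Y euclideanreal (T \<circ> coset B) \<and>
    (\<forall>A. A \<notin> coset B ` Z \<longrightarrow> T A = 0)"
proof -
  have "continuous_map (quotient_topology Y (coset B)) euclideanreal T \<longleftrightarrow>
      continuous_map Y euclideanreal (T \<circ> coset B)"
    by (rule continuous_compose_quotient_map_eq[OF quotient_map_quotient_topology, symmetric])
  then show ?thesis
    unfolding dual_def mem_Collect_eq linear_on_def quot_simps(1)[OF B(1)]
    by (simp add: quot_simps[OF B(1)])
qed

text \<open>Common core of the isomorphisms with spaces of currents; \<open>ev\<close> makes a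
  functional out of a parameter. For surjectivity a functional on the quotient is pulled back to
  \<open>Z\<close> and extended to all test forms; the extension still kills \<open>B\<close>, and
  \<open>rep\<close> supplies a parameter with the same values on \<open>Z\<close>. The last
  conclusion describes the kernel, from which injectivity or the quotient is obtained.\<close>

lemma represent_dual:
  fixes Z B :: "(pt \<Rightarrow> 'b::real_normed_vector) set" and ev :: "'v::real_vector \<Rightarrow> (pt \<Rightarrow> 'b) \<Rightarrow> real"
  assumes S: "subspace S" and Z: "subspace Z" "Z \<subseteq> test S" and B: "subspace B" "B \<subseteq> Z"
    and ev: "\<And>T. T \<in> P \<Longrightarrow> linear_on (test S) (ev T) \<and> bounded_on_tests S (ev T)"
    and add: "\<And>T U z. \<lbrakk>T \<in> P; U \<in> P; z \<in> test S\<rbrakk> \<Longrightarrow> ev (T + U) z = ev T z + ev U z"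
    and scale: "\<And>c T z. \<lbrakk>T \<in> P; z \<in> test S\<rbrakk> \<Longrightarrow> ev (c *\<^sub>R T) z = c * ev T z"
    and vanish: "\<And>T b. \<lbrakk>T \<in> P; b \<in> B\<rbrakk> \<Longrightarrow> ev T b = 0"
    and rep: "\<And>u. \<lbrakk>linear_on (test S) u; bounded_on_tests S u; \<And>b. b \<in> B \<Longrightarrow> u b = 0\<rbrakk> \<Longrightarrow>
      \<exists>T\<in>P. \<forall>z\<in>Z. ev T z = u z"
  defines "D \<equiv> dual (quot Z B) (quotient_topology (subtopology (LF_topology S) Z) (coset B))"
    and "\<Xi> \<equiv> \<lambda>T. induced Z B (ev T)"
  shows "\<Xi> ` P = D"
    "\<And>T U. \<lbrakk>T \<in> P; U \<in> P\<rbrakk> \<Longrightarrow> \<Xi> (T + U) = \<Xi> T + \<Xi> U"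
    "\<And>c T. T \<in> P \<Longrightarrow> \<Xi> (c *\<^sub>R T) = c *\<^sub>R \<Xi> T"
    "\<And>T z. \<lbrakk>T \<in> P; z \<in> Z\<rbrakk> \<Longrightarrow> \<Xi> T (coset B z) = ev T z"
    "\<And>T U. \<lbrakk>T \<in> P; U \<in> P\<rbrakk> \<Longrightarrow> \<Xi> T = \<Xi> U \<longleftrightarrow> (\<forall>z\<in>Z. ev T z = ev U z)"
proof -
  have lin: "linear_on Z (ev T)" if "T \<in> P" for T
    using ev[OF that] Z(2) unfolding linear_on_def by blast
  show val: "\<Xi> T (coset B z) = ev T z" if "T \<in> P" "z \<in> Z" for T z
    unfolding \<Xi>_def using induced_coset[OF Z(1) B(1) lin vanish] that by blast
  have off: "\<Xi> T A = 0" if "A \<notin> coset B ` Z" for T A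
    using that by (simp add: \<Xi>_def induced_def)
  have some: "(SOME z. z \<in> Z \<and> A = coset B z) \<in> Z" if "A \<in> coset B ` Z" for A
  proof -
    have "\<exists>z. z \<in> Z \<and> A = coset B z" using that by blast
    from someI_ex[OF this] show ?thesis by blast
  qed
  show "\<Xi> (T + U) = \<Xi> T + \<Xi> U" if "T \<in> P" "U \<in> P" for T U
    unfolding \<Xi>_def induced_def using some Z(2) add[OF that] by (auto simp: fun_eq_iff subset_iff)
  show "\<Xi> (c *\<^sub>R T) = c *\<^sub>R \<Xi> T" if "T \<in> P" for c T
    unfolding \<Xi>_def induced_def using some Z(2) scale[OF that] by (auto simp: fun_eq_iff subset_iff scaleR_fun_def)
  show "\<Xi> T = \<Xi> U \<longleftrightarrow> (\<forall>z\<in>Z. ev T z = ev U z)" if TU: "T \<in> P" "U \<in> P" for T U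
  proof
    assume "\<Xi> T = \<Xi> U"
    then show "\<forall>z\<in>Z. ev T z = ev U z" using val TU by metis
  next
    assume "\<forall>z\<in>Z. ev T z = ev U z"
    then show "\<Xi> T = \<Xi> U" using some unfolding \<Xi>_def induced_def by (auto simp: fun_eq_iff)
  qed
  have top: "topspace (subtopology (LF_topology S) Z) = Z"
    using Z(2) topspace_LF_topology[OF S] by (auto simp: topspace_subtopology)
  note dual = dual_quotient_iff[OF Z(1) B top]
  show "\<Xi> ` P = D"
  proof (intro set_eqI iffI)
    fix t assume "t \<in> \<Xi> ` P"
    then obtain T where T: "T \<in> P" "t = \<Xi> T" by blast
    have eq: "(t \<circ> coset B) z = ev T z" if "z \<in> Z" for z using val T that by simp
    have "continuous_map (LF_topology S) euclideanreal (ev T)"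
      using LF_continuous_iff[OF S] ev[OF T(1)] by blast
    then have "continuous_map (subtopology (LF_topology S) Z) euclideanreal (ev T)"
      by (rule continuous_map_from_subtopology)
    then have "continuous_map (subtopology (LF_topology S) Z) euclideanreal (t \<circ> coset B)"
      by (rule continuous_map_eq) (use eq top in auto)
    moreover have "linear_on Z (t \<circ> coset B)"
      using lin[OF T(1)] eq subspace_add[OF Z(1)] subspace_scale[OF Z(1)]
      unfolding linear_on_def by (metis (no_types, lifting))
    ultimately show "t \<in> D"
      unfolding D_def dual using off T(2) by blast
  next
    fix t assume "t \<in> D"
    then have t: "linear_on Z (t \<circ> coset B)"
      "continuous_map (subtopology (LF_topology S) Z) euclideanreal (t \<circ> coset B)"
      "\<And>A. A \<notin> coset B ` Z \<Longrightarrow> t A = 0"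
      unfolding D_def dual by blast+
    obtain u where u: "linear_on (test S) u" "bounded_on_tests S u" "\<And>z. z \<in> Z \<Longrightarrow> u z = t (coset B z)"
      using LF_functional_extension[OF S Z t(1,2)] by auto
    have "u b = 0" if "b \<in> B" for b
    proof -
      have "coset B b = coset B 0" using that by (simp add: coset_eq_iff[OF B(1)])
      then show ?thesis
        using u(3)[of b] that B(2) linear_on_0[OF t(1) Z(1)] by auto
    qed
    then obtain T where T: "T \<in> P" "\<And>z. z \<in> Z \<Longrightarrow> ev T z = u z" using rep[OF u(1,2)] by blast
    have "t A = \<Xi> T A" for A
    proof (cases "A \<in> coset B ` Z")
      case True
      then show ?thesis using T u(3) val by auto
    qed (use t(3) off in simp)
    then show "t \<in> \<Xi> ` P" using T(1) by blast
  qed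
qed

section \<open>Left-invariant forms\<close>

lemma set4_eq_iff: "(A::4 set) = B \<longleftrightarrow>
   (1 \<in> A \<longleftrightarrow> 1 \<in> B) \<and> (2 \<in> A \<longleftrightarrow> 2 \<in> B) \<and> (3 \<in> A \<longleftrightarrow> 3 \<in> B) \<and> (4 \<in> A \<longleftrightarrow> 4 \<in> B)"
  by (simp only: set_eq_iff forall_4)

lemma UNIV4: "(UNIV :: 4 set) = {1, 2, 3, 4}"
  by (simp add: set4_eq_iff)

lemma theta_nth: "\<theta> I $ J = (if J = I then 1 else 0)"
  by (simp add: \<theta>_def axis_def)

lemma ext_expansion: "(\<xi>::ext) = (\<Sum>I\<in>UNIV. \<xi> $ I *\<^sub>R \<theta> I)"
  by (simp add: vec_eq_iff theta_nth if_distrib cong: if_cong)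

lemma span_theta: "span (\<theta> ` M) = {\<xi>. \<forall>I. I \<notin> M \<longrightarrow> \<xi> $ I = 0}"
proof
  show "span (\<theta> ` M) \<subseteq> {\<xi>. \<forall>I. I \<notin> M \<longrightarrow> \<xi> $ I = 0}"
    by (rule span_minimal) (auto simp: theta_nth subspace_def)
  show "{\<xi>. \<forall>I. I \<notin> M \<longrightarrow> \<xi> $ I = 0} \<subseteq> span (\<theta> ` M)"
  proof
    fix \<xi> :: ext assume "\<xi> \<in> {\<xi>. \<forall>I. I \<notin> M \<longrightarrow> \<xi> $ I = 0}"
    then have "\<xi> $ I *\<^sub>R \<theta> I \<in> span (\<theta> ` M)" for I
      by (cases "I \<in> M") (auto intro: span_scale span_base span_zero)
    then show "\<xi> \<in> span (\<theta> ` M)" by (subst ext_expansion) (auto intro: span_sum)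
  qed
qed

text \<open>Membership becomes arithmetic in four truth values, which settles the tables in
  \<open>bideg_simps\<close> and the complement rule by case analysis.\<close>

lemma bideg_iff: "I \<in> bideg p q \<longleftrightarrow>
    of_bool (1 \<in> I) + of_bool (2 \<in> I) + 2 * of_bool (3 \<in> I) + 3 * of_bool (4 \<in> I) = p \<and>
    of_bool (1 \<in> I) + of_bool (2 \<in> I) + of_bool (3 \<in> I) + of_bool (4 \<in> I) = p + q"
proof -
  have *: "int (sum f I) = int (\<Sum>i\<in>UNIV. if i \<in> I then f i else 0)" for f :: "4 \<Rightarrow> nat"
    by (simp add: sum.If_cases)
  have "int (sum f I) = of_bool (1 \<in> I) * int (f 1) + of_bool (2 \<in> I) * int (f 2)
      + of_bool (3 \<in> I) * int (f 3) + of_bool (4 \<in> I) * int (f 4)" for f :: "4 \<Rightarrow> nat"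
    unfolding * sum_4 by auto
  note this[of weight] this[of "\<lambda>i. 1"]
  then show ?thesis by (simp add: bideg_def weight_def)
qed

lemma bideg_eqI:
  assumes "\<And>I. I \<in> bideg p q \<longleftrightarrow> I \<in> M"
  shows "bideg p q = M"
  using assms by blast

lemma bideg_simps:
  "bideg 1 0 = {{1}, {2}}" "bideg 2 (-1) = {{3}}" "bideg 3 (-2) = {{4}}"
  "bideg 3 (-1) = {{1, 3}, {2, 3}}" "bideg 4 (-2) = {{1, 4}, {2, 4}}" "bideg 5 (-3) = {{3, 4}}"
  "bideg 6 (-3) = {{1, 3, 4}, {2, 3, 4}}" "bideg 7 (-3) = {{1, 2, 3, 4}}"
  "bideg 1 (-1) = {}" "bideg 4 (-3) = {}" "bideg 6 (-4) = {}"
  by (rule bideg_eqI, simp add: bideg_iff set4_eq_iff of_bool_def)+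

text \<open>The volume form has weight 1+1+2+3 = 7 and degree 4, and an index set and its complement
  share these between them.\<close>

lemma bideg_compl: "I \<in> bideg (7 - p) (4 - (p + q) - (7 - p)) \<longleftrightarrow> - I \<in> bideg p q"
  by (auto simp: bideg_iff of_bool_def split: if_splits)

text \<open>Inversions are counted by a double sum instead of the cardinality of a set of pairs, so
  that the simplifier can evaluate the sign on explicit index sets.\<close>

definition theta_wedge :: "4 set \<Rightarrow> 4 set \<Rightarrow> ext" where
  "theta_wedge I J = (if I \<inter> J = {} then
     (-1) ^ (\<Sum>i\<in>I. \<Sum>j\<in>J. if prec j i then 1 else 0) *\<^sub>R \<theta> (I \<union> J) else 0)"

lemma wedge_eq: "wedge \<xi> \<eta> = (\<Sum>I\<in>UNIV. \<Sum>J\<in>UNIV. (\<xi> $ I * \<eta> $ J) *\<^sub>R theta_wedge I J)"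
proof -
  have "card {(i, j). i \<in> I \<and> j \<in> J \<and> prec j i} = (\<Sum>i\<in>I. \<Sum>j\<in>J. if prec j i then 1 else 0)"
    for I J :: "4 set"
  proof -
    have "{(i, j). i \<in> I \<and> j \<in> J \<and> prec j i} = Sigma I (\<lambda>i. {j \<in> J. prec j i})" by auto
    then show ?thesis by (simp add: sum.If_cases Int_def)
  qed
  then show ?thesis
    unfolding wedge_def theta_wedge_def by (intro sum.cong) (auto simp: ac_simps)
qed

lemma wedge_theta: "wedge (\<theta> I) (\<theta> J) = theta_wedge I J"
  by (simp add: wedge_eq theta_nth if_distrib[of "\<lambda>x. x *\<^sub>R _"] if_distrib[of "\<lambda>x. _ * x"]
      if_distrib[of "\<lambda>x. x * _"] cong: if_cong)

lemma wedge_linear_right: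
  "wedge \<xi> (\<eta> + \<zeta>) = wedge \<xi> \<eta> + wedge \<xi> \<zeta>" "wedge \<xi> (c *\<^sub>R \<eta>) = c *\<^sub>R wedge \<xi> \<eta>" "wedge \<xi> 0 = 0"
  by (simp_all add: wedge_eq algebra_simps sum.distrib scaleR_sum_right)

lemma wedge_linear_left:
  "wedge (- \<xi>) \<eta> = - wedge \<xi> \<eta>" "wedge 0 \<eta> = 0"
  by (simp_all add: wedge_eq sum_negf)

lemma one_theta_wedge:
  "theta_wedge {1} {1} = 0" "theta_wedge {1} {2} = \<theta> {1, 2}" "theta_wedge {2} {1} = - \<theta> {1, 2}"
  "theta_wedge {2} {2} = 0" "theta_wedge {3} {1} = - \<theta> {1, 3}" "theta_wedge {3} {2} = - \<theta> {2, 3}"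
  "theta_wedge {1} {3} = \<theta> {1, 3}" "theta_wedge {2} {3} = \<theta> {2, 3}"
  "theta_wedge {1} {1, 3} = 0" "theta_wedge {1} {2, 3} = \<theta> {1, 2, 3}"
  "theta_wedge {2} {1, 3} = - \<theta> {1, 2, 3}" "theta_wedge {2} {2, 3} = 0"
  "theta_wedge {3} {1, 3} = 0" "theta_wedge {3} {2, 3} = 0"
  "theta_wedge {1} {1, 4} = 0" "theta_wedge {1} {2, 4} = \<theta> {1, 2, 4}"
  "theta_wedge {2} {1, 4} = - \<theta> {1, 2, 4}" "theta_wedge {2} {2, 4} = 0"
  "theta_wedge {3} {1, 4} = - \<theta> {1, 3, 4}"
  "theta_wedge {1} {3, 4} = \<theta> {1, 3, 4}" "theta_wedge {2} {3, 4} = \<theta> {2, 3, 4}"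
  by (simp_all add: theta_wedge_def prec_def insert_commute)

lemma dinv_eq: "dinv \<xi> = (\<Sum>I\<in>UNIV. \<xi> $ I *\<^sub>R dinv (\<theta> I))"
  unfolding dinv_def
  by (simp add: theta_nth if_distrib[of "\<lambda>x. x *\<^sub>R _"] cong: if_cong)

lemma dinv_linear: "dinv (\<xi> + \<eta>) = dinv \<xi> + dinv \<eta>" "dinv (c *\<^sub>R \<xi>) = c *\<^sub>R dinv \<xi>" "dinv 0 = 0"
proof -
  show "dinv (\<xi> + \<eta>) = dinv \<xi> + dinv \<eta>"
    by (subst (1 2 3) dinv_eq) (simp add: algebra_simps sum.distrib)
  show "dinv (c *\<^sub>R \<xi>) = c *\<^sub>R dinv \<xi>"
    by (subst (1 2) dinv_eq) (simp add: scaleR_sum_right)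
  show "dinv 0 = 0" by (subst dinv_eq) simp
qed

lemma dinv_theta_sum: "dinv (\<theta> I) =
   (\<Sum>i\<in>I. (-1) ^ card {j \<in> I. prec j i} *\<^sub>R wedge (dtheta i) (\<theta> (I - {i})))"
  unfolding dinv_def
  by (simp add: theta_nth if_distrib[of "\<lambda>x. x *\<^sub>R _"] cong: if_cong)

text \<open>The computation of cycles and boundaries rests on these values: \<open>d 0\<close> is
  injective on the multiples of \<open>\<theta> {3}\<close>, of \<open>\<theta> {4}\<close> and of
  \<open>\<theta> {3, 4}\<close>, and of the two monomials of bidegree (4,-2) only
  \<open>\<theta> {1, 4}\<close> is closed.\<close>

lemma dinv_theta:
  "dinv (\<theta> {1}) = 0" "dinv (\<theta> {2}) = 0" "dinv (\<theta> {3}) = - \<theta> {1, 2}" "dinv (\<theta> {4}) = - \<theta> {1, 3}"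
  "dinv (\<theta> {1, 3}) = 0" "dinv (\<theta> {2, 3}) = 0" "dinv (\<theta> {1, 4}) = 0"
  "dinv (\<theta> {2, 4}) = - \<theta> {1, 2, 3}" "dinv (\<theta> {3, 4}) = - \<theta> {1, 2, 4}"
  "dinv (\<theta> {1, 3, 4}) = 0" "dinv (\<theta> {2, 3, 4}) = 0"
proof -
  have c: "card {j \<in> I. prec j i} = (\<Sum>j\<in>I. if prec j i then 1 else 0)" for I i
    by (simp add: sum.If_cases Int_def)
  show "dinv (\<theta> {1}) = 0" "dinv (\<theta> {2}) = 0" "dinv (\<theta> {3}) = - \<theta> {1, 2}" "dinv (\<theta> {4}) = - \<theta> {1, 3}"
  "dinv (\<theta> {1, 3}) = 0" "dinv (\<theta> {2, 3}) = 0" "dinv (\<theta> {1, 4}) = 0"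
  "dinv (\<theta> {2, 4}) = - \<theta> {1, 2, 3}" "dinv (\<theta> {3, 4}) = - \<theta> {1, 2, 4}"
  "dinv (\<theta> {1, 3, 4}) = 0" "dinv (\<theta> {2, 3, 4}) = 0"
    unfolding dinv_theta_sum c
    by (simp_all add: dtheta_def wedge_linear_left wedge_theta theta_wedge_def prec_def
        insert_Diff_if insert_commute)
qed

section \<open>The vector fields\<close>

text \<open>The coefficient of \<open>t\<close> in the product of \<open>x\<close> with
  \<open>t *\<^sub>R axis i 1\<close>, that is, the field \<open>X i\<close> as a vector at
  \<open>x\<close>. The Baker-Campbell-Hausdorff term containing the second factor twice is
  quadratic in \<open>t\<close> and drops out.\<close>

definition frame :: "4 \<Rightarrow> pt \<Rightarrow> pt" where
  "frame i x = axis i 1 + (1/2) *\<^sub>R lie_bracket x (axis i 1)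
     + (1/12) *\<^sub>R lie_bracket x (lie_bracket x (axis i 1))"

lemma lie_bracket_scaleR: "lie_bracket x (t *\<^sub>R y) = t *\<^sub>R lie_bracket x y"
  "lie_bracket (t *\<^sub>R x) y = t *\<^sub>R lie_bracket x y"
  by (simp_all add: lie_bracket_def vec_eq_iff algebra_simps)

lemma engel_mult_axis: "engel_mult x (t *\<^sub>R axis i 1) = x + t *\<^sub>R frame i x
    - (t\<^sup>2 / 12) *\<^sub>R lie_bracket (axis i 1) (lie_bracket x (axis i 1))"
  by (simp add: engel_mult_def frame_def lie_bracket_scaleR algebra_simps power2_eq_square)

lemma curve_derivative:
  "((\<lambda>t. engel_mult x (t *\<^sub>R axis i 1)) has_vector_derivative frame i x) (at 0)"
  unfolding engel_mult_axis by (auto intro!: derivative_eq_intros)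

lemma X_eq:
  fixes f :: "pt \<Rightarrow> 'b::real_normed_vector"
  assumes "f differentiable (at x)"
  shows "X i f x = (\<Sum>j\<in>UNIV. frame i x $ j *\<^sub>R pd j f x)"
proof -
  have 0: "engel_mult x ((0::real) *\<^sub>R axis i 1) = x" by (simp add: engel_group_laws)
  have "(f has_derivative (\<lambda>h. \<Sum>j\<in>UNIV. h $ j *\<^sub>R pd j f x)) (at (engel_mult x (0 *\<^sub>R axis i 1)))"
    using has_derivative_pd[OF assms] 0 by simp
  from vector_derivative_diff_chain_within[OF curve_derivative has_derivative_at_withinI[OF this]]
  show ?thesis
    unfolding X_def by (intro vector_derivative_at) (simp add: o_def)
qed

lemmas X_smooth_eq = X_eq[OF smooth_differentiable]

lemma X_expand:
  fixes f :: "pt \<Rightarrow> real"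
  assumes "smooth f"
  shows "X 1 f = (\<lambda>x. pd 1 f x - x$2 / 2 * pd 3 f x - (x$3 / 2 + x$1 * x$2 / 12) * pd 4 f x)"
    "X 2 f = (\<lambda>x. pd 2 f x + x$1 / 2 * pd 3 f x + (x$1)\<^sup>2 / 12 * pd 4 f x)"
    "X 3 f = (\<lambda>x. pd 3 f x + x$1 / 2 * pd 4 f x)"
    "X 4 f = (\<lambda>x. pd 4 f x)"
  by (rule ext, simp add: X_smooth_eq[OF assms] sum_4 frame_def lie_bracket_def axis_def power2_eq_square
      algebra_simps)+

lemma X_linear:
  assumes "bounded_linear L" "smooth f"
  shows "X i (\<lambda>x. L (f x)) = (\<lambda>x. L (X i f x))"
proof
  fix x
  interpret bounded_linear L by fact
  show "X i (\<lambda>x. L (f x)) x = L (X i f x)"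
    unfolding X_smooth_eq[OF smooth_linear[OF assms]] X_smooth_eq[OF assms(2)]
    by (simp add: pd_linear[OF assms(1) smooth_differentiable[OF assms(2)]] sum scaleR)
qed

lemma X_add:
  assumes "smooth f" "smooth g"
  shows "X i (\<lambda>x. f x + g x) = (\<lambda>x. X i f x + X i g x)"
  by (rule ext) (simp add: X_smooth_eq assms smooth_add pd_add[OF smooth_differentiable smooth_differentiable]
      sum.distrib algebra_simps)

lemma X_scaleR: "smooth f \<Longrightarrow> X i (\<lambda>x. c *\<^sub>R f x) = (\<lambda>x. c *\<^sub>R X i f x)"
  by (rule X_linear[OF bounded_linear_scaleR_right])

lemma X_diff:
  assumes "smooth f" "smooth g"
  shows "X i (\<lambda>x. f x - g x) = (\<lambda>x. X i f x - X i g x)"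
  using X_add[OF assms(1) smooth_scaleR[OF assms(2), of "-1"], of i] X_scaleR[OF assms(2), of i "-1"] by simp

lemma smooth_X:
  fixes f :: "pt \<Rightarrow> real"
  assumes "smooth f"
  shows "smooth (X i f)"
proof -
  have c: "smooth (\<lambda>x. x$1 / 2)" "smooth (\<lambda>x. x$2 / 2)" "smooth (\<lambda>x. x$3 / 2 + x$1 * x$2 / 12)"
    "smooth (\<lambda>x. (x$1)\<^sup>2 / 12)"
    unfolding power2_eq_square divide_inverse by (intro smooth_intros)+
  have "smooth (X 1 f)" "smooth (X 2 f)" "smooth (X 3 f)" "smooth (X 4 f)"
    unfolding X_expand[OF assms] by (intro smooth_add smooth_diff smooth_mult smooth_pd c assms)+
  then show ?thesis using exhaust_4[of i] by auto
qed

lemma X_zero_outside: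
  assumes "closed K" "\<And>x. x \<notin> K \<Longrightarrow> f x = 0" "smooth f" "x \<notin> K"
  shows "X i f x = 0"
  using pd_zero_outside[of K f x] assms by (simp add: X_smooth_eq)

lemma X_test:
  assumes "f \<in> Ccinf"
  shows "X i f \<in> Ccinf"
proof -
  obtain K where K: "compact K" "smooth f" "\<And>x. x \<notin> K \<Longrightarrow> f x = 0"
    using assms by (auto simp: test_iff)
  show ?thesis
    by (rule testI[OF smooth_X[OF K(2)] UNIV_I K(1)])
       (rule X_zero_outside[OF compact_imp_closed[OF K(1)] K(3,2)])
qed

section \<open>Cycles and boundaries\<close>

text \<open>Both \<open>Om\<close> and \<open>Omc\<close> have this form, and so have most of the
  cycle and boundary spaces found below, with a smaller \<open>M\<close>.\<close>

definition coef :: "(pt \<Rightarrow> real) set \<Rightarrow> 4 set set \<Rightarrow> form set" where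
  "coef \<G> M = {\<alpha>. (\<forall>I\<in>M. (\<lambda>x. \<alpha> x $ I) \<in> \<G>) \<and> (\<forall>I x. I \<notin> M \<longrightarrow> \<alpha> x $ I = 0)}"

lemma form_expansion: "\<alpha> = (\<lambda>x. \<Sum>I\<in>UNIV. \<alpha> x $ I *\<^sub>R \<theta> I)"
  by (rule ext) (rule ext_expansion)

lemma smooth_form_iff: "smooth (\<alpha>::form) \<longleftrightarrow> (\<forall>I. smooth (\<lambda>x. \<alpha> x $ I))"
proof
  assume "smooth \<alpha>"
  then show "\<forall>I. smooth (\<lambda>x. \<alpha> x $ I)" using smooth_linear[OF bounded_linear_vec_nth] by blast
next
  assume "\<forall>I. smooth (\<lambda>x. \<alpha> x $ I)"
  then have "smooth (\<lambda>x. \<Sum>I\<in>UNIV. \<alpha> x $ I *\<^sub>R \<theta> I)"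
    by (intro smooth_sum smooth_linear[OF bounded_linear_scaleR_left]) auto
  then show "smooth \<alpha>" unfolding form_expansion[of \<alpha>, symmetric] .
qed

lemma Om_eq_coef: "Om p q = coef Cinf (bideg p q)"
proof -
  have "smooth \<alpha> \<and> range \<alpha> \<subseteq> Lam p q \<longleftrightarrow> \<alpha> \<in> coef Cinf (bideg p q)" for \<alpha>
  proof -
    have L: "range \<alpha> \<subseteq> Lam p q \<longleftrightarrow> (\<forall>I x. I \<notin> bideg p q \<longrightarrow> \<alpha> x $ I = 0)"
      unfolding Lam_def span_theta by blast
    have "smooth (\<lambda>x. \<alpha> x $ I)" if "\<forall>x. \<alpha> x $ I = 0" for I
      using smooth_const[of "0::real"] that by simp
    then show ?thesis unfolding L smooth_form_iff coef_def mem_Collect_eq by meson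
  qed
  then show ?thesis unfolding Om_def by blast
qed

lemma test_span_theta: "test (span (\<theta> ` M)) = coef Ccinf M"
proof (intro set_eqI iffI)
  fix \<alpha> :: form assume "\<alpha> \<in> test (span (\<theta> ` M))"
  then obtain K where K: "smooth \<alpha>" "compact K" "\<And>x. x \<notin> K \<Longrightarrow> \<alpha> x = 0"
    "\<And>x I. I \<notin> M \<Longrightarrow> \<alpha> x $ I = 0"
    unfolding test_iff span_theta by blast
  have "(\<lambda>x. \<alpha> x $ I) \<in> Ccinf" for I
    by (rule testI[OF _ UNIV_I K(2)]) (use K smooth_form_iff in auto)
  then show "\<alpha> \<in> coef Ccinf M" using K(4) by (simp add: coef_def)
next
  fix \<alpha> assume \<alpha>: "\<alpha> \<in> coef Ccinf M"
  have "(\<lambda>x. \<alpha> x $ I) \<in> Ccinf" for I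
    using \<alpha> subspace_0[OF subspace_test[OF subspace_UNIV]]
    by (cases "I \<in> M") (auto simp: coef_def zero_fun_def)
  then have "\<forall>I. \<exists>K. compact K \<and> smooth (\<lambda>x. \<alpha> x $ I) \<and> (\<forall>x. x \<notin> K \<longrightarrow> \<alpha> x $ I = 0)"
    unfolding test_iff by blast
  from choice[OF this] obtain K where
    K: "\<And>I. compact (K I)" "\<And>I. smooth (\<lambda>x. \<alpha> x $ I)" "\<And>I x. x \<notin> K I \<Longrightarrow> \<alpha> x $ I = 0" by blast
  show "\<alpha> \<in> test (span (\<theta> ` M))"
  proof (rule testI)
    show "smooth \<alpha>" using K(2) by (simp add: smooth_form_iff)
    show "\<alpha> x \<in> span (\<theta> ` M)" for x using \<alpha> by (simp add: span_theta coef_def)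
    show "compact (\<Union>I. K I)" using K(1) by (intro compact_UN) auto
    show "\<alpha> x = 0" if "x \<notin> (\<Union>I. K I)" for x using that K(3) by (simp add: vec_eq_iff)
  qed
qed

lemma Omc_eq_coef: "Omc p q = coef Ccinf (bideg p q)"
  by (simp add: Omc_def Lam_def test_span_theta)

lemma subspace_coef:
  assumes "subspace \<G>"
  shows "subspace (coef \<G> M)"
proof (rule subspaceI)
  show "0 \<in> coef \<G> M" using subspace_0[OF assms] by (simp add: coef_def zero_fun_def)
next
  fix \<alpha> \<beta> assume "\<alpha> \<in> coef \<G> M" "\<beta> \<in> coef \<G> M"
  then show "\<alpha> + \<beta> \<in> coef \<G> M"
    using subspace_add[OF assms] unfolding coef_def by (fastforce simp: plus_fun_def)
next
  fix c \<alpha> assume "\<alpha> \<in> coef \<G> M"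
  then show "c *\<^sub>R \<alpha> \<in> coef \<G> M"
    using subspace_scale[OF assms, of _ c] unfolding coef_def by (fastforce simp: scaleR_fun_def)
qed

lemma coef_mono: "M \<subseteq> N \<Longrightarrow> 0 \<in> \<G> \<Longrightarrow> coef \<G> M \<subseteq> coef \<G> N"
  unfolding coef_def by (force simp: zero_fun_def)

lemma coef_empty: "coef \<G> {} = {0}"
  by (auto simp: coef_def fun_eq_iff vec_eq_iff)

lemma coef_single: "coef \<G> {I} = {\<lambda>x. a x *\<^sub>R \<theta> I | a. a \<in> \<G>}"
proof (intro set_eqI iffI)
  fix \<alpha> assume \<alpha>: "\<alpha> \<in> coef \<G> {I}"
  show "\<alpha> \<in> {\<lambda>x. a x *\<^sub>R \<theta> I | a. a \<in> \<G>}"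
  proof (intro CollectI exI[of _ "\<lambda>x. \<alpha> x $ I"] conjI)
    show "\<alpha> = (\<lambda>x. \<alpha> x $ I *\<^sub>R \<theta> I)"
      using \<alpha> by (intro ext) (simp add: coef_def vec_eq_iff theta_nth)
    show "(\<lambda>x. \<alpha> x $ I) \<in> \<G>" using \<alpha> by (simp add: coef_def)
  qed
next
  fix \<alpha> assume "\<alpha> \<in> {\<lambda>x. a x *\<^sub>R \<theta> I | a. a \<in> \<G>}"
  then obtain a where "\<alpha> = (\<lambda>x. a x *\<^sub>R \<theta> I)" "a \<in> \<G>" by blast
  then show "\<alpha> \<in> coef \<G> {I}" by (simp add: coef_def theta_nth)
qed

lemma coef_pair:
  assumes "I \<noteq> J"
  shows "coef \<G> {I, J} = {\<lambda>x. a x *\<^sub>R \<theta> I + b x *\<^sub>R \<theta> J | a b. a \<in> \<G> \<and> b \<in> \<G>}"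
proof (intro set_eqI iffI)
  fix \<alpha> assume \<alpha>: "\<alpha> \<in> coef \<G> {I, J}"
  show "\<alpha> \<in> {\<lambda>x. a x *\<^sub>R \<theta> I + b x *\<^sub>R \<theta> J | a b. a \<in> \<G> \<and> b \<in> \<G>}"
  proof (rule CollectI, rule exI[of _ "\<lambda>x. \<alpha> x $ I"], rule exI[of _ "\<lambda>x. \<alpha> x $ J"], intro conjI)
    show "\<alpha> = (\<lambda>x. \<alpha> x $ I *\<^sub>R \<theta> I + \<alpha> x $ J *\<^sub>R \<theta> J)"
      using \<alpha> assms by (intro ext) (simp add: coef_def vec_eq_iff theta_nth)
    show "(\<lambda>x. \<alpha> x $ I) \<in> \<G>" "(\<lambda>x. \<alpha> x $ J) \<in> \<G>" using \<alpha> by (simp_all add: coef_def)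
  qed
next
  fix \<alpha> assume "\<alpha> \<in> {\<lambda>x. a x *\<^sub>R \<theta> I + b x *\<^sub>R \<theta> J | a b. a \<in> \<G> \<and> b \<in> \<G>}"
  then obtain a b where "\<alpha> = (\<lambda>x. a x *\<^sub>R \<theta> I + b x *\<^sub>R \<theta> J)" "a \<in> \<G>" "b \<in> \<G>" by blast
  then show "\<alpha> \<in> coef \<G> {I, J}" using assms by (simp add: coef_def theta_nth)
qed

section \<open>Cycles and boundaries of order at most 3, with the auxiliary forms named\<close>

lemma Zr_1: "Zr F 1 p q = {\<alpha> \<in> F p q. d 0 \<alpha> = 0}"
  by (simp add: Zr_def)

lemma Zr_2: "Zr F 2 p q = {\<alpha> \<in> F p q. d 0 \<alpha> = 0 \<and> (\<exists>z\<in>F (p + 1) (q - 1). d 1 \<alpha> = d 0 z)}"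
proof -
  have "(\<exists>z::nat \<Rightarrow> form. z 1 \<in> F (p + 1) (q - 1) \<and> d 1 \<alpha> = d 0 (z 1)) \<longleftrightarrow>
      (\<exists>z\<in>F (p + 1) (q - 1). d 1 \<alpha> = d 0 z)" for \<alpha>
    by (auto intro: exI[of _ "\<lambda>_. _"])
  then show ?thesis by (simp add: Zr_def)
qed

lemma atLeastAtMost_1_2: "{1..2::nat} = {1, 2}" "{Suc 0..2} = {1, 2}" "{0..2::nat} = {0, 1, 2}" "{0..Suc 0} = {0, 1}"
  by auto

lemma Zr_3: "Zr F 3 p q = {\<alpha> \<in> F p q. d 0 \<alpha> = 0 \<and> (\<exists>z\<in>F (p + 1) (q - 1). \<exists>w\<in>F (p + 2) (q - 2).
    d 1 \<alpha> = d 0 z \<and> d 2 \<alpha> = d 0 w + d 1 z)}"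
proof -
  have "(\<exists>z::nat \<Rightarrow> form. (z 1 \<in> F (p + 1) (q - 1) \<and> z 2 \<in> F (p + 2) (q - 2)) \<and>
        d 1 \<alpha> = d 0 (z 1) \<and> d 2 \<alpha> = d 0 (z 2) + d 1 (z 1)) \<longleftrightarrow>
      (\<exists>z\<in>F (p + 1) (q - 1). \<exists>w\<in>F (p + 2) (q - 2). d 1 \<alpha> = d 0 z \<and> d 2 \<alpha> = d 0 w + d 1 z)"
    (is "?L \<longleftrightarrow> ?R") for \<alpha>
  proof
    assume ?R
    then obtain z w where "z \<in> F (p + 1) (q - 1)" "w \<in> F (p + 2) (q - 2)"
      "d 1 \<alpha> = d 0 z \<and> d 2 \<alpha> = d 0 w + d 1 z" by blast
    then show ?L by (intro exI[of _ "\<lambda>j. if j = 1 then z else w"]) simp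
  qed blast
  then show ?thesis by (simp add: Zr_def atLeastAtMost_1_2)
qed

lemma Br_1: "Br F 1 p q = {\<alpha> \<in> F p q. \<exists>c\<in>F p (q - 1). \<alpha> = d 0 c}"
proof -
  have "(\<exists>c::nat \<Rightarrow> form. c 0 \<in> F p (q - 1) \<and> \<alpha> = d 0 (c 0)) \<longleftrightarrow> (\<exists>c\<in>F p (q - 1). \<alpha> = d 0 c)" for \<alpha>
    by (auto intro: exI[of _ "\<lambda>_. _"])
  then show ?thesis by (simp add: Br_def)
qed

lemma Br_2: "Br F 2 p q = {\<alpha> \<in> F p q. \<exists>c\<in>F p (q - 1). \<exists>e\<in>F (p - 1) q.
    \<alpha> = d 0 c + d 1 e \<and> 0 = d 0 e}"
proof -
  have "(\<exists>c::nat \<Rightarrow> form. (c 0 \<in> F p (q - 1) \<and> c 1 \<in> F (p - 1) q) \<and> \<alpha> = d 0 (c 0) + d 1 (c 1) \<and> 0 = d 0 (c 1)) \<longleftrightarrow>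
     (\<exists>c\<in>F p (q - 1). \<exists>e\<in>F (p - 1) q. \<alpha> = d 0 c + d 1 e \<and> 0 = d 0 e)"
    (is "?L \<longleftrightarrow> ?R") for \<alpha>
  proof
    assume ?R
    then obtain c e where "c \<in> F p (q - 1)" "e \<in> F (p - 1) q" "\<alpha> = d 0 c + d 1 e \<and> 0 = d 0 e" by blast
    then show ?L by (intro exI[of _ "\<lambda>j. if j = 0 then c else e"]) simp
  qed blast
  then show ?thesis by (simp add: Br_def atLeastAtMost_1_2)
qed

lemma Br_3: "Br F 3 p q = {\<alpha> \<in> F p q. \<exists>c\<in>F p (q - 1). \<exists>e\<in>F (p - 1) q. \<exists>g\<in>F (p - 2) (q + 1).
    \<alpha> = d 0 c + d 1 e + d 2 g \<and> 0 = d 0 e + d 1 g \<and> 0 = d 0 g}"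
proof -
  have "(\<exists>c::nat \<Rightarrow> form. (c 0 \<in> F p (q - 1) \<and> c 1 \<in> F (p - 1) q \<and> c 2 \<in> F (p - 2) (q + 1)) \<and>
        \<alpha> = d 0 (c 0) + (d 1 (c 1) + d 2 (c 2)) \<and> 0 = d 0 (c 1) + d 1 (c 2) \<and> 0 = d 0 (c 2)) \<longleftrightarrow>
     (\<exists>c\<in>F p (q - 1). \<exists>e\<in>F (p - 1) q. \<exists>g\<in>F (p - 2) (q + 1).
        \<alpha> = d 0 c + d 1 e + d 2 g \<and> 0 = d 0 e + d 1 g \<and> 0 = d 0 g)"
    (is "?L \<longleftrightarrow> ?R") for \<alpha>
  proof
    assume ?R
    then obtain c e g where "c \<in> F p (q - 1)" "e \<in> F (p - 1) q" "g \<in> F (p - 2) (q + 1)"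
      "\<alpha> = d 0 c + d 1 e + d 2 g \<and> 0 = d 0 e + d 1 g \<and> 0 = d 0 g" by blast
    then show ?L by (intro exI[of _ "\<lambda>j. if j = 0 then c else if j = 1 then e else g"]) (simp add: add.assoc)
  qed (auto simp: add.assoc)
  then show ?thesis by (simp add: Br_def atLeastAtMost_1_2 add.commute[of q 1])
qed

lemma Br_2I:
  "\<lbrakk>\<alpha> \<in> F p q; c \<in> F p (q - 1); e \<in> F (p - 1) q; \<alpha> = d 0 c + d 1 e; 0 = d 0 e\<rbrakk> \<Longrightarrow> \<alpha> \<in> Br F 2 p q"
  unfolding Br_2 by blast

lemma Br_3I:
  "\<lbrakk>\<alpha> \<in> F p q; c \<in> F p (q - 1); e \<in> F (p - 1) q; g \<in> F (p - 2) (q + 1);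
    \<alpha> = d 0 c + d 1 e + d 2 g; 0 = d 0 e + d 1 g; 0 = d 0 g\<rbrakk> \<Longrightarrow> \<alpha> \<in> Br F 3 p q"
  unfolding Br_3 by blast

lemma d_explicit:
  "d 0 \<alpha> = (\<lambda>x. dinv (\<alpha> x))"
  "d 1 \<alpha> = (\<lambda>x. wedge (\<theta> {1}) (X 1 \<alpha> x) + wedge (\<theta> {2}) (X 2 \<alpha> x))"
  "d 2 \<alpha> = (\<lambda>x. wedge (\<theta> {3}) (X 3 \<alpha> x))"
proof -
  have "{i. weight i = 1} = {1, 2}" "{i. weight i = 2} = {3}"
    by (auto simp: set4_eq_iff weight_def)
  then show "d 1 \<alpha> = (\<lambda>x. wedge (\<theta> {1}) (X 1 \<alpha> x) + wedge (\<theta> {2}) (X 2 \<alpha> x))"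
    "d 2 \<alpha> = (\<lambda>x. wedge (\<theta> {3}) (X 3 \<alpha> x))"
    by (simp_all add: d_def)
qed (simp add: d_def)

lemma X_form:
  assumes "smooth a"
  shows "X i (\<lambda>x. a x *\<^sub>R (\<xi>::ext)) = (\<lambda>x. X i a x *\<^sub>R \<xi>)"
  by (rule X_linear[OF bounded_linear_scaleR_left assms])

lemma smooth_monomial: "smooth a \<Longrightarrow> smooth (\<lambda>x. a x *\<^sub>R (\<xi>::ext))"
  by (rule smooth_linear[OF bounded_linear_scaleR_left])

lemma d_monomial:
  assumes "smooth a"
  shows "d 0 (\<lambda>x. a x *\<^sub>R \<theta> I) = (\<lambda>x. a x *\<^sub>R dinv (\<theta> I))"
    "d 1 (\<lambda>x. a x *\<^sub>R \<theta> I) = (\<lambda>x. X 1 a x *\<^sub>R theta_wedge {1} I + X 2 a x *\<^sub>R theta_wedge {2} I)"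
    "d 2 (\<lambda>x. a x *\<^sub>R \<theta> I) = (\<lambda>x. X 3 a x *\<^sub>R theta_wedge {3} I)"
  by (simp_all add: d_explicit[unfolded One_nat_def] d_explicit X_form[OF assms] dinv_linear wedge_linear_right wedge_theta)

lemma d_binomial:
  assumes "smooth a" "smooth b"
  shows "d 0 (\<lambda>x. a x *\<^sub>R \<theta> I + b x *\<^sub>R \<theta> J) = (\<lambda>x. a x *\<^sub>R dinv (\<theta> I) + b x *\<^sub>R dinv (\<theta> J))"
    "d 1 (\<lambda>x. a x *\<^sub>R \<theta> I + b x *\<^sub>R \<theta> J) =
       (\<lambda>x. X 1 a x *\<^sub>R theta_wedge {1} I + X 1 b x *\<^sub>R theta_wedge {1} J +
            (X 2 a x *\<^sub>R theta_wedge {2} I + X 2 b x *\<^sub>R theta_wedge {2} J))"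
    "d 2 (\<lambda>x. a x *\<^sub>R \<theta> I + b x *\<^sub>R \<theta> J) = (\<lambda>x. X 3 a x *\<^sub>R theta_wedge {3} I + X 3 b x *\<^sub>R theta_wedge {3} J)"
  by (simp_all add: d_explicit[unfolded One_nat_def] d_explicit X_form assms X_add smooth_monomial dinv_linear
      wedge_linear_right wedge_theta)

lemma d_zero: "d 0 0 = 0" "d 1 0 = 0" "d (Suc 0) 0 = 0" "d 2 0 = 0"
  using d_monomial[OF smooth_const[of 0], of "{}"] X_scaleR[OF smooth_const[of "0::real"], of _ 0]
  by (simp_all add: zero_fun_def)

lemma monomial_eq_iff: "(\<lambda>x. a x *\<^sub>R \<theta> I) = (\<lambda>x. b x *\<^sub>R \<theta> I) \<longleftrightarrow> a = b"
  "(\<lambda>x. a x *\<^sub>R \<theta> I) = 0 \<longleftrightarrow> a = 0"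
proof -
  have "\<theta> I \<noteq> 0" by (auto simp: vec_eq_iff theta_nth)
  then show "(\<lambda>x. a x *\<^sub>R \<theta> I) = (\<lambda>x. b x *\<^sub>R \<theta> I) \<longleftrightarrow> a = b" "(\<lambda>x. a x *\<^sub>R \<theta> I) = 0 \<longleftrightarrow> a = 0"
    by (auto simp: fun_eq_iff)
qed

text \<open>In the compactly supported spaces the auxiliary forms must have compact support too.
  Every witness below arises from given coefficients by sums, signs and the fields
  \<open>X i\<close>, so a class closed under these covers both versions at once.\<close>

locale coefficients =
  fixes \<G> :: "(pt \<Rightarrow> real) set" and F :: "int \<Rightarrow> int \<Rightarrow> form set"
  assumes sub: "subspace \<G>" and smooth: "f \<in> \<G> \<Longrightarrow> smooth f" and X_closed: "f \<in> \<G> \<Longrightarrow> X i f \<in> \<G>"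
    and F: "F p q = coef \<G> (bideg p q)"
begin

lemma closed:
  "f \<in> \<G> \<Longrightarrow> g \<in> \<G> \<Longrightarrow> (\<lambda>x. f x + g x) \<in> \<G>" "f \<in> \<G> \<Longrightarrow> g \<in> \<G> \<Longrightarrow> (\<lambda>x. f x - g x) \<in> \<G>"
  "f \<in> \<G> \<Longrightarrow> (\<lambda>x. - f x) \<in> \<G>" "(\<lambda>x. 0) \<in> \<G>" "0 \<in> \<G>"
  using subspace_add[OF sub, of f g] subspace_diff[OF sub, of f g] subspace_neg[OF sub, of f] subspace_0[OF sub]
  by (simp_all add: plus_fun_def fun_diff_def fun_Compl_def zero_fun_def)

lemma F_simps:
  "F 1 0 = {\<lambda>x. a x *\<^sub>R \<theta> {1} + b x *\<^sub>R \<theta> {2} | a b. a \<in> \<G> \<and> b \<in> \<G>}"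
  "F 2 (-1) = {\<lambda>x. a x *\<^sub>R \<theta> {3} | a. a \<in> \<G>}"
  "F 3 (-2) = {\<lambda>x. a x *\<^sub>R \<theta> {4} | a. a \<in> \<G>}"
  "F 3 (-1) = {\<lambda>x. a x *\<^sub>R \<theta> {1, 3} + b x *\<^sub>R \<theta> {2, 3} | a b. a \<in> \<G> \<and> b \<in> \<G>}"
  "F 4 (-2) = {\<lambda>x. a x *\<^sub>R \<theta> {1, 4} + b x *\<^sub>R \<theta> {2, 4} | a b. a \<in> \<G> \<and> b \<in> \<G>}"
  "F 5 (-3) = {\<lambda>x. a x *\<^sub>R \<theta> {3, 4} | a. a \<in> \<G>}"
  "F 6 (-3) = {\<lambda>x. a x *\<^sub>R \<theta> {1, 3, 4} + b x *\<^sub>R \<theta> {2, 3, 4} | a b. a \<in> \<G> \<and> b \<in> \<G>}"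
  "F 1 (-1) = {0}" "F 4 (-3) = {0}" "F 6 (-4) = {0}"
  by (simp_all add: F bideg_simps coef_single coef_pair coef_empty set4_eq_iff)

lemma F_intros:
  "a \<in> \<G> \<Longrightarrow> b \<in> \<G> \<Longrightarrow> (\<lambda>x. a x *\<^sub>R \<theta> {1} + b x *\<^sub>R \<theta> {2}) \<in> F 1 0"
  "a \<in> \<G> \<Longrightarrow> (\<lambda>x. a x *\<^sub>R \<theta> {3}) \<in> F 2 (-1)"
  "a \<in> \<G> \<Longrightarrow> (\<lambda>x. a x *\<^sub>R \<theta> {4}) \<in> F 3 (-2)"
  "a \<in> \<G> \<Longrightarrow> b \<in> \<G> \<Longrightarrow> (\<lambda>x. a x *\<^sub>R \<theta> {1, 3} + b x *\<^sub>R \<theta> {2, 3}) \<in> F 3 (-1)"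
  "a \<in> \<G> \<Longrightarrow> b \<in> \<G> \<Longrightarrow> (\<lambda>x. a x *\<^sub>R \<theta> {1, 4} + b x *\<^sub>R \<theta> {2, 4}) \<in> F 4 (-2)"
  "a \<in> \<G> \<Longrightarrow> (\<lambda>x. a x *\<^sub>R \<theta> {3, 4}) \<in> F 5 (-3)"
  "a \<in> \<G> \<Longrightarrow> b \<in> \<G> \<Longrightarrow> (\<lambda>x. a x *\<^sub>R \<theta> {1, 3, 4} + b x *\<^sub>R \<theta> {2, 3, 4}) \<in> F 6 (-3)"
  unfolding F by (simp_all add: bideg_simps coef_def theta_nth set4_eq_iff)

lemma subspace_F: "subspace (F p q)"
  unfolding F by (rule subspace_coef[OF sub])

lemma zero_F: "0 \<in> F p q"
  by (rule subspace_0[OF subspace_F])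

lemma Zr_1_6: "Zr F 1 6 (-3) = F 6 (-3)"
proof -
  have "d 0 \<alpha> = 0" if \<alpha>: "\<alpha> \<in> F 6 (-3)" for \<alpha>
  proof -
    obtain a b where "a \<in> \<G>" "b \<in> \<G>" "\<alpha> = (\<lambda>x. a x *\<^sub>R \<theta> {1, 3, 4} + b x *\<^sub>R \<theta> {2, 3, 4})"
      using \<alpha> unfolding F_simps by blast
    then show ?thesis by (simp add: d_binomial smooth dinv_theta zero_fun_def)
  qed
  then show ?thesis unfolding Zr_1 by blast
qed

text \<open>No 2-form has weight 6, and \<open>d 0\<close> is injective on multiples of
  \<open>\<theta> {3, 4}\<close>, so both auxiliary forms vanish.\<close>

lemma Br_2_6: "Br F 2 6 (-3) = {0}"
proof -
  have "e = 0" if e: "e \<in> F 5 (-3)" "0 = d 0 e" for e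
  proof -
    obtain a where a: "a \<in> \<G>" "e = (\<lambda>x. a x *\<^sub>R \<theta> {3, 4})" using e(1) unfolding F_simps by blast
    then have "(\<lambda>x. (- a x) *\<^sub>R \<theta> {1, 2, 4}) = 0"
      using e(2) by (simp add: d_monomial smooth dinv_theta)
    then have "(\<lambda>x. - a x) = 0" by (simp only: monomial_eq_iff)
    then show "e = 0" using a(2) by (simp add: fun_eq_iff)
  qed
  then show ?thesis
    unfolding Br_2 using zero_F[of 5 "-3"] zero_F[of 6 "-3"] d_zero by (auto simp: F_simps(10))
qed

lemma Br_1_1: "Br F 1 1 0 = {0}"
  unfolding Br_1 using zero_F[of 1 0] d_zero by (auto simp: F_simps(8))

text \<open>\<open>d 1 \<alpha>\<close> is a multiple of \<open>\<theta> {1, 2}\<close>, which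
  equals \<open>- dinv (\<theta> {3})\<close>; the equation for the auxiliary form is therefore
  always solvable.\<close>

lemma Zr_2_1: "Zr F 2 1 0 = F 1 0"
proof -
  have "\<alpha> \<in> Zr F 2 1 0" if \<alpha>: "\<alpha> \<in> F 1 0" for \<alpha>
  proof -
    obtain a b where a: "a \<in> \<G>" "b \<in> \<G>" "\<alpha> = (\<lambda>x. a x *\<^sub>R \<theta> {1} + b x *\<^sub>R \<theta> {2})"
      using \<alpha> unfolding F_simps by blast
    have h: "(\<lambda>x. X 2 a x - X 1 b x) \<in> \<G>" using a by (intro closed X_closed)
    have "d 0 \<alpha> = 0" using a by (simp add: d_binomial smooth dinv_theta zero_fun_def)
    moreover have "d 1 \<alpha> = d 0 (\<lambda>x. (X 2 a x - X 1 b x) *\<^sub>R \<theta> {3})"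
      unfolding a(3) d_binomial[OF smooth smooth, OF a(1,2)] d_monomial[OF smooth[OF h]]
      by (simp add: one_theta_wedge dinv_theta algebra_simps)
    moreover have "(\<lambda>x. (X 2 a x - X 1 b x) *\<^sub>R \<theta> {3}) \<in> F 2 (-1)" by (rule F_intros[OF h])
    ultimately show ?thesis using \<alpha> unfolding Zr_2 by auto
  qed
  then show ?thesis by (auto simp: Zr_2)
qed

text \<open>The first equation determines the coefficient \<open>h\<close> of
  \<open>\<theta> {3}\<close>. In the second, the \<open>\<theta> {1, 3}\<close> component is
  absorbed by the free coefficient of \<open>\<theta> {4}\<close>. The
  \<open>\<theta> {2, 3}\<close> component cannot be corrected, as \<open>d 0\<close> of a multiple
  of \<open>\<theta> {4}\<close> has none; it is the stated condition.\<close>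

lemma Zr_3_1: "Zr F 3 1 0 = {\<lambda>x. a x *\<^sub>R \<theta> {1} + b x *\<^sub>R \<theta> {2} | a b. a \<in> \<G> \<and> b \<in> \<G> \<and>
   (\<forall>x. X 2 (X 2 a) x - X 2 (X 1 b) x + X 3 b x = 0)}"
proof (intro set_eqI iffI)
  fix \<alpha> assume \<alpha>: "\<alpha> \<in> Zr F 3 1 0"
  then obtain a b where a: "a \<in> \<G>" "b \<in> \<G>" "\<alpha> = (\<lambda>x. a x *\<^sub>R \<theta> {1} + b x *\<^sub>R \<theta> {2})"
    unfolding Zr_3 F_simps by blast
  obtain z w where zw: "z \<in> F 2 (-1)" "w \<in> F 3 (-2)" "d 1 \<alpha> = d 0 z" "d 2 \<alpha> = d 0 w + d 1 z"
    using \<alpha> unfolding Zr_3 by auto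
  obtain h k where h: "h \<in> \<G>" "z = (\<lambda>x. h x *\<^sub>R \<theta> {3})" and k: "k \<in> \<G>" "w = (\<lambda>x. k x *\<^sub>R \<theta> {4})"
    using zw(1,2) unfolding F_simps by blast
  have "h x = X 2 a x - X 1 b x" for x
  proof -
    have "(d 1 \<alpha> x) $ {1, 2} = (d 0 z x) $ {1, 2}" using zw(3) by simp
    then show ?thesis
      unfolding a(3) h(2) d_binomial[OF smooth smooth, OF a(1,2)] d_monomial[OF smooth[OF h(1)]]
      by (simp add: one_theta_wedge dinv_theta theta_nth)
  qed
  then have heq: "h = (\<lambda>x. X 2 a x - X 1 b x)" by blast
  have "X 2 h x = - X 3 b x" for x
  proof -
    have "(d 2 \<alpha> x) $ {2, 3} = (d 0 w x + d 1 z x) $ {2, 3}" using zw(4) by simp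
    then show ?thesis
      unfolding a(3) h(2) k(2) d_binomial[OF smooth smooth, OF a(1,2)] d_monomial[OF smooth[OF h(1)]]
        d_monomial[OF smooth[OF k(1)]]
      by (simp add: one_theta_wedge dinv_theta theta_nth set4_eq_iff)
  qed
  moreover have "X 2 h = (\<lambda>x. X 2 (X 2 a) x - X 2 (X 1 b) x)"
    unfolding heq using a by (intro X_diff smooth X_closed)
  ultimately have "\<forall>x. X 2 (X 2 a) x - X 2 (X 1 b) x + X 3 b x = 0" by (simp add: fun_eq_iff)
  then show "\<alpha> \<in> {\<lambda>x. a x *\<^sub>R \<theta> {1} + b x *\<^sub>R \<theta> {2} | a b. a \<in> \<G> \<and> b \<in> \<G> \<and>
   (\<forall>x. X 2 (X 2 a) x - X 2 (X 1 b) x + X 3 b x = 0)}" using a by blast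
next
  fix \<alpha> assume "\<alpha> \<in> {\<lambda>x. a x *\<^sub>R \<theta> {1} + b x *\<^sub>R \<theta> {2} | a b. a \<in> \<G> \<and> b \<in> \<G> \<and>
   (\<forall>x. X 2 (X 2 a) x - X 2 (X 1 b) x + X 3 b x = 0)}"
  then obtain a b where a: "a \<in> \<G>" "b \<in> \<G>" "\<alpha> = (\<lambda>x. a x *\<^sub>R \<theta> {1} + b x *\<^sub>R \<theta> {2})"
    and eq: "\<And>x. X 2 (X 2 a) x - X 2 (X 1 b) x + X 3 b x = 0" by blast
  define h where "h = (\<lambda>x. X 2 a x - X 1 b x)"
  \<comment> \<open>Read off from the \<open>\<theta> {1, 3}\<close> component of the second
    equation.\<close>
  define k where "k = (\<lambda>x. X 3 a x + X 1 h x)"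
  have h: "h \<in> \<G>" unfolding h_def using a by (intro closed X_closed)
  have k: "k \<in> \<G>" unfolding k_def using a h by (intro closed X_closed)
  have X2h: "X 2 h x = - X 3 b x" for x
  proof -
    have "X 2 h = (\<lambda>x. X 2 (X 2 a) x - X 2 (X 1 b) x)"
      unfolding h_def using a by (intro X_diff smooth X_closed)
    then show ?thesis using eq[of x] by simp
  qed
  have "d 0 \<alpha> = 0" using a by (simp add: d_binomial smooth dinv_theta zero_fun_def)
  moreover have "d 1 \<alpha> = d 0 (\<lambda>x. h x *\<^sub>R \<theta> {3})"
    unfolding a(3) d_binomial[OF smooth smooth, OF a(1,2)] d_monomial[OF smooth[OF h]]
    by (simp add: one_theta_wedge dinv_theta h_def algebra_simps)
  moreover have "d 2 \<alpha> = d 0 (\<lambda>x. k x *\<^sub>R \<theta> {4}) + d 1 (\<lambda>x. h x *\<^sub>R \<theta> {3})"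
    unfolding a(3) d_binomial[OF smooth smooth, OF a(1,2)] d_monomial[OF smooth[OF h]] d_monomial[OF smooth[OF k]]
    by (simp add: one_theta_wedge dinv_theta k_def X2h plus_fun_def algebra_simps)
  moreover have "(\<lambda>x. h x *\<^sub>R \<theta> {3}) \<in> F 2 (-1)" "(\<lambda>x. k x *\<^sub>R \<theta> {4}) \<in> F 3 (-2)" "\<alpha> \<in> F 1 0"
    unfolding a(3) using h k a by (auto intro: F_intros)
  ultimately show "\<alpha> \<in> Zr F 3 1 0" unfolding Zr_3 by auto
qed

text \<open>\<open>d 1 \<alpha>\<close> is a multiple of \<open>\<theta> {1, 2, 3}\<close>, hence
  \<open>d 0\<close> of a multiple of \<open>\<theta> {2, 4}\<close>. Next
  \<open>d 2 \<alpha>\<close> vanishes because the factor \<open>\<theta> {3}\<close> is repeated,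
  and what \<open>d 1\<close> leaves of the auxiliary form is a multiple of
  \<open>\<theta> {1, 2, 4}\<close>, cancelled by \<open>d 0\<close> of a multiple of
  \<open>\<theta> {3, 4}\<close>.\<close>

lemma Zr_3_3: "Zr F 3 3 (-1) = F 3 (-1)"
proof -
  have "\<alpha> \<in> Zr F 3 3 (-1)" if \<alpha>: "\<alpha> \<in> F 3 (-1)" for \<alpha>
  proof -
    obtain a b where a: "a \<in> \<G>" "b \<in> \<G>" "\<alpha> = (\<lambda>x. a x *\<^sub>R \<theta> {1, 3} + b x *\<^sub>R \<theta> {2, 3})"
      using \<alpha> unfolding F_simps by blast
    define h where "h = (\<lambda>x. X 2 a x - X 1 b x)"
    have h: "h \<in> \<G>" unfolding h_def using a by (intro closed X_closed)
    note dz = d_binomial[OF smooth smooth, OF closed(4) h, of "{1, 4}" "{2, 4}"]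
    have X0: "X i (\<lambda>x. 0::real) x = 0" for i x
      using X_scaleR[OF smooth_const[of "0::real"], of i 0] by simp
    have "d 0 \<alpha> = 0" using a by (simp add: d_binomial smooth dinv_theta zero_fun_def)
    moreover have "d 1 \<alpha> = d 0 (\<lambda>x. 0 *\<^sub>R \<theta> {1, 4} + h x *\<^sub>R \<theta> {2, 4})"
      unfolding a(3) d_binomial[OF smooth smooth, OF a(1,2)] dz
      by (simp add: one_theta_wedge dinv_theta h_def algebra_simps)
    moreover have "d 2 \<alpha> = d 0 (\<lambda>x. X 1 h x *\<^sub>R \<theta> {3, 4}) + d 1 (\<lambda>x. 0 *\<^sub>R \<theta> {1, 4} + h x *\<^sub>R \<theta> {2, 4})"
      unfolding a(3) d_binomial[OF smooth smooth, OF a(1,2)] d_monomial[OF smooth[OF X_closed[OF h]]] dz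
      by (simp add: one_theta_wedge dinv_theta plus_fun_def zero_fun_def X0)
    moreover have "(\<lambda>x. 0 *\<^sub>R \<theta> {1, 4} + h x *\<^sub>R \<theta> {2, 4}) \<in> F 4 (-2)"
      using h closed(4) by (intro F_intros)
    moreover have "(\<lambda>x. X 1 h x *\<^sub>R \<theta> {3, 4}) \<in> F 5 (-3)"
      using X_closed[OF h] by (intro F_intros)
    ultimately show ?thesis using \<alpha> unfolding Zr_3 by auto
  qed
  then show ?thesis by (auto simp: Zr_3)
qed

text \<open>Injectivity of \<open>d 0\<close> on multiples of \<open>\<theta> {3}\<close> kills the
  auxiliary form of lower weight; \<open>d 0\<close> of multiples of \<open>\<theta> {4}\<close>
  gives the rest.\<close>

lemma Br_2_3: "Br F 2 3 (-1) = coef \<G> {{1, 3}}"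
proof (intro set_eqI iffI)
  fix \<alpha> assume "\<alpha> \<in> Br F 2 3 (-1)"
  then obtain c e where ce: "c \<in> F 3 (-2)" "e \<in> F 2 (-1)" "\<alpha> = d 0 c + d 1 e" "0 = d 0 e"
    unfolding Br_2 by auto
  obtain a b where a: "a \<in> \<G>" "c = (\<lambda>x. a x *\<^sub>R \<theta> {4})" and b: "b \<in> \<G>" "e = (\<lambda>x. b x *\<^sub>R \<theta> {3})"
    using ce unfolding F_simps by blast
  have "(\<lambda>x. (- b x) *\<^sub>R \<theta> {1, 2}) = 0"
    using ce(4) b by (simp add: d_monomial smooth dinv_theta)
  then have "(\<lambda>x. - b x) = 0" by (simp only: monomial_eq_iff)
  then have "e = 0" using b(2) by (simp add: fun_eq_iff)
  then have "\<alpha> = (\<lambda>x. (- a x) *\<^sub>R \<theta> {1, 3})"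
    using ce(3) a by (simp add: d_zero d_monomial smooth dinv_theta)
  then show "\<alpha> \<in> coef \<G> {{1, 3}}" using closed(3)[OF a(1)] by (simp add: coef_def theta_nth)
next
  fix \<alpha> assume "\<alpha> \<in> coef \<G> {{1, 3}}"
  then obtain a where a: "a \<in> \<G>" "\<alpha> = (\<lambda>x. a x *\<^sub>R \<theta> {1, 3})" by (auto simp: coef_single)
  have "(\<lambda>x. (- a x) *\<^sub>R \<theta> {4}) \<in> F 3 (-2)" using closed(3)[OF a(1)] by (intro F_intros)
  moreover have "\<alpha> = d 0 (\<lambda>x. (- a x) *\<^sub>R \<theta> {4}) + d 1 0"
    unfolding d_monomial[OF smooth[OF closed(3)[OF a(1)]]] a(2) d_zero by (simp add: dinv_theta)
  moreover have "\<alpha> = (\<lambda>x. a x *\<^sub>R \<theta> {1, 3} + 0 *\<^sub>R \<theta> {2, 3})" using a(2) by simp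
  then have "\<alpha> \<in> F 3 (-1)"
    using F_intros(4)[OF a(1) closed(4)] by simp
  ultimately show "\<alpha> \<in> Br F 2 3 (-1)"
    using zero_F[of 2 "-1"] d_zero(1) by (intro Br_2I[of _ _ _ _ "\<lambda>x. (- a x) *\<^sub>R \<theta> {4}" 0]) simp_all
qed

lemma d0_4_2:
  assumes "\<alpha> \<in> F 4 (-2)"
  shows "d 0 \<alpha> = 0 \<longleftrightarrow> \<alpha> \<in> coef \<G> {{1, 4}}"
proof -
  obtain a b where a: "a \<in> \<G>" "b \<in> \<G>" "\<alpha> = (\<lambda>x. a x *\<^sub>R \<theta> {1, 4} + b x *\<^sub>R \<theta> {2, 4})"
    using assms unfolding F_simps by blast
  have "d 0 \<alpha> = (\<lambda>x. (- b x) *\<^sub>R \<theta> {1, 2, 3})"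
    using a by (simp add: d_binomial smooth dinv_theta)
  then have "d 0 \<alpha> = 0 \<longleftrightarrow> (\<lambda>x. - b x) = 0" by (simp only: monomial_eq_iff)
  also have "\<dots> \<longleftrightarrow> \<alpha> \<in> coef \<G> {{1, 4}}"
  proof
    assume "(\<lambda>x. - b x) = 0"
    then have "b x = 0" for x by (auto simp: fun_eq_iff)
    then have "\<alpha> = (\<lambda>x. a x *\<^sub>R \<theta> {1, 4})" by (simp add: a(3))
    then show "\<alpha> \<in> coef \<G> {{1, 4}}" using a(1) by (simp add: coef_def theta_nth)
  next
    assume "\<alpha> \<in> coef \<G> {{1, 4}}"
    then have "\<alpha> x $ {2, 4} = 0" for x by (simp add: coef_def set4_eq_iff)
    then have "b x = 0" for x by (simp add: a(3) theta_nth set4_eq_iff)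
    then show "(\<lambda>x. - b x) = 0" by (simp add: zero_fun_def)
  qed
  finally show ?thesis .
qed

text \<open>Being \<open>d 0\<close>-closed already removes \<open>\<theta> {2, 4}\<close>. For the
  remaining monomial \<open>d 1\<close> yields a multiple of \<open>\<theta> {1, 2, 4}\<close>,
  which is again in the image of \<open>d 0\<close>.\<close>

lemma Zr_2_4: "Zr F 2 4 (-2) = coef \<G> {{1, 4}}"
proof -
  have sub: "coef \<G> {{1, 4}} \<subseteq> F 4 (-2)"
    unfolding F bideg_simps by (intro coef_mono closed(5)) auto
  have "\<alpha> \<in> Zr F 2 4 (-2)" if \<alpha>: "\<alpha> \<in> coef \<G> {{1, 4}}" for \<alpha>
  proof -
    obtain a where a: "a \<in> \<G>" "\<alpha> = (\<lambda>x. a x *\<^sub>R \<theta> {1, 4})" using \<alpha> by (auto simp: coef_single)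
    have "d 1 \<alpha> = d 0 (\<lambda>x. X 2 a x *\<^sub>R \<theta> {3, 4})"
      unfolding a(2) d_monomial[OF smooth[OF a(1)]] d_monomial[OF smooth[OF X_closed[OF a(1)]]]
      by (simp add: one_theta_wedge dinv_theta)
    moreover have "(\<lambda>x. X 2 a x *\<^sub>R \<theta> {3, 4}) \<in> F 5 (-3)"
      using X_closed[OF a(1)] by (intro F_intros)
    ultimately show ?thesis
      unfolding Zr_2 using sub \<alpha> d0_4_2 by auto
  qed
  then show ?thesis using d0_4_2 by (auto simp: Zr_2)
qed

text \<open>The constraints are solved from the lowest weight upwards: injectivity of
  \<open>d 0\<close> first gives \<open>g = 0\<close>, then \<open>e = 0\<close>, and there is no
  1-form of weight 4.\<close>

lemma Br_3_4: "Br F 3 4 (-2) = {0}"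
proof -
  have "\<alpha> = 0" if \<alpha>: "\<alpha> \<in> Br F 3 4 (-2)" for \<alpha>
  proof -
    obtain c e g where raw: "c \<in> F 4 (-2 - 1)" "e \<in> F (4 - 1) (-2)" "g \<in> F (4 - 2) (-2 + 1)"
      "\<alpha> = d 0 c + d 1 e + d 2 g" "0 = d 0 e + d 1 g" "0 = d 0 g"
      using \<alpha> unfolding Br_3 by blast
    have "c = 0" using raw(1) by (simp add: F_simps(9))
    then have eg: "e \<in> F 3 (-2)" "g \<in> F 2 (-1)" "\<alpha> = d 0 0 + d 1 e + d 2 g"
      "0 = d 0 e + d 1 g" "0 = d 0 g"
      using raw by simp_all
    obtain a b where a: "a \<in> \<G>" "e = (\<lambda>x. a x *\<^sub>R \<theta> {4})" and b: "b \<in> \<G>" "g = (\<lambda>x. b x *\<^sub>R \<theta> {3})"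
      using eg unfolding F_simps by blast
    have "(\<lambda>x. (- b x) *\<^sub>R \<theta> {1, 2}) = 0"
      using eg(5) b by (simp add: d_monomial smooth dinv_theta)
    then have "(\<lambda>x. - b x) = 0" by (simp only: monomial_eq_iff)
    then have g: "g = 0" using b(2) by (simp add: fun_eq_iff)
    then have "(\<lambda>x. (- a x) *\<^sub>R \<theta> {1, 3}) = 0"
      using eg(4) a by (simp add: d_zero d_monomial smooth dinv_theta)
    then have "(\<lambda>x. - a x) = 0" by (simp only: monomial_eq_iff)
    then have "e = 0" using a(2) by (simp add: fun_eq_iff)
    then show "\<alpha> = 0" using g eg(3) d_zero by simp
  qed
  moreover have "0 \<in> Br F 3 4 (-2)"
    using zero_F d_zero by (intro Br_3I[of _ _ _ _ 0 0 0]) simp_all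
  ultimately show ?thesis by blast
qed

text \<open>The constraints leave one free function: \<open>d 0 g = 0\<close> makes \<open>g\<close>
  a multiple \<open>f\<close> of \<open>\<theta> {1, 4}\<close>, and the next equation determines
  \<open>e\<close> as \<open>- X 2 f\<close> times \<open>\<theta> {3, 4}\<close>. The formula is
  \<open>d 1 e + d 2 g\<close>.\<close>

lemma Br_3_6: "Br F 3 6 (-3) =
   {\<lambda>x. (- X 1 (X 2 f) x - X 3 f x) *\<^sub>R \<theta> {1, 3, 4} + (- X 2 (X 2 f) x) *\<^sub>R \<theta> {2, 3, 4} | f. f \<in> \<G>}"
proof (intro set_eqI iffI)
  let ?b = "\<lambda>f x. (- X 1 (X 2 f) x - X 3 f x) *\<^sub>R \<theta> {1, 3, 4} + (- X 2 (X 2 f) x) *\<^sub>R \<theta> {2, 3, 4}"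
  have b: "d 1 (\<lambda>x. (- X 2 f x) *\<^sub>R \<theta> {3, 4}) + d 2 (\<lambda>x. f x *\<^sub>R \<theta> {1, 4}) = ?b f" if f: "f \<in> \<G>" for f
  proof -
    have "X i (\<lambda>x. - X 2 f x) = (\<lambda>x. - X i (X 2 f) x)" for i
      using X_scaleR[OF smooth[OF X_closed[OF f]], of i "-1" 2] by simp
    then show ?thesis
      unfolding d_monomial[OF smooth[OF f]] d_monomial[OF smooth[OF closed(3)[OF X_closed[OF f]]]]
      by (intro ext) (simp add: one_theta_wedge plus_fun_def vec_eq_iff algebra_simps)
  qed
  {
    fix \<alpha> assume "\<alpha> \<in> Br F 3 6 (-3)"
    then obtain c e g where raw: "c \<in> F 6 (-3 - 1)" "e \<in> F (6 - 1) (-3)" "g \<in> F (6 - 2) (-3 + 1)"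
      "\<alpha> = d 0 c + d 1 e + d 2 g" "0 = d 0 e + d 1 g" "0 = d 0 g"
      unfolding Br_3 by blast
    have "c = 0" using raw(1) by (simp add: F_simps(10))
    then have eg: "e \<in> F 5 (-3)" "g \<in> F 4 (-2)" "\<alpha> = d 0 0 + d 1 e + d 2 g"
      "0 = d 0 e + d 1 g" "0 = d 0 g"
      using raw by simp_all
    have "g \<in> coef \<G> {{1, 4}}" using d0_4_2[OF eg(2)] eg(5) by simp
    then obtain f where f: "f \<in> \<G>" "g = (\<lambda>x. f x *\<^sub>R \<theta> {1, 4})" by (auto simp: coef_single)
    obtain a where a: "a \<in> \<G>" "e = (\<lambda>x. a x *\<^sub>R \<theta> {3, 4})" using eg unfolding F_simps by blast
    have "0 = (\<lambda>x. (- a x - X 2 f x) *\<^sub>R \<theta> {1, 2, 4})"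
      using eg(4) unfolding a(2) f(2) d_monomial[OF smooth[OF a(1)]] d_monomial[OF smooth[OF f(1)]]
      by (simp add: one_theta_wedge dinv_theta plus_fun_def algebra_simps)
    from this[symmetric] have "(\<lambda>x. - a x - X 2 f x) = 0" by (simp only: monomial_eq_iff)
    then have "- a x - X 2 f x = 0" for x by (simp only: fun_eq_iff zero_fun_def)
    then have "a x = - X 2 f x" for x by (metis diff_eq_eq add_0 minus_minus)
    then have "a = (\<lambda>x. - X 2 f x)" by (rule ext)
    then have "\<alpha> = ?b f" using b[OF f(1)] eg(3) a f by (simp add: d_zero)
    then show "\<alpha> \<in> {?b f | f. f \<in> \<G>}" using f(1) by blast
  }
  fix \<alpha> assume "\<alpha> \<in> {?b f | f. f \<in> \<G>}"
  then obtain f where f: "f \<in> \<G>" "\<alpha> = ?b f" by blast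
  let ?e = "\<lambda>x. (- X 2 f x) *\<^sub>R \<theta> {3, 4}" and ?g = "\<lambda>x. f x *\<^sub>R \<theta> {1, 4}"
  have e: "?e \<in> F 5 (-3)" using closed(3)[OF X_closed[OF f(1)]] by (intro F_intros)
  have g: "?g \<in> coef \<G> {{1, 4}}" using f(1) by (simp add: coef_def theta_nth)
  then have g': "?g \<in> F 4 (-2)"
    unfolding F bideg_simps using coef_mono[of "{{1, 4}}" "{{1, 4}, {2, 4}}" \<G>] closed(5) by blast
  have "\<alpha> = d 0 0 + d 1 ?e + d 2 ?g" using b[OF f(1)] f(2) by (simp add: d_zero)
  moreover have "0 = d 0 ?e + d 1 ?g"
    unfolding d_monomial[OF smooth[OF f(1)]] d_monomial[OF smooth[OF closed(3)[OF X_closed[OF f(1)]]]]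
    by (simp add: one_theta_wedge dinv_theta plus_fun_def zero_fun_def)
  moreover have "0 = d 0 ?g" using d0_4_2[OF g'] g by simp
  moreover have "\<alpha> \<in> F 6 (-3)"
  proof -
    have "(\<lambda>x. - X 1 (X 2 f) x - X 3 f x) \<in> \<G>" "(\<lambda>x. - X 2 (X 2 f) x) \<in> \<G>"
      by (intro closed X_closed f(1))+
    then show ?thesis unfolding f(2) by (intro F_intros)
  qed
  ultimately show "\<alpha> \<in> Br F 3 6 (-3)"
    using zero_F[of 6 "-4"] e g' by (intro Br_3I[of _ _ _ _ 0 ?e ?g]) simp_all
qed

end

lemma subspace_Cinf: "subspace Cinf"
  using smooth_const[of "0::real"] smooth_add smooth_scaleR[where 'a=real]
  by (auto simp: subspace_def zero_fun_def plus_fun_def scaleR_fun_def)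

interpretation Om: coefficients Cinf Om
  by unfold_locales (auto simp: subspace_Cinf smooth_X Om_eq_coef)

interpretation Omc: coefficients Ccinf Omc
  by (rule coefficients.intro[OF subspace_test[OF subspace_UNIV] _ X_test Omc_eq_coef]) (simp add: test_iff)

section \<open>Horizontal closed forms with compact support\<close>

lemma line_derivative:
  fixes f :: "pt \<Rightarrow> real"
  assumes "smooth f"
  shows "((\<lambda>s. f (y + s *\<^sub>R axis i 1)) has_real_derivative pd i f (y + s *\<^sub>R axis i 1)) (at s)"
proof -
  have "((\<lambda>s. y + s *\<^sub>R axis i 1) has_vector_derivative axis i 1) (at s)"
    by (auto intro!: derivative_eq_intros)
  from vector_derivative_diff_chain_within[OF this has_derivative_at_withinI[OF smooth_has_derivative[OF assms]]]
  have "((\<lambda>s. f (y + s *\<^sub>R axis i 1)) has_vector_derivative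
      (\<Sum>j\<in>UNIV. axis i 1 $ j * pd j f (y + s *\<^sub>R axis i 1))) (at s)"
    by (simp add: o_def)
  moreover have "(\<Sum>j\<in>UNIV. axis i 1 $ j * pd j f (y + s *\<^sub>R axis i 1))
      = (\<Sum>j\<in>UNIV. if j = i then pd j f (y + s *\<^sub>R axis i 1) else 0)"
    by (rule sum.cong) (auto simp: axis_def)
  ultimately show ?thesis by (simp add: has_real_derivative_iff_has_vector_derivative)
qed

text \<open>Mean value theorem twice: in direction \<open>i\<close> for the difference
  \<open>G\<close> of two parallel segments, then in direction \<open>j\<close> for
  \<open>pd i f\<close>.\<close>

lemma second_difference:
  fixes f :: "pt \<Rightarrow> real"
  assumes "smooth f" "h > 0"
  shows "\<exists>s t. 0 < s \<and> s < h \<and> 0 < t \<and> t < h \<and>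
    f (x + h *\<^sub>R axis i 1 + h *\<^sub>R axis j 1) - f (x + h *\<^sub>R axis i 1) - f (x + h *\<^sub>R axis j 1) + f x
      = h\<^sup>2 * pd j (pd i f) (x + s *\<^sub>R axis i 1 + t *\<^sub>R axis j 1)"
proof -
  define G where "G s = f (x + h *\<^sub>R axis j 1 + s *\<^sub>R axis i 1) - f (x + s *\<^sub>R axis i 1)" for s
  have "(G has_real_derivative
     pd i f (x + h *\<^sub>R axis j 1 + s *\<^sub>R axis i 1) - pd i f (x + s *\<^sub>R axis i 1)) (at s)" for s
    unfolding G_def by (intro DERIV_diff line_derivative assms)
  from MVT2[OF assms(2), of G, OF this] obtain s where s: "0 < s" "s < h"
    "G h - G 0 = h * (pd i f (x + h *\<^sub>R axis j 1 + s *\<^sub>R axis i 1) - pd i f (x + s *\<^sub>R axis i 1))"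
    by auto
  from MVT2[OF assms(2) line_derivative[OF smooth_pd[OF assms(1)]], of i "x + s *\<^sub>R axis i 1" j]
  obtain t where t: "0 < t" "t < h" "pd i f (x + s *\<^sub>R axis i 1 + h *\<^sub>R axis j 1) - pd i f (x + s *\<^sub>R axis i 1)
     = h * pd j (pd i f) (x + s *\<^sub>R axis i 1 + t *\<^sub>R axis j 1)" by auto
  have "G h - G 0 = h\<^sup>2 * pd j (pd i f) (x + s *\<^sub>R axis i 1 + t *\<^sub>R axis j 1)"
    using s(3) t(3) by (simp add: power2_eq_square add_ac)
  moreover have "f (x + h *\<^sub>R axis i 1 + h *\<^sub>R axis j 1) - f (x + h *\<^sub>R axis i 1) - f (x + h *\<^sub>R axis j 1) + f x
      = G h - G 0"
    by (simp add: G_def add_ac)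
  ultimately have "f (x + h *\<^sub>R axis i 1 + h *\<^sub>R axis j 1) - f (x + h *\<^sub>R axis i 1) - f (x + h *\<^sub>R axis j 1) + f x
      = h\<^sup>2 * pd j (pd i f) (x + s *\<^sub>R axis i 1 + t *\<^sub>R axis j 1)" by simp
  then show ?thesis using s(1,2) t(1,2) by blast
qed

text \<open>The second difference is symmetric in \<open>i\<close> and \<open>j\<close>, so each
  mixed derivative takes a common value at some point near \<open>x\<close>; continuity then
  contradicts a gap at \<open>x\<close>.\<close>

lemma pd_commute:
  fixes f :: "pt \<Rightarrow> real"
  assumes f: "smooth f"
  shows "pd i (pd j f) = pd j (pd i f)"
proof (rule ext, rule ccontr)
  fix x
  let ?A = "pd j (pd i f)" and ?B = "pd i (pd j f)"
  assume ne: "?B x \<noteq> ?A x"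
  define e where "e = \<bar>?B x - ?A x\<bar> / 2"
  have e: "e > 0" using ne by (simp add: e_def)
  have "isCont ?A x" "isCont ?B x"
    using smooth_continuous[of ?A UNIV] smooth_continuous[of ?B UNIV] f
    by (simp_all add: continuous_on_eq_continuous_at smooth_pd)
  then obtain a b where a: "a > 0" "\<And>y. dist y x < a \<Longrightarrow> dist (?A y) (?A x) < e"
    and b: "b > 0" "\<And>y. dist y x < b \<Longrightarrow> dist (?B y) (?B x) < e"
    using e unfolding continuous_at_eps_delta by metis
  \<comment> \<open>Intermediate points are displaced by at most \<open>s + t\<close>, which is
    below \<open>2 * h\<close>; hence the division by 2.\<close>
  define h where "h = min a b / 2"
  have h: "h > 0" using a b by (simp add: h_def)
  have near: "dist (x + s *\<^sub>R axis k 1 + t *\<^sub>R axis l 1) x < min a b"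
    if "0 < s" "s < h" "0 < t" "t < h" for s t and k l :: 4
  proof -
    have "dist (x + s *\<^sub>R axis k 1 + t *\<^sub>R axis l 1) x \<le> norm (s *\<^sub>R (axis k 1 :: pt)) + norm (t *\<^sub>R (axis l 1 :: pt))"
      using norm_triangle_ineq[of "s *\<^sub>R (axis k 1 :: pt)" "t *\<^sub>R axis l 1"] by (simp add: dist_norm add.assoc)
    also have "\<dots> = s + t" using that by simp
    finally show ?thesis using that by (simp add: h_def)
  qed
  obtain s t where st: "0 < s" "s < h" "0 < t" "t < h"
    "f (x + h *\<^sub>R axis i 1 + h *\<^sub>R axis j 1) - f (x + h *\<^sub>R axis i 1) - f (x + h *\<^sub>R axis j 1) + f x
      = h\<^sup>2 * ?A (x + s *\<^sub>R axis i 1 + t *\<^sub>R axis j 1)"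
    using second_difference[OF f h, of x i j] by blast
  obtain s' t' where st': "0 < s'" "s' < h" "0 < t'" "t' < h"
    "f (x + h *\<^sub>R axis j 1 + h *\<^sub>R axis i 1) - f (x + h *\<^sub>R axis j 1) - f (x + h *\<^sub>R axis i 1) + f x
      = h\<^sup>2 * ?B (x + s' *\<^sub>R axis j 1 + t' *\<^sub>R axis i 1)"
    using second_difference[OF f h, of x j i] by blast
  have swap: "x + h *\<^sub>R axis j 1 + h *\<^sub>R axis i 1 = x + h *\<^sub>R axis i 1 + h *\<^sub>R axis j 1"
    by (simp add: add_ac)
  have "h\<^sup>2 * ?A (x + s *\<^sub>R axis i 1 + t *\<^sub>R axis j 1) = h\<^sup>2 * ?B (x + s' *\<^sub>R axis j 1 + t' *\<^sub>R axis i 1)"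
    using st(5) st'(5)[unfolded swap] by linarith
  then have "?A (x + s *\<^sub>R axis i 1 + t *\<^sub>R axis j 1) = ?B (x + s' *\<^sub>R axis j 1 + t' *\<^sub>R axis i 1)"
    using h by simp
  moreover have "dist (?A (x + s *\<^sub>R axis i 1 + t *\<^sub>R axis j 1)) (?A x) < e"
    using a(2) near[OF st(1-4), of i j] by simp
  moreover have "dist (?B (x + s' *\<^sub>R axis j 1 + t' *\<^sub>R axis i 1)) (?B x) < e"
    using b(2) near[OF st'(1-4), of j i] by simp
  ultimately have "dist (?B x) (?A x) < e + e" by (metis dist_commute dist_triangle_less_add)
  then show False by (simp add: e_def dist_real_def)
qed

subsection \<open>Commutators\<close>

lemma X_mult:
  fixes f g :: "pt \<Rightarrow> real"
  assumes "smooth f" "smooth g"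
  shows "X i (\<lambda>x. f x * g x) x = f x * X i g x + X i f x * g x"
  by (simp add: X_smooth_eq assms smooth_mult pd_mult[OF smooth_differentiable smooth_differentiable]
      sum.distrib sum_distrib_left sum_distrib_right algebra_simps)

lemma X_sum:
  fixes f :: "'i \<Rightarrow> pt \<Rightarrow> real"
  assumes "finite A" "\<And>j. j \<in> A \<Longrightarrow> smooth (f j)"
  shows "X i (\<lambda>x. \<Sum>j\<in>A. f j x) = (\<lambda>x. \<Sum>j\<in>A. X i (f j) x)"
  using assms
proof (induction A rule: finite_induct)
  case empty
  show ?case using X_scaleR[OF smooth_const[of "0::real"], of i 0] by simp
next
  case (insert a A)
  then show ?case by (simp add: X_add smooth_sum)
qed

lemma X_const: "X i (\<lambda>x. c::real) = (\<lambda>x. 0)"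
  by (rule ext) (simp add: X_smooth_eq[OF smooth_const] pd_const)

lemma X_coord: "X i (\<lambda>x. x $ j) = (\<lambda>x. frame i x $ j)"
  by (rule ext) (simp add: X_smooth_eq[OF smooth_coord] pd_coord if_distrib cong: if_cong)

lemma frame_nth:
  "frame 1 x $ 1 = 1" "frame 1 x $ 2 = 0" "frame 1 x $ 3 = (-1/2) * x$2"
  "frame 1 x $ 4 = (-1/2) * x$3 + (-1/12) * (x$1 * x$2)"
  "frame 2 x $ 1 = 0" "frame 2 x $ 2 = 1" "frame 2 x $ 3 = (1/2) * x$1" "frame 2 x $ 4 = (1/12) * (x$1 * x$1)"
  "frame 3 x $ 1 = 0" "frame 3 x $ 2 = 0" "frame 3 x $ 3 = 1" "frame 3 x $ 4 = (1/2) * x$1"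
  by (simp_all add: frame_def lie_bracket_def axis_def algebra_simps)

lemma smooth_frame: "smooth (\<lambda>x. frame i x $ j)"
  by (subst X_coord[symmetric]) (rule smooth_X[OF smooth_coord])

text \<open>The second-order terms cancel by \<open>pd_commute\<close>, leaving derivatives of the
  frame coefficients only.\<close>

lemma X_commutator:
  fixes u :: "pt \<Rightarrow> real"
  assumes u: "smooth u"
  shows "X i (X k u) x - X k (X i u) x =
    (\<Sum>j\<in>UNIV. (X i (\<lambda>x. frame k x $ j) x - X k (\<lambda>x. frame i x $ j) x) * pd j u x)"
proof -
  have "X i (X k u) x = (\<Sum>j\<in>UNIV. X i (\<lambda>x. frame k x $ j) x * pd j u x) +
      (\<Sum>j\<in>UNIV. \<Sum>l\<in>UNIV. frame k x $ j * frame i x $ l * pd l (pd j u) x)" for i k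
  proof -
    have "X k u = (\<lambda>x. \<Sum>j\<in>UNIV. frame k x $ j * pd j u x)"
      by (rule ext) (simp add: X_smooth_eq[OF u])
    then have "X i (X k u) x = (\<Sum>j\<in>UNIV. X i (\<lambda>x. frame k x $ j * pd j u x) x)"
      by (simp add: X_sum smooth_mult smooth_frame smooth_pd u)
    also have "\<dots> = (\<Sum>j\<in>UNIV. frame k x $ j * X i (pd j u) x + X i (\<lambda>x. frame k x $ j) x * pd j u x)"
      by (simp add: X_mult smooth_frame smooth_pd u)
    also have "\<dots> = (\<Sum>j\<in>UNIV. X i (\<lambda>x. frame k x $ j) x * pd j u x) +
      (\<Sum>j\<in>UNIV. \<Sum>l\<in>UNIV. frame k x $ j * frame i x $ l * pd l (pd j u) x)"
      by (simp add: sum.distrib X_smooth_eq[OF smooth_pd[OF u]] sum_distrib_left mult.assoc)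
    finally show ?thesis .
  qed
  moreover have "(\<Sum>j\<in>UNIV. \<Sum>l\<in>UNIV. frame k x $ j * frame i x $ l * pd l (pd j u) x) =
      (\<Sum>j\<in>UNIV. \<Sum>l\<in>UNIV. frame i x $ j * frame k x $ l * pd l (pd j u) x)"
    by (subst sum.swap) (simp add: pd_commute[OF u] mult.commute)
  ultimately show ?thesis
    by (simp add: sum_subtractf left_diff_distrib)
qed

text \<open>The bracket relations of the Lie algebra, verified for the coordinate fields; after
  \<open>X_commutator\<close> only polynomial frame coefficients are differentiated.\<close>

lemma commutators:
  fixes u :: "pt \<Rightarrow> real"
  assumes u: "smooth u"
  shows "X 1 (X 2 u) x = X 2 (X 1 u) x + X 3 u x"
    "X 1 (X 3 u) x = X 3 (X 1 u) x + X 4 u x"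
    "X 2 (X 3 u) x = X 3 (X 2 u) x"
proof -
  have q: "smooth (\<lambda>x. x$1 * x$2)" "smooth (\<lambda>x. x$1 * x$1)"
    by (intro smooth_intros)+
  have s: "X i (\<lambda>x. c * f x) = (\<lambda>x. c * X i f x)" if "smooth f" for i c and f :: "pt \<Rightarrow> real"
    using X_scaleR[OF that] by simp
  have a: "X i (\<lambda>x. c * x$3 + c' * (x$1 * x$2)) = (\<lambda>x. c * X i (\<lambda>x. x$3) x + c' * X i (\<lambda>x. x$1 * x$2) x)" for i c c'
    using X_add[OF smooth_scaleR[OF smooth_coord] smooth_scaleR[OF q(1)], of i c 3 c'] 
    by (simp add: s smooth_coord q)
  note r = sum_4 frame_nth X_const X_coord s[OF smooth_coord] s[OF q(1)] s[OF q(2)] a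
    X_mult[OF smooth_coord smooth_coord]
  have "X 1 (X 2 u) x - X 2 (X 1 u) x = X 3 u x"
    unfolding X_commutator[OF u] X_expand(3)[OF u] r by (simp add: algebra_simps)
  then show "X 1 (X 2 u) x = X 2 (X 1 u) x + X 3 u x" by simp
  have "X 1 (X 3 u) x - X 3 (X 1 u) x = X 4 u x"
    unfolding X_commutator[OF u] X_expand(4)[OF u] r by (simp add: algebra_simps)
  then show "X 1 (X 3 u) x = X 3 (X 1 u) x + X 4 u x" by simp
  have "X 2 (X 3 u) x - X 3 (X 2 u) x = 0"
    unfolding X_commutator[OF u] r by (simp add: algebra_simps)
  then show "X 2 (X 3 u) x = X 3 (X 2 u) x" by simp
qed

text \<open>This is the condition of \<open>Zr_3_1\<close> for a horizontal gradient. Replacing X_1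
  X_2 by X_2 X_1 + X_3 leaves the commutator of X_2 and X_3, which is zero.\<close>

lemma gradient_closed:
  fixes u :: "pt \<Rightarrow> real"
  assumes u: "smooth u"
  shows "X 2 (X 2 (X 1 u)) x - X 2 (X 1 (X 2 u)) x + X 3 (X 2 u) x = 0"
proof -
  have "X 1 (X 2 u) = (\<lambda>x. X 2 (X 1 u) x + X 3 u x)" using commutators(1)[OF u] by blast
  then have "X 2 (X 1 (X 2 u)) x = X 2 (X 2 (X 1 u)) x + X 2 (X 3 u) x"
    by (simp add: X_add smooth_X u)
  then show ?thesis using commutators(3)[OF u] by simp
qed

subsection \<open>Integration along the flow of \<open>X\<^sub>2\<close>\<close>

lemma flow_add: "engel_mult (engel_mult x (s *\<^sub>R axis i 1)) (t *\<^sub>R axis i 1) = engel_mult x ((s + t) *\<^sub>R axis i 1)"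
proof -
  have "lie_bracket (axis i 1) (axis i 1) = 0" by (simp add: lie_bracket_def vec_eq_iff)
  moreover have "lie_bracket y 0 = 0" for y by (simp add: lie_bracket_def vec_eq_iff)
  ultimately have "engel_mult (s *\<^sub>R axis i 1) (t *\<^sub>R axis i 1) = (s + t) *\<^sub>R axis i 1"
    by (simp add: engel_mult_def lie_bracket_scaleR scaleR_add_left)
  then show ?thesis by (simp add: engel_group_laws(1))
qed

text \<open>By \<open>flow_add\<close> the flow line through \<open>x\<close>, reparametrised at
  time \<open>s\<close>, is the flow line through the point reached; so the definition of
  \<open>X\<close> at that point applies.\<close>

lemma flow_derivative:
  fixes f :: "pt \<Rightarrow> real"
  assumes "smooth f"
  shows "((\<lambda>s. f (engel_mult x (s *\<^sub>R axis i 1))) has_real_derivative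
     X i f (engel_mult x (s *\<^sub>R axis i 1))) (at s)"
proof -
  let ?y = "engel_mult x (s *\<^sub>R axis i 1)"
  have 0: "engel_mult ?y ((0::real) *\<^sub>R axis i 1) = ?y" by (simp add: engel_group_laws)
  have "(f has_derivative (\<lambda>h. \<Sum>j\<in>UNIV. h $ j *\<^sub>R pd j f ?y)) (at (engel_mult ?y (0 *\<^sub>R axis i 1)))"
    using smooth_has_derivative[OF assms] 0 by simp
  from vector_derivative_diff_chain_within[OF curve_derivative has_derivative_at_withinI[OF this]]
  have "((\<lambda>t. f (engel_mult ?y (t *\<^sub>R axis i 1))) has_real_derivative X i f ?y) (at 0)"
    by (simp add: o_def X_smooth_eq[OF assms] has_real_derivative_iff_has_vector_derivative)
  then have "((\<lambda>t. f (engel_mult x ((s + t) *\<^sub>R axis i 1))) has_real_derivative X i f ?y) (at 0)"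
    by (simp add: flow_add)
  then show ?thesis
    using DERIV_shift[of "\<lambda>t. f (engel_mult x (t *\<^sub>R axis i 1))" _ 0 s] by (simp add: add.commute)
qed

lemma X_eqI:
  fixes f :: "pt \<Rightarrow> real"
  assumes "((\<lambda>t. f (engel_mult x (t *\<^sub>R axis i 1))) has_real_derivative D) (at 0)"
  shows "X i f x = D"
  using assms unfolding X_def by (simp add: has_real_derivative_iff_has_vector_derivative vector_derivative_at)

text \<open>The term quadratic in \<open>t\<close> is a bracket of X_2 with a multiple of X_3 and
  vanishes. Flow lines of X_2 are thus straight, and \<open>retract\<close> is polynomial.\<close>

lemma flow2: "engel_mult x (t *\<^sub>R axis 2 1) = x + t *\<^sub>R frame 2 x"
  unfolding engel_mult_axis by (simp add: lie_bracket_def vec_eq_iff forall_4 axis_def)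

lemma flow2_nth2: "engel_mult x (t *\<^sub>R axis 2 1) $ 2 = x $ 2 + t"
  by (simp add: flow2 frame_nth)

text \<open>For \<open>t \<in> {0..1}\<close> this runs along the flow line of \<open>X\<^sub>2\<close> from the hyperplane \<open>x\<^sub>2 = - \<rho>\<close> to \<open>x\<close>;
  the interval of integration thus does not depend on \<open>x\<close>.\<close>

definition retract :: "real \<Rightarrow> real \<Rightarrow> pt \<Rightarrow> pt" where
  "retract \<rho> t x = engel_mult x (((t - 1) * (x $ 2 + \<rho>)) *\<^sub>R axis 2 1)"

lemma retract_poly: "(\<lambda>t x. retract \<rho> t x $ j) \<in> poly_fun"
proof -
  have c: "(\<lambda>t x. (t + (-1)) * (x $ 2 + \<rho>)) \<in> poly_fun"
    by (intro poly_fun.intros)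
  have "(\<lambda>t x. frame 2 x $ j) \<in> poly_fun"
    using exhaust_4[of j] by (elim disjE) (simp_all only: frame_nth, (intro poly_fun.intros)+)
  then have "(\<lambda>t x. x $ j + ((t + (-1)) * (x $ 2 + \<rho>)) * frame 2 x $ j) \<in> poly_fun"
    by (intro poly_fun.add poly_fun.mult c poly_fun.coord)
  then show ?thesis by (simp add: retract_def flow2)
qed

text \<open>The factor \<open>x $ 2 + \<rho>\<close> is the Jacobian of the substitution that fixes
  the interval: this is the integral of \<open>g\<close> over flow times from
  \<open>- (x $ 2 + \<rho>)\<close> to 0, with orientation.\<close>

definition flow_integral :: "real \<Rightarrow> (pt \<Rightarrow> real) \<Rightarrow> pt \<Rightarrow> real" where
  "flow_integral \<rho> g x = integral {0..1} (\<lambda>t. (x $ 2 + \<rho>) * g (retract \<rho> t x))"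

lemma flow_integrand:
  "smooth g \<Longrightarrow> (\<lambda>t x. (x $ 2 + \<rho>) * g (retract \<rho> t x)) \<in> par_fun (retract \<rho>)"
  by (intro par_fun.mult par_fun.comp par_fun.poly poly_fun.intros)

lemma smooth_flow_integral: "smooth g \<Longrightarrow> smooth (flow_integral \<rho> g)"
  unfolding flow_integral_def by (rule smooth_par_fun_integral[OF retract_poly flow_integrand])

text \<open>Fundamental theorem of calculus along the flow line. Differentiating under the integral
  sign makes the integrand an exact derivative in \<open>t\<close>.\<close>

lemma X2_flow_integral:
  assumes g: "smooth g"
  shows "X 2 (flow_integral \<rho> g) x = g x"
proof -
  let ?h = "\<lambda>t x. (x $ 2 + \<rho>) * g (retract \<rho> t x)"
  note h = flow_integrand[OF g, of \<rho>]
  obtain dh where dh: "\<And>i. dh i \<in> par_fun (retract \<rho>)"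
    "\<And>t x. (?h t has_derivative (\<lambda>v. \<Sum>i\<in>UNIV. v $ i * dh i t x)) (at x)"
    using par_fun_derivative[OF retract_poly h] by blast
  note D = par_fun_integral_derivative[OF retract_poly h dh, of x]
  have "pd i (flow_integral \<rho> g) x = integral {0..1} (\<lambda>t. dh i t x)" for i
    unfolding flow_integral_def[abs_def] by (rule has_derivative_pd_sum[OF D])
  then have "X 2 (flow_integral \<rho> g) x = (\<Sum>i\<in>UNIV. frame 2 x $ i * integral {0..1} (\<lambda>t. dh i t x))"
    unfolding X_smooth_eq[OF smooth_flow_integral[OF g]] by simp
  also have "\<dots> = integral {0..1} (\<lambda>t. \<Sum>i\<in>UNIV. frame 2 x $ i * dh i t x)"
  proof -
    have "(\<lambda>t. frame 2 x $ i * dh i t x) integrable_on {0..1}" for i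
      using integrable_on_cmult_left[OF par_fun_integrable[OF retract_poly dh(1)[of i], of x]] by simp
    then show ?thesis by (simp add: integral_sum)
  qed
  also have "\<dots> = integral {0..1} (\<lambda>t. X 2 (?h t) x)"
  proof -
    have "X 2 (?h t) x = (\<Sum>i\<in>UNIV. frame 2 x $ i * dh i t x)" for t
    proof -
      have "?h t differentiable (at x)" using dh(2) differentiable_def by blast
      then show ?thesis by (simp add: X_eq has_derivative_pd_sum[OF dh(2)])
    qed
    then show ?thesis by simp
  qed
  also have "\<dots> = g x"
  proof -
    define c where "c = x $ 2 + \<rho>"
    define G where "G s = g (engel_mult x (s *\<^sub>R axis 2 1))" for s
    define G' where "G' s = X 2 g (engel_mult x (s *\<^sub>R axis 2 1))" for s
    have G: "(G has_real_derivative G' s) (at s)" for s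
      unfolding G_def G'_def by (rule flow_derivative[OF g])
    have "X 2 (?h t) x = G ((t - 1) * c) + t * (c * G' ((t - 1) * c))" for t
    proof (rule X_eqI)
      \<comment> \<open>Moving \<open>x\<close> by flow time \<open>s\<close> lengthens the segment
        from \<open>c\<close> to \<open>c + s\<close>, and the time measured from the old
        \<open>x\<close> becomes \<open>s + (t - 1) * (c + s)\<close>.\<close>
      have "?h t (engel_mult x (s *\<^sub>R axis 2 1)) = (c + s) * G ((t - 1) * c + t * s)" for s
        unfolding retract_def flow_add flow2_nth2 G_def c_def by (simp add: algebra_simps)
      moreover have "((\<lambda>s. (c + s) * G ((t - 1) * c + t * s)) has_real_derivative
          G ((t - 1) * c) + t * (c * G' ((t - 1) * c))) (at 0)"
        by (auto intro!: derivative_eq_intros DERIV_chain2[OF G])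
      ultimately show "((\<lambda>s. ?h t (engel_mult x (s *\<^sub>R axis 2 1))) has_real_derivative
          G ((t - 1) * c) + t * (c * G' ((t - 1) * c))) (at 0)" by simp
    qed
    \<comment> \<open>A primitive is \<open>t * G ((t - 1) * c)\<close>; it vanishes at 0 and equals
      \<open>G 0 = g x\<close> at 1.\<close>
    moreover have "((\<lambda>t. G ((t - 1) * c) + t * (c * G' ((t - 1) * c))) has_integral
        (1 * G ((1 - 1) * c) - 0 * G ((0 - 1) * c))) {0..1}"
    proof (rule fundamental_theorem_of_calculus)
      fix t :: real
      have "((\<lambda>t. t * G ((t - 1) * c)) has_real_derivative G ((t - 1) * c) + t * (c * G' ((t - 1) * c))) (at t)"
        by (auto intro!: derivative_eq_intros DERIV_chain2[OF G])
      then show "((\<lambda>t. t * G ((t - 1) * c)) has_vector_derivative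
          G ((t - 1) * c) + t * (c * G' ((t - 1) * c))) (at t within {0..1})"
        by (simp add: has_real_derivative_iff_has_vector_derivative has_vector_derivative_at_within)
    qed simp
    ultimately show ?thesis
      by (simp add: integral_unique G_def engel_group_laws)
  qed
  finally show ?thesis .
qed

text \<open>The second coordinate along the segment stays between that of \<open>x\<close> and
  \<open>- \<rho>\<close>, so the segment never meets the ball that carries
  \<open>g\<close>.\<close>

lemma flow_integral_zero:
  assumes "\<And>y. \<rho> \<le> norm y \<Longrightarrow> g y = 0" "x $ 2 \<le> - \<rho>"
  shows "flow_integral \<rho> g x = 0"
proof -
  have "g (retract \<rho> t x) = 0" if "t \<in> {0..1}" for t
  proof (rule assms(1))
    have "retract \<rho> t x $ 2 = t * (x $ 2 + \<rho>) - \<rho>"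
      unfolding retract_def flow2_nth2 by (simp add: algebra_simps)
    also have "\<dots> \<le> - \<rho>" using that assms(2) by (simp add: mult_nonneg_nonpos)
    finally have "\<rho> \<le> \<bar>retract \<rho> t x $ 2\<bar>" by linarith
    then show "\<rho> \<le> norm (retract \<rho> t x)"
      using component_le_norm_cart[of "retract \<rho> t x" 2] by linarith
  qed
  then have "integral {0..1} (\<lambda>t. (x $ 2 + \<rho>) * g (retract \<rho> t x)) = integral {0..1} (\<lambda>t::real. 0)"
    by (intro integral_cong) simp
  then show ?thesis by (simp add: flow_integral_def)
qed

text \<open>The function is constant on flow lines, and along each of them the second coordinate
  runs through all reals at unit speed.\<close>

lemma zero_along_flow:
  fixes v :: "pt \<Rightarrow> real"
  assumes v: "smooth v" and X: "\<And>x. X 2 v x = 0" and zero: "\<And>x. x $ 2 < a \<Longrightarrow> v x = 0"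
  shows "v x = 0"
proof -
  have "((\<lambda>s. v (engel_mult x (s *\<^sub>R axis 2 1))) has_real_derivative 0) (at s)" for s
    using flow_derivative[OF v, of x 2 s] X by simp
  \<comment> \<open>At this flow time the second coordinate is \<open>a - 1\<close>, inside the
    half-space.\<close>
  then have "v (engel_mult x (0 *\<^sub>R axis 2 1)) = v (engel_mult x ((a - 1 - x $ 2) *\<^sub>R axis 2 1))"
    using DERIV_isconst_all by metis
  moreover have "v (engel_mult x ((a - 1 - x $ 2) *\<^sub>R axis 2 1)) = 0"
    by (rule zero) (simp add: flow2_nth2)
  ultimately show ?thesis by (simp add: engel_group_laws)
qed

text \<open>On the open exterior of the ball the brackets propagate the vanishing from X_1, X_2 to
  X_3 and then X_4. These four fields span all directions, so the differential is zero on a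
  connected set.\<close>

lemma zero_gradient_outside:
  fixes u :: "pt \<Rightarrow> real"
  assumes u: "smooth u" and X: "\<And>x. \<rho> < norm x \<Longrightarrow> X 1 u x = 0" "\<And>x. \<rho> < norm x \<Longrightarrow> X 2 u x = 0"
    and p: "\<rho> < norm p" "u p = 0" and x: "\<rho> < norm x"
  shows "u x = 0"
proof -
  have out: "y \<notin> cball 0 \<rho> \<longleftrightarrow> \<rho> < norm y" for y :: pt by auto
  have Xout: "X i f y = 0" if "smooth f" "\<And>y. \<rho> < norm y \<Longrightarrow> f y = 0" "\<rho> < norm y"
    for i y and f :: "pt \<Rightarrow> real"
    using X_zero_outside[OF closed_cball, of 0 \<rho> f y i] that out by simp
  have 3: "X 3 u y = 0" if "\<rho> < norm y" for y
    using commutators(1)[OF u, of y] Xout[OF smooth_X[OF u] X(2) that] Xout[OF smooth_X[OF u] X(1) that] by simp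
  have 4: "X 4 u y = 0" if "\<rho> < norm y" for y
    using commutators(2)[OF u, of y] Xout[OF smooth_X[OF u] 3 that] Xout[OF smooth_X[OF u] X(1) that] by simp
  have "(u has_derivative (\<lambda>h. 0)) (at y)" if y: "y \<in> - cball 0 \<rho>" for y
  proof -
    have "\<rho> < norm y" using y by simp
    \<comment> \<open>The formulas of \<open>X_expand\<close> are triangular: X_4 gives the last
      partial, then X_3, and then X_2 and X_1 the others.\<close>
    then have "pd 4 u y = 0" "pd 3 u y = 0" "pd 2 u y = 0" "pd 1 u y = 0"
      using X[of y] 3[of y] 4[of y] unfolding X_expand[OF u] by auto
    then show ?thesis using smooth_has_derivative[OF u, of y] by (simp add: sum_4)
  qed
  \<comment> \<open>Here it matters that the dimension is at least 2.\<close>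
  moreover have "connected (- cball (0::pt) \<rho>)"
    by (rule connected_complement_bounded_convex) auto
  ultimately have "u x = u p"
    by (intro has_derivative_zero_unique_connected[of "- cball 0 \<rho>"]) (use p x in auto)
  then show ?thesis using p by simp
qed

lemma horizontal_potential:
  assumes f: "f \<in> Ccinf" and g: "g \<in> Ccinf"
    and eq: "\<And>x. X 2 (X 2 f) x - X 2 (X 1 g) x + X 3 g x = 0"
  shows "\<exists>u\<in>Ccinf. f = X 1 u \<and> g = X 2 u"
proof -
  obtain K L where K: "compact K" "smooth f" "\<And>x. x \<notin> K \<Longrightarrow> f x = 0"
    and L: "compact L" "smooth g" "\<And>x. x \<notin> L \<Longrightarrow> g x = 0"
    using f g unfolding test_iff by blast
  have "bounded (K \<union> L)" using K(1) L(1) by (simp add: compact_imp_bounded)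
  then obtain b where b: "\<And>x. x \<in> K \<union> L \<Longrightarrow> norm x \<le> b" unfolding bounded_iff by blast
  \<comment> \<open>The added 1 makes \<open>\<rho>\<close> positive and lets \<open>f\<close> and
    \<open>g\<close> vanish on the sphere of radius \<open>\<rho>\<close> too, as
    \<open>flow_integral_zero\<close> asks.\<close>
  define \<rho> where "\<rho> = \<bar>b\<bar> + 1"
  have \<rho>: "\<rho> > 0" by (simp add: \<rho>_def)
  have zero: "f x = 0" "g x = 0" if "\<rho> \<le> norm x" for x
  proof -
    have "x \<notin> K \<union> L" using b[of x] that by (auto simp: \<rho>_def)
    then show "f x = 0" "g x = 0" using K(3) L(3) by blast+
  qed
  define u where "u = flow_integral \<rho> g"
  have u: "smooth u" unfolding u_def by (rule smooth_flow_integral[OF L(2)])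
  have X2u: "X 2 u = g" unfolding u_def using X2_flow_integral[OF L(2)] by blast
  have u0: "u x = 0" if "x $ 2 \<le> - \<rho>" for x
    unfolding u_def using zero(2) that by (rule flow_integral_zero)
  define v where "v = (\<lambda>x. f x - X 1 u x)"
  have v: "smooth v" unfolding v_def by (intro smooth_diff K(2) smooth_X u)
  have "X 2 v = (\<lambda>x. X 2 f x - X 2 (X 1 u) x)"
    unfolding v_def by (intro X_diff K(2) smooth_X u)
  then have "X 2 (X 2 v) = (\<lambda>x. X 2 (X 2 f) x - X 2 (X 2 (X 1 u)) x)"
    by (simp add: X_diff K(2) smooth_X u)
  \<comment> \<open>The assumption \<open>eq\<close> minus the identity
    \<open>gradient_closed\<close> for \<open>u\<close>; the terms in \<open>g = X 2 u\<close>
    cancel.\<close>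
  then have X22v: "X 2 (X 2 v) x = 0" for x
    using gradient_closed[OF u, of x] eq[of x] unfolding X2u by simp
  have v0: "v x = 0" if "x $ 2 < - \<rho>" for x
  proof -
    have "\<rho> \<le> norm x" using that component_le_norm_cart[of x 2] by linarith
    moreover have "X 1 u x = 0"
      by (rule X_zero_outside[of "{x. - \<rho> \<le> x $ 2}"])
         (use u0 u that in \<open>auto intro!: closed_Collect_le continuous_intros\<close>)
    ultimately show ?thesis using zero(1) by (simp add: v_def)
  qed
  \<comment> \<open>The second-order equation is integrated twice: \<open>zero_along_flow\<close> is
    applied to \<open>X 2 v\<close> and afterwards to \<open>v\<close>, each with zero data in the
    half-space.\<close>
  have "X 2 v x = 0" if "x $ 2 < - \<rho>" for x
    by (rule X_zero_outside[of "{x. - \<rho> \<le> x $ 2}"])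
       (use v0 v that in \<open>auto intro!: closed_Collect_le continuous_intros\<close>)
  then have "X 2 v x = 0" for x by (rule zero_along_flow[OF smooth_X[OF v] X22v])
  then have "v x = 0" for x using zero_along_flow[OF v] v0 by blast
  then have X1u: "X 1 u = f" unfolding v_def by (simp add: fun_eq_iff)
  \<comment> \<open>A point outside the ball and in the half-space where \<open>u\<close> vanishes;
    it fixes the constant value of \<open>u\<close> outside the ball.\<close>
  let ?p = "axis 2 (- (\<rho> + 1)) :: pt"
  have "u x = 0" if "\<rho> < norm x" for x
  proof (rule zero_gradient_outside[OF u])
    show "X 1 u y = 0" "X 2 u y = 0" if "\<rho> < norm y" for y
      using zero[of y] that by (simp_all add: X1u X2u)
    have "?p $ 2 = - (\<rho> + 1)" by (simp add: axis_def)
    then show "\<rho> < norm ?p" using component_le_norm_cart[of ?p 2] by linarith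
    show "u ?p = 0" by (rule u0) (simp add: axis_def)
  qed (rule that)
  then have "u \<in> Ccinf"
    by (intro testI[OF u UNIV_I compact_cball[of 0 \<rho>]]) simp
  then show ?thesis using X1u X2u by blast
qed

section \<open>Distributions and tensor products\<close>

lemma sum_fun_apply: "(\<Sum>i\<in>A. f i) x = (\<Sum>i\<in>A. f i x)"
  by (induction A rule: infinite_finite_induct) auto

lemma subspace_functionals:
  assumes S: "subspace S"
  shows "subspace {T. linear_on (test S) T \<and> bounded_on_tests S T}"
proof (rule subspaceI)
  have "\<exists>L \<delta>. finite L \<and> \<delta> > 0 \<and> (\<forall>\<phi>\<in>test_on K S. small_on L \<delta> \<phi> \<longrightarrow> \<bar>0\<bar> \<le> (1::real))" for K
    by (intro exI[of _ "{}"] exI[of _ "1::real"]) simp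
  then show "0 \<in> {T. linear_on (test S) T \<and> bounded_on_tests S T}"
    by (simp add: linear_on_def bounded_on_tests_def)
next
  fix T U assume "T \<in> {T. linear_on (test S) T \<and> bounded_on_tests S T}"
    "U \<in> {T. linear_on (test S) T \<and> bounded_on_tests S T}"
  then have T: "linear_on (test S) T" "bounded_on_tests S T" and U: "linear_on (test S) U" "bounded_on_tests S U"
    by auto
  have "linear_on (test S) (T + U)"
    using T(1) U(1) by (simp add: linear_on_def algebra_simps)
  moreover have "bounded_on_tests S (T + U)"
    unfolding bounded_on_tests_def
  proof (intro allI impI)
    fix K :: "pt set" assume K: "compact K"
    obtain L \<delta> where 1: "finite L" "\<delta> > 0"
      "\<forall>\<phi>\<in>test_on K S. small_on L \<delta> \<phi> \<longrightarrow> \<bar>T \<phi>\<bar> \<le> 1/2"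
      using bounded_on_testsD[OF T(2,1) S K, of "1/2"] by auto
    obtain L' \<delta>' where 2: "finite L'" "\<delta>' > 0"
      "\<forall>\<phi>\<in>test_on K S. small_on L' \<delta>' \<phi> \<longrightarrow> \<bar>U \<phi>\<bar> \<le> 1/2"
      using bounded_on_testsD[OF U(2,1) S K, of "1/2"] by auto
    have "\<bar>(T + U) \<phi>\<bar> \<le> 1"
      if "\<phi> \<in> test_on K S" "small_on (L \<union> L') (min \<delta> \<delta>') \<phi>" for \<phi>
    proof -
      have "\<bar>T \<phi>\<bar> \<le> 1/2" "\<bar>U \<phi>\<bar> \<le> 1/2" using 1(3) 2(3) that by auto
      then show ?thesis using abs_triangle_ineq[of "T \<phi>" "U \<phi>"] by simp
    qed
    then show "\<exists>L \<delta>. finite L \<and> \<delta> > 0 \<and>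
      (\<forall>\<phi>\<in>test_on K S. small_on L \<delta> \<phi> \<longrightarrow> \<bar>(T + U) \<phi>\<bar> \<le> 1)"
      using 1 2 by (intro exI[of _ "L \<union> L'"] exI[of _ "min \<delta> \<delta>'"]) simp
  qed
  ultimately show "T + U \<in> {T. linear_on (test S) T \<and> bounded_on_tests S T}" by simp
next
  fix c T assume "T \<in> {T. linear_on (test S) T \<and> bounded_on_tests S T}"
  then have T: "linear_on (test S) T" "bounded_on_tests S T" by auto
  have "linear_on (test S) (c *\<^sub>R T)"
    using T(1) by (simp add: linear_on_def scaleR_fun_def algebra_simps)
  moreover have "bounded_on_tests S (c *\<^sub>R T)"
    unfolding bounded_on_tests_def
  proof (intro allI impI)
    fix K :: "pt set" assume K: "compact K"
    \<comment> \<open>The added 1 allows \<open>c = 0\<close>.\<close>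
    have pos: "1 / (\<bar>c\<bar> + 1) > 0" by (simp add: add_nonneg_pos)
    obtain L \<delta> where 1: "finite L" "\<delta> > 0"
      "\<forall>\<phi>\<in>test_on K S. small_on L \<delta> \<phi> \<longrightarrow> \<bar>T \<phi>\<bar> \<le> 1 / (\<bar>c\<bar> + 1)"
      using bounded_on_testsD[OF T(2,1) S K pos] by blast
    have "\<bar>(c *\<^sub>R T) \<phi>\<bar> \<le> 1" if "\<bar>T \<phi>\<bar> \<le> 1 / (\<bar>c\<bar> + 1)" for \<phi>
    proof -
      have "\<bar>c\<bar> * \<bar>T \<phi>\<bar> \<le> \<bar>c\<bar> * (1 / (\<bar>c\<bar> + 1))" using that by (intro mult_left_mono) auto
      also have "\<dots> \<le> 1" by (simp add: field_simps)
      finally show ?thesis by (simp add: scaleR_fun_def abs_mult)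
    qed
    then show "\<exists>L \<delta>. finite L \<and> \<delta> > 0 \<and>
      (\<forall>\<phi>\<in>test_on K S. small_on L \<delta> \<phi> \<longrightarrow> \<bar>(c *\<^sub>R T) \<phi>\<bar> \<le> 1)"
      using 1 by blast
  qed
  ultimately show "c *\<^sub>R T \<in> {T. linear_on (test S) T \<and> bounded_on_tests S T}" by simp
qed

lemma subspace_dual_LF:
  assumes S: "subspace S"
  shows "subspace (dual (subsp (test S)) (LF_topology S))"
proof -
  have "dual (subsp (test S)) (LF_topology S) =
      {T. linear_on (test S) T \<and> bounded_on_tests S T} \<inter> {T. \<forall>\<phi>. \<phi> \<notin> test S \<longrightarrow> T \<phi> = 0}"
    using dual_LF_iff[OF S] by blast
  moreover have "subspace {T. \<forall>\<phi>. \<phi> \<notin> test S \<longrightarrow> T \<phi> = (0::real)}"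
    by (auto simp: subspace_def scaleR_fun_def)
  ultimately show ?thesis using subspace_inter[OF subspace_functionals[OF S]] by simp
qed

lemma Distr_iff: "T \<in> Distr \<longleftrightarrow>
    linear_on Ccinf T \<and> bounded_on_tests UNIV T \<and> (\<forall>\<phi>. \<phi> \<notin> Ccinf \<longrightarrow> T \<phi> = 0)"
  unfolding Distr_def by (rule dual_LF_iff[OF subspace_UNIV])

lemma subspace_Distr: "subspace Distr"
  unfolding Distr_def by (rule subspace_dual_LF[OF subspace_UNIV])

lemma test_mult:
  assumes "smooth f" "\<phi> \<in> Ccinf"
  shows "(\<lambda>x. f x * \<phi> x) \<in> Ccinf"
proof -
  obtain K where "smooth \<phi>" "compact K" "\<And>x. x \<notin> K \<Longrightarrow> \<phi> x = 0"
    using assms(2) unfolding test_iff by blast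
  then show ?thesis using assms(1) by (intro testI[of _ _ K] smooth_mult) auto
qed

text \<open>A qualitative Leibniz rule. The induction removes the derivative taken first, because
  the product rule there leaves two products, with \<open>f\<close> and with \<open>pd i f\<close>,
  and the induction hypothesis holds for every smooth factor.\<close>

lemma partials_mult_bound:
  fixes f :: "pt \<Rightarrow> real"
  assumes "smooth f" "compact K"
  shows "\<exists>L C. finite L \<and> C \<ge> 0 \<and> (\<forall>\<phi> M. \<forall>x\<in>K. smooth \<phi> \<longrightarrow> (\<forall>b\<in>L. \<bar>partials b \<phi> x\<bar> \<le> M) \<longrightarrow>
    \<bar>partials is (\<lambda>x. f x * \<phi> x) x\<bar> \<le> C * M)"
  using assms(1)
proof (induction "is" arbitrary: f rule: rev_induct)
  case Nil
  have "bounded (f ` K)"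
    by (intro compact_imp_bounded compact_continuous_image smooth_continuous Nil assms(2))
  then obtain C where C: "C > 0" "\<And>x. x \<in> K \<Longrightarrow> \<bar>f x\<bar> \<le> C" by (auto simp: bounded_pos)
  have "\<bar>f x * \<phi> x\<bar> \<le> C * M" if "x \<in> K" "\<bar>\<phi> x\<bar> \<le> M" for x \<phi> M
    unfolding abs_mult using C that by (intro mult_mono) (auto simp: order_less_imp_le)
  then show ?case using C(1) by (intro exI[of _ "{[]}"] exI[of _ C]) simp
next
  case (snoc i "is")
  obtain L C where 1: "finite L" "C \<ge> 0" "\<And>\<phi> M x. \<lbrakk>x \<in> K; smooth \<phi>; \<forall>b\<in>L. \<bar>partials b \<phi> x\<bar> \<le> M\<rbrakk> \<Longrightarrow>
    \<bar>partials is (\<lambda>x. f x * \<phi> x) x\<bar> \<le> C * M"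
    using snoc.IH[OF snoc.prems] by blast
  obtain L' C' where 2: "finite L'" "C' \<ge> 0" "\<And>\<phi> M x. \<lbrakk>x \<in> K; smooth \<phi>; \<forall>b\<in>L'. \<bar>partials b \<phi> x\<bar> \<le> M\<rbrakk> \<Longrightarrow>
    \<bar>partials is (\<lambda>x. pd i f x * \<phi> x) x\<bar> \<le> C' * M"
    using snoc.IH[OF smooth_pd[OF snoc.prems, of i]] by blast
  have "\<bar>partials (is @ [i]) (\<lambda>x. f x * \<phi> x) x\<bar> \<le> (C + C') * M"
    if x: "x \<in> K" and \<phi>: "smooth \<phi>" and b: "\<forall>b\<in>(\<lambda>b. b @ [i]) ` L \<union> L'. \<bar>partials b \<phi> x\<bar> \<le> M" for \<phi> M x
  proof -
    have "pd i (\<lambda>x. f x * \<phi> x) = (\<lambda>x. f x * pd i \<phi> x + pd i f x * \<phi> x)"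
      by (rule ext) (rule pd_mult[OF smooth_differentiable[OF snoc.prems] smooth_differentiable[OF \<phi>]])
    then have "partials (is @ [i]) (\<lambda>x. f x * \<phi> x) x =
        partials is (\<lambda>x. f x * pd i \<phi> x) x + partials is (\<lambda>x. pd i f x * \<phi> x) x"
      by (simp add: partials_snoc partials_add smooth_mult smooth_pd snoc.prems \<phi>)
    moreover have "\<bar>partials is (\<lambda>x. f x * pd i \<phi> x) x\<bar> \<le> C * M"
      using b by (intro 1(3) x smooth_pd \<phi>) (auto simp flip: partials_snoc)
    moreover have "\<bar>partials is (\<lambda>x. pd i f x * \<phi> x) x\<bar> \<le> C' * M"
      using b by (intro 2(3) x \<phi>) auto
    ultimately show ?thesis by (simp add: distrib_right)
  qed
  then show ?case
    using 1(1,2) 2(1,2) by (intro exI[of _ "(\<lambda>b. b @ [i]) ` L \<union> L'"] exI[of _ "C + C'"]) auto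
qed

lemma distr_mult_Distr:
  assumes f: "smooth f" and T: "T \<in> Distr"
  shows "distr_mult f T \<in> Distr"
proof -
  have lin: "linear_on Ccinf T" and bdd: "bounded_on_tests UNIV T" using T by (auto simp: Distr_iff)
  note sub = subspace_test[OF subspace_UNIV]
  have "linear_on Ccinf (distr_mult f T)"
    unfolding linear_on_def
  proof (intro conjI ballI allI)
    fix \<phi> \<psi> assume "\<phi> \<in> Ccinf" "\<psi> \<in> Ccinf"
    then show "distr_mult f T (\<phi> + \<psi>) = distr_mult f T \<phi> + distr_mult f T \<psi>"
      using linear_onD(1)[OF lin test_mult[OF f] test_mult[OF f], of \<phi> \<psi>] subspace_add[OF sub, of \<phi> \<psi>]
      by (simp add: distr_mult_def plus_fun_def distrib_left)
  next
    fix c \<phi> assume "\<phi> \<in> Ccinf"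
    then show "distr_mult f T (c *\<^sub>R \<phi>) = c * distr_mult f T \<phi>"
      using linear_onD(2)[OF lin test_mult[OF f], of \<phi> c] subspace_scale[OF sub, of \<phi> c]
      by (simp add: distr_mult_def scaleR_fun_def mult.left_commute)
  qed
  moreover have "bounded_on_tests UNIV (distr_mult f T)"
    unfolding bounded_on_tests_def
  proof (intro allI impI)
    fix K :: "pt set" assume K: "compact K"
    obtain L0 \<delta>0 where 0: "finite L0" "\<delta>0 > 0"
      "\<forall>\<phi>\<in>test_on K UNIV. small_on L0 \<delta>0 \<phi> \<longrightarrow> \<bar>T \<phi>\<bar> \<le> 1"
      using bdd K unfolding bounded_on_tests_def by blast
    obtain L C where LC: "\<And>is. finite (L is)" "\<And>is. C is \<ge> 0"
      "\<And>is \<phi> M x. \<lbrakk>x \<in> K; smooth \<phi>; \<forall>b\<in>L is. \<bar>partials b \<phi> x\<bar> \<le> M\<rbrakk> \<Longrightarrow>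
        \<bar>partials is (\<lambda>x. f x * \<phi> x) x\<bar> \<le> C is * M"
      using partials_mult_bound[OF f K] by metis
    \<comment> \<open>The summand 1 makes every \<open>C is\<close> strictly smaller than
      \<open>c\<close>, so the final bound by \<open>\<delta>0\<close> is strict.\<close>
    define c where "c = 1 + (\<Sum>is\<in>L0. C is)"
    have c: "c > 0" unfolding c_def using LC(2) by (simp add: add_pos_nonneg sum_nonneg)
    have "\<bar>distr_mult f T \<phi>\<bar> \<le> 1"
      if \<phi>: "\<phi> \<in> test_on K UNIV" "\<forall>b\<in>\<Union>(L ` L0). \<forall>x. norm (partials b \<phi> x) < \<delta>0 / c" for \<phi>
    proof -
      have p: "smooth \<phi>" "\<And>x. x \<notin> K \<Longrightarrow> \<phi> x = 0"
        using \<phi>(1) by (auto simp: test_on_iff[OF compact_imp_closed[OF K]])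
      have f\<phi>: "(\<lambda>x. f x * \<phi> x) \<in> test_on K UNIV"
        using p by (simp add: test_on_iff[OF compact_imp_closed[OF K]] smooth_mult[OF f])
      have "norm (partials is (\<lambda>x. f x * \<phi> x) x) < \<delta>0" if i: "is \<in> L0" for "is" x
      proof (cases "x \<in> K")
        case True
        have "\<bar>partials is (\<lambda>x. f x * \<phi> x) x\<bar> \<le> C is * (\<delta>0 / c)"
          using \<phi>(2) i by (intro LC(3) True p(1)) (auto simp: order_less_imp_le)
        also have "C is < c" unfolding c_def using member_le_sum[of "is" L0 C] i 0(1) LC(2) by auto
        then have "C is * (\<delta>0 / c) < c * (\<delta>0 / c)" using 0(2) c by (intro mult_strict_right_mono) auto
        also have "\<dots> = \<delta>0" using c by simp
        finally show ?thesis by simp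
      next
        case False
        then show ?thesis
          using partials_zero_outside[OF compact_imp_closed[OF K], of "\<lambda>x. f x * \<phi> x"] p(2) 0(2) by simp
      qed
      then have "\<bar>T (\<lambda>x. f x * \<phi> x)\<bar> \<le> 1" using 0(3) f\<phi> by blast
      then show ?thesis by (simp add: distr_mult_def)
    qed
    moreover have "finite (\<Union>(L ` L0))" using 0(1) LC(1) by blast
    ultimately show "\<exists>L \<delta>. finite L \<and> \<delta> > 0 \<and>
      (\<forall>\<phi>\<in>test_on K UNIV. small_on L \<delta> \<phi> \<longrightarrow> \<bar>distr_mult f T \<phi>\<bar> \<le> 1)"
      using 0(2) c by (intro exI[of _ "\<Union>(L ` L0)"] exI[of _ "\<delta>0 / c"]) simp
  qed
  ultimately show ?thesis by (auto simp: Distr_iff distr_mult_def)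
qed

lemma DF_Distr: "T \<in> DF M \<Longrightarrow> T I \<in> Distr"
  using subspace_0[OF subspace_Distr] by (cases "I \<in> M") (auto simp: DF_def)

lemma subspace_DF: "subspace (DF M)"
  using subspace_0[OF subspace_Distr] subspace_add[OF subspace_Distr] subspace_scale[OF subspace_Distr]
  by (auto simp: subspace_def DF_def scaleR_fun_def[of _ "_ :: 4 set \<Rightarrow> distr"])

section \<open>The tensor product over the smooth functions\<close>

lemma independent_pure: "independent (range (\<lambda>y. pure (fst y) (snd y)))"
proof
  let ?P = "range (\<lambda>y. pure (fst y) (snd y)) :: ('a \<times> 'b \<Rightarrow> real) set"
  assume "dependent ?P"
  then obtain w where w: "w \<in> ?P" "w \<in> span (?P - {w})" unfolding dependent_def by blast
  then obtain y where y: "w = pure (fst y) (snd y)" by blast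
  have "?P - {w} \<subseteq> {v. v y = 0}" by (auto simp: y pure_def)
  moreover have "subspace {v. v y = (0::real)}" by (auto simp: subspace_def scaleR_fun_def)
  ultimately have "w y = 0" using w(2) span_minimal by blast
  then show False by (simp add: y pure_def)
qed

text \<open>Universal property of the free vector space on pairs: the functions
  \<open>pure a b\<close> are independent, and the pair is recovered as the point where the value is
  1.\<close>

lemma pure_extension:
  fixes h :: "'a \<Rightarrow> 'b \<Rightarrow> 'c::real_vector"
  shows "\<exists>g. linear g \<and> (\<forall>a b. g (pure a b) = h a b)"
proof -
  have y: "(SOME y. pure a b y = 1) = (a, b)" for a :: 'a and b :: 'b
    by (rule some_equality) (auto simp: pure_def split: if_splits)
  obtain g :: "('a \<times> 'b \<Rightarrow> real) \<Rightarrow> 'c" where "linear g"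
    "\<And>w. w \<in> range (\<lambda>y. pure (fst y) (snd y)) \<Longrightarrow> g w = case_prod h (SOME y. w y = 1)"
    using linear_independent_extend[OF independent_pure, of "\<lambda>w. case_prod h (SOME y. w y = 1)"] by blast
  moreover have "pure a b \<in> range (\<lambda>y. pure (fst y) (snd y))" for a :: 'a and b :: 'b
    by (rule image_eqI[of _ _ "(a, b)"]) auto
  ultimately show ?thesis using y by (intro exI[of _ g]) simp
qed

text \<open>\<open>E r l p q\<close> is here a free module over the smooth functions with basis the
  classes of \<open>\<theta> I\<close> for \<open>I\<close> in \<open>M\<close>; the monomials from
  \<open>N\<close> are boundaries. Tensoring a free module with the distributions gives one
  distribution per basis element, and the inverse multiplies the distribution by the coefficients of
  the form.\<close>

lemma tensor_iso:
  assumes Z: "Zr Om r p q = coef Cinf (M \<union> N)" and B: "Br Om l p q = coef Cinf N" and MN: "M \<inter> N = {}"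
  shows "linear_iso (subsp (DF M)) (tensor_E r l p q) (to_tensor_E r l p q M)"
proof -
  define B where "B = coef Cinf N"
  define Z where "Z = coef Cinf (M \<union> N)"
  define R where "R = tensor_rels r l p q"
  define e where "e I = coset B (\<lambda>x. \<theta> I)" for I
  define emb where "emb T = (\<Sum>I\<in>M. pure (T I) (e I))" for T :: "4 set \<Rightarrow> distr"
  have sB: "subspace B" and sZ: "subspace Z"
    unfolding B_def Z_def by (intro subspace_coef subspace_Cinf)+
  have E: "E r l p q = quot Z B" by (simp add: E_def assms Z_def B_def)
  have carr: "carr (E r l p q) = coset B ` Z" unfolding E by (rule quot_simps(1)[OF sB])
  have vadd: "vadd (E r l p q) (coset B \<alpha>) (coset B \<beta>) = coset B (\<alpha> + \<beta>)" for \<alpha> \<beta>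
    unfolding E by (rule quot_simps(2)[OF sB])
  have Br: "Br Om l p q = B" by (simp add: B B_def)
  have sR: "subspace R" unfolding R_def tensor_rels_def by (rule subspace_span)
  have sm: "smooth (\<lambda>x. \<alpha> x $ I)" if "\<alpha> \<in> Z" for \<alpha> I
  proof (cases "I \<in> M \<union> N")
    case True
    then show ?thesis using that by (simp add: Z_def coef_def)
  next
    case False
    then show ?thesis using that smooth_const[of "0::real"] by (simp add: Z_def coef_def)
  qed
  have mult_coef: "(\<lambda>x. f x *\<^sub>R \<alpha> x) \<in> coef Cinf K" if "smooth f" "\<alpha> \<in> coef Cinf K" for f \<alpha> K
    using that smooth_mult[OF that(1)] by (simp add: coef_def)
  have fm: "form_mult B f (coset B \<alpha>) = coset B (\<lambda>x. f x *\<^sub>R \<alpha> x)" if f: "smooth f" for f \<alpha>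
  proof (intro set_eqI iffI)
    fix \<beta> assume "\<beta> \<in> form_mult B f (coset B \<alpha>)"
    then obtain w b where "w \<in> B" "b \<in> B" "\<beta> = (\<lambda>x. f x *\<^sub>R (\<alpha> + w) x) + b"
      by (auto simp: form_mult_def coset_def)
    moreover from this have "(\<lambda>x. f x *\<^sub>R w x) + b \<in> B"
      using mult_coef[OF f, of w N] subspace_add[OF sB] by (simp add: B_def)
    moreover have "\<beta> = (\<lambda>x. f x *\<^sub>R \<alpha> x) + ((\<lambda>x. f x *\<^sub>R w x) + b)"
      using calculation by (simp add: fun_eq_iff scaleR_add_right)
    ultimately show "\<beta> \<in> coset B (\<lambda>x. f x *\<^sub>R \<alpha> x)" unfolding coset_def by blast
  next
    fix \<beta> assume "\<beta> \<in> coset B (\<lambda>x. f x *\<^sub>R \<alpha> x)"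
    then obtain b where "b \<in> B" "\<beta> = (\<lambda>x. f x *\<^sub>R \<alpha> x) + b" by (auto simp: coset_def)
    moreover have "\<alpha> \<in> coset B \<alpha>" using subspace_0[OF sB] by (force simp: coset_def)
    ultimately show "\<beta> \<in> form_mult B f (coset B \<alpha>)" unfolding form_mult_def by blast
  qed
  have R1: "pure (S + T) (coset B \<alpha>) - pure S (coset B \<alpha>) - pure T (coset B \<alpha>) \<in> R"
    if "S \<in> Distr" "T \<in> Distr" "\<alpha> \<in> Z" for S T \<alpha>
    unfolding R_def tensor_rels_def carr Br using that by (intro span_base) blast
  have R2: "pure T (coset B (\<alpha> + \<beta>)) - pure T (coset B \<alpha>) - pure T (coset B \<beta>) \<in> R"
    if "T \<in> Distr" "\<alpha> \<in> Z" "\<beta> \<in> Z" for T \<alpha> \<beta>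
    unfolding R_def tensor_rels_def carr Br vadd[symmetric] using that by (intro span_base) blast
  have R3: "pure (c *\<^sub>R T) (coset B \<alpha>) - c *\<^sub>R pure T (coset B \<alpha>) \<in> R"
    if "T \<in> Distr" "\<alpha> \<in> Z" for c T \<alpha>
    unfolding R_def tensor_rels_def carr Br using that by (intro span_base) blast
  have R4: "pure (distr_mult f T) (coset B \<alpha>) - pure T (coset B (\<lambda>x. f x *\<^sub>R \<alpha> x)) \<in> R"
    if "smooth f" "T \<in> Distr" "\<alpha> \<in> Z" for f T \<alpha>
    unfolding R_def tensor_rels_def carr Br fm[OF that(1), symmetric] using that by (intro span_base) blast
  have theta_Z: "(\<lambda>x. \<theta> I) \<in> Z" if "I \<in> M" for I
    using that smooth_const by (auto simp: Z_def coef_def theta_nth)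

  \<comment> \<open>Well defined on classes although a representative is chosen: boundaries have no
    component in \<open>M\<close>.\<close>
  define cf where "cf I A = (\<lambda>x. (SOME \<alpha>. \<alpha> \<in> Z \<and> A = coset B \<alpha>) x $ I)" for I A
  have cf: "cf I (coset B \<alpha>) = (\<lambda>x. \<alpha> x $ I)" if "I \<in> M" "\<alpha> \<in> Z" for I \<alpha>
  proof -
    have ex: "\<exists>\<beta>. \<beta> \<in> Z \<and> coset B \<alpha> = coset B \<beta>" using that by blast
    define \<beta> where "\<beta> = (SOME \<beta>. \<beta> \<in> Z \<and> coset B \<alpha> = coset B \<beta>)"
    have "coset B \<alpha> = coset B \<beta>" using someI_ex[OF ex] unfolding \<beta>_def by blast
    then have "\<alpha> - \<beta> \<in> B" using coset_eq_iff[OF sB] by blast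
    moreover have "I \<notin> N" using that MN by blast
    ultimately have "(\<alpha> - \<beta>) x $ I = 0" for x by (simp add: B_def coef_def)
    then show ?thesis unfolding cf_def \<beta>_def[symmetric] by simp
  qed
  \<comment> \<open>The candidate for the inverse, defined on the free space; \<open>g0\<close> lets
    it descend to the tensor product and \<open>g_emb\<close> gives injectivity.\<close>
  obtain g :: "(distr \<times> form set \<Rightarrow> real) \<Rightarrow> 4 set \<Rightarrow> distr" where g: "linear g"
    "\<And>T A. g (pure T A) = (\<lambda>I. if I \<in> M then distr_mult (cf I A) T else 0)"
    using pure_extension[of "\<lambda>T A I. if I \<in> M then distr_mult (cf I A) T else 0"] by blast
  have g0: "g w = 0" if "w \<in> R" for w
    using g(1) _ that unfolding R_def tensor_rels_def
  proof (rule linear_eq_0_on_span)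
    fix w assume "w \<in> {pure (S + T) A - pure S A - pure T A | S T A.
         S \<in> Distr \<and> T \<in> Distr \<and> A \<in> carr (E r l p q)} \<union>
      {pure T (vadd (E r l p q) A A') - pure T A - pure T A' | T A A'.
         T \<in> Distr \<and> A \<in> carr (E r l p q) \<and> A' \<in> carr (E r l p q)} \<union>
      {pure (c *\<^sub>R T) A - c *\<^sub>R pure T A | c T A. T \<in> Distr \<and> A \<in> carr (E r l p q)} \<union>
      {pure (distr_mult f T) A - pure T (form_mult (Br Om l p q) f A) | f T A.
         f \<in> Cinf \<and> T \<in> Distr \<and> A \<in> carr (E r l p q)}"
    then consider (1) S T A where "w = pure (S + T) A - pure S A - pure T A"
      | (2) T \<alpha> \<beta> where "w = pure T (coset B (\<alpha> + \<beta>)) - pure T (coset B \<alpha>) - pure T (coset B \<beta>)"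
          "T \<in> Distr" "\<alpha> \<in> Z" "\<beta> \<in> Z"
      | (3) c T A where "w = pure (c *\<^sub>R T) A - c *\<^sub>R pure T A"
      | (4) f T \<alpha> where "w = pure (distr_mult f T) (coset B \<alpha>) - pure T (coset B (\<lambda>x. f x *\<^sub>R \<alpha> x))"
          "smooth f" "\<alpha> \<in> Z"
      unfolding carr Br by (auto simp: vadd fm)
    then show "g w = 0"
    proof cases
      case 1
      show ?thesis
        unfolding 1 linear_diff[OF g(1)] g(2) by (intro ext) (simp add: distr_mult_def)
    next
      case 2
      have "T (\<lambda>x. (\<alpha> x $ I + \<beta> x $ I) * \<phi> x) = T (\<lambda>x. \<alpha> x $ I * \<phi> x) + T (\<lambda>x. \<beta> x $ I * \<phi> x)"
        if "\<phi> \<in> Ccinf" for I \<phi>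
      proof -
        have "linear_on Ccinf T" using 2(2) by (simp add: Distr_iff)
        from linear_onD(1)[OF this test_mult[OF sm[OF 2(3)] that] test_mult[OF sm[OF 2(4)] that], of I I]
        show ?thesis by (simp add: plus_fun_def distrib_right)
      qed
      then show ?thesis
        using 2(3,4) subspace_add[OF sZ 2(3,4)]
        by (auto simp: 2(1) linear_diff[OF g(1)] g(2) cf distr_mult_def fun_eq_iff)
    next
      case 3
      show ?thesis
        unfolding 3 linear_diff[OF g(1)] linear_scale[OF g(1)] g(2)
        by (intro ext) (simp add: distr_mult_def scaleR_fun_def)
    next
      case 4
      have "(\<lambda>x. f x *\<^sub>R \<alpha> x) \<in> Z" using mult_coef[OF 4(2)] 4(3) by (simp add: Z_def)
      then show ?thesis
        using 4(3) test_mult[OF sm[OF 4(3)]]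
        by (auto simp: 4(1) linear_diff[OF g(1)] g(2) cf distr_mult_def fun_eq_iff mult.assoc)
    qed
  qed
  have g_emb: "g (emb T) = T" if T: "T \<in> DF M" for T
  proof
    fix I
    have one: "distr_mult (cf I (e J)) (T J) = (if J = I then T I else 0)" if "I \<in> M" "J \<in> M" for J
    proof -
      have TD: "T J \<in> Distr" using T by (rule DF_Distr)
      have "T J (\<lambda>x. 0) = 0"
        using linear_on_0[OF _ subspace_test[OF subspace_UNIV], of "T J"] TD by (simp add: Distr_iff zero_fun_def)
      then show ?thesis
        using TD that by (auto simp: e_def cf[OF that(1) theta_Z[OF that(2)]] theta_nth distr_mult_def fun_eq_iff Distr_iff)
    qed
    have "g (emb T) I = (\<Sum>J\<in>M. g (pure (T J) (e J)) I)"
      unfolding emb_def linear_sum[OF g(1)] by (rule sum_fun_apply)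
    also have "\<dots> = T I"
    proof (cases "I \<in> M")
      case True
      have "(\<Sum>J\<in>M. g (pure (T J) (e J)) I) = (\<Sum>J\<in>M. if J = I then T I else 0)"
        by (rule sum.cong) (use True one in \<open>auto simp: g(2)\<close>)
      then show ?thesis using True by simp
    next
      case False
      then show ?thesis using T by (simp add: g(2) DF_def)
    qed
    finally show "g (emb T) I = T I" .
  qed
  have emb_add: "emb (T + U) - (emb T + emb U) \<in> R" if "T \<in> DF M" "U \<in> DF M" for T U
  proof -
    have "emb (T + U) - (emb T + emb U) = (\<Sum>I\<in>M. pure (T I + U I) (e I) - pure (T I) (e I) - pure (U I) (e I))"
      by (simp add: emb_def sum_subtractf sum.distrib algebra_simps)
    also have "\<dots> \<in> R"
      unfolding e_def by (intro subspace_sum sR R1 DF_Distr[OF that(1)] DF_Distr[OF that(2)] theta_Z)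
    finally show ?thesis .
  qed
  have emb_scale: "emb (c *\<^sub>R T) - c *\<^sub>R emb T \<in> R" if "T \<in> DF M" for c T
  proof -
    have "emb (c *\<^sub>R T) - c *\<^sub>R emb T = (\<Sum>I\<in>M. pure (c *\<^sub>R T I) (e I) - c *\<^sub>R pure (T I) (e I))"
      by (simp add: emb_def sum_subtractf scaleR_sum_right scaleR_fun_def[of c T])
    also have "\<dots> \<in> R"
      unfolding e_def by (intro subspace_sum sR R3 DF_Distr[OF that] theta_Z)
    finally show ?thesis .
  qed
  \<comment> \<open>Additivity for 0 + 0 leaves exactly minus this tensor.\<close>
  have pure0: "pure T (coset B 0) \<in> R" if "T \<in> Distr" for T
    using subspace_neg[OF sR R2[OF that subspace_0[OF sZ] subspace_0[OF sZ]]] by simp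
  \<comment> \<open>Modulo boundaries \<open>\<alpha>\<close> is a sum of monomials over
    \<open>M\<close>. Additivity splits the tensor, and the balancing relation moves each smooth
    coefficient onto the distribution.\<close>
  have gen: "\<exists>U\<in>DF M. pure T (coset B \<alpha>) - emb U \<in> R" if T: "T \<in> Distr" and \<alpha>: "\<alpha> \<in> Z" for T \<alpha>
  proof -
    define a where "a I = (\<lambda>x. \<alpha> x $ I)" for I
    have a: "smooth (a I)" for I unfolding a_def by (rule sm[OF \<alpha>])
    define s where "s F = (\<lambda>x. \<Sum>I\<in>F. a I x *\<^sub>R \<theta> I)" for F
    have mono: "(\<lambda>x. a I x *\<^sub>R \<theta> I) \<in> Z" if "I \<in> M" for I
      using mult_coef[OF a, of "\<lambda>x. \<theta> I" "M \<union> N" I] theta_Z[OF that] by (simp add: Z_def)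
    have "finite F \<Longrightarrow> F \<subseteq> M \<Longrightarrow> s F \<in> Z \<and>
      pure T (coset B (s F)) - (\<Sum>I\<in>F. pure (distr_mult (a I) T) (e I)) \<in> R" for F
    proof (induction F rule: finite_induct)
      case empty
      show ?case using pure0[OF T] subspace_0[OF sZ] by (simp add: s_def zero_fun_def)
    next
      case (insert I F)
      then have I: "I \<in> M" and sF: "s F \<in> Z" by auto
      have s: "s (insert I F) = s F + (\<lambda>x. a I x *\<^sub>R \<theta> I)"
        using insert by (simp add: s_def fun_eq_iff add.commute)
      have IH: "pure T (coset B (s F)) - (\<Sum>I\<in>F. pure (distr_mult (a I) T) (e I)) \<in> R"
        using insert by blast
      have sum: "(\<Sum>I\<in>insert I F. pure (distr_mult (a I) T) (e I)) =
          pure (distr_mult (a I) T) (e I) + (\<Sum>I\<in>F. pure (distr_mult (a I) T) (e I))"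
        by (rule sum.insert[OF insert.hyps])
      have cancel: "(u - v - w) + (v - t) - (z - w) = u - (z + t)" for u v w t z :: "distr \<times> form set \<Rightarrow> real"
        by (simp add: algebra_simps)
      note subspace_diff[OF sR subspace_add[OF sR R2[OF T sF mono[OF I]] IH]
          R4[OF a[of I] T theta_Z[OF I], folded e_def]]
      then have "pure T (coset B (s (insert I F))) - (\<Sum>I\<in>insert I F. pure (distr_mult (a I) T) (e I)) \<in> R"
        unfolding cancel s sum .
      moreover have "s (insert I F) \<in> Z" unfolding s by (rule subspace_add[OF sZ sF mono[OF I]])
      ultimately show ?case by blast
    qed
    from this[of M] have sM: "s M \<in> Z" "pure T (coset B (s M)) - (\<Sum>I\<in>M. pure (distr_mult (a I) T) (e I)) \<in> R"
      by auto
    have "\<alpha> - s M \<in> B"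
    proof -
      have comp: "(\<alpha> - s M) x $ I = (if I \<in> M then 0 else \<alpha> x $ I)" for x I
        by (simp add: s_def a_def theta_nth if_distrib cong: if_cong)
      show ?thesis
        unfolding B_def coef_def
      proof (intro CollectI conjI ballI allI impI)
        fix I assume "I \<in> N"
        then have "I \<notin> M" using MN by blast
        then show "smooth (\<lambda>x. (\<alpha> - s M) x $ I)" unfolding comp using sm[OF \<alpha>, of I] by simp
      next
        fix I x assume "I \<notin> N"
        then show "(\<alpha> - s M) x $ I = 0" unfolding comp using \<alpha> by (simp add: Z_def coef_def)
      qed
    qed
    then have "coset B \<alpha> = coset B (s M)" using coset_eq_iff[OF sB] by blast
    moreover define U where "U = (\<lambda>I. if I \<in> M then distr_mult (a I) T else 0)"
    have "U \<in> DF M" using distr_mult_Distr[OF a T] by (auto simp: U_def DF_def)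
    moreover have "emb U = (\<Sum>I\<in>M. pure (distr_mult (a I) T) (e I))"
      unfolding emb_def by (rule sum.cong) (auto simp: U_def)
    ultimately have "pure T (coset B \<alpha>) - emb U \<in> R" using sM(2) by (simp only:)
    with \<open>U \<in> DF M\<close> show ?thesis by blast
  qed
  have onto: "\<exists>U\<in>DF M. w - emb U \<in> R" if "w \<in> tensor_free r l p q" for w
  proof -
    have emb0: "emb 0 \<in> R" using emb_scale[OF subspace_0[OF subspace_DF], of 0] by simp
    have "subspace {w. \<exists>U\<in>DF M. w - emb U \<in> R}"
    proof (rule subspaceI)
      show "0 \<in> {w. \<exists>U\<in>DF M. w - emb U \<in> R}"
        using subspace_neg[OF sR emb0] subspace_0[OF subspace_DF] by (auto intro!: bexI[of _ 0])
    next
      fix v w assume "v \<in> {w. \<exists>U\<in>DF M. w - emb U \<in> R}" "w \<in> {w. \<exists>U\<in>DF M. w - emb U \<in> R}"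
      then obtain T U where TU: "T \<in> DF M" "U \<in> DF M" "v - emb T \<in> R" "w - emb U \<in> R" by blast
      have "(v - emb T) + (w - emb U) - (emb (T + U) - (emb T + emb U)) \<in> R"
        by (intro subspace_add[OF sR] subspace_diff[OF sR] emb_add TU)
      then have "v + w - emb (T + U) \<in> R" by (simp add: algebra_simps)
      then show "v + w \<in> {w. \<exists>U\<in>DF M. w - emb U \<in> R}" using subspace_add[OF subspace_DF TU(1,2)] by blast
    next
      fix c w assume "w \<in> {w. \<exists>U\<in>DF M. w - emb U \<in> R}"
      then obtain U where U: "U \<in> DF M" "w - emb U \<in> R" by blast
      have "c *\<^sub>R (w - emb U) - (emb (c *\<^sub>R U) - c *\<^sub>R emb U) \<in> R"
        by (intro subspace_diff[OF sR] subspace_scale[OF sR] emb_scale U)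
      then have "c *\<^sub>R w - emb (c *\<^sub>R U) \<in> R" by (simp add: algebra_simps)
      then show "c *\<^sub>R w \<in> {w. \<exists>U\<in>DF M. w - emb U \<in> R}" using subspace_scale[OF subspace_DF U(1)] by blast
    qed
    moreover have "{pure T A | T A. T \<in> Distr \<and> A \<in> carr (E r l p q)} \<subseteq> {w. \<exists>U\<in>DF M. w - emb U \<in> R}"
      unfolding carr using gen by blast
    ultimately have "tensor_free r l p q \<subseteq> {w. \<exists>U\<in>DF M. w - emb U \<in> R}"
      unfolding tensor_free_def by (rule span_minimal[rotated])
    then show ?thesis using that by blast
  qed
  have emb_free: "emb U \<in> tensor_free r l p q" if "U \<in> DF M" for U
    unfolding emb_def tensor_free_def e_def carr
    by (intro span_sum span_base) (use DF_Distr[OF that] theta_Z in blast)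
  have to: "to_tensor_E r l p q M U = coset R (emb U)" for U
    by (simp add: to_tensor_E_def R_def emb_def e_def Br)
  have T: "tensor_E r l p q = quot (tensor_free r l p q) R" by (simp add: tensor_E_def R_def)
  have "bij_betw (\<lambda>U. coset R (emb U)) (DF M) (coset R ` tensor_free r l p q)"
    unfolding bij_betw_def
  proof
    show "inj_on (\<lambda>U. coset R (emb U)) (DF M)"
    proof (rule inj_onI)
      fix T U assume TU: "T \<in> DF M" "U \<in> DF M" "coset R (emb T) = coset R (emb U)"
      then have "g (emb T - emb U) = 0" using g0 coset_eq_iff[OF sR] by blast
      then show "T = U" using g_emb TU(1,2) by (simp add: linear_diff[OF g(1)])
    qed
    show "(\<lambda>U. coset R (emb U)) ` DF M = coset R ` tensor_free r l p q"
    proof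
      show "(\<lambda>U. coset R (emb U)) ` DF M \<subseteq> coset R ` tensor_free r l p q" using emb_free by blast
      show "coset R ` tensor_free r l p q \<subseteq> (\<lambda>U. coset R (emb U)) ` DF M"
        using onto coset_eq_iff[OF sR] by blast
    qed
  qed
  moreover have "coset R (emb (T + U)) = coset R (emb T + emb U)" if "T \<in> DF M" "U \<in> DF M" for T U
    using emb_add[OF that] coset_eq_iff[OF sR] by blast
  moreover have "coset R (emb (c *\<^sub>R T)) = coset R (c *\<^sub>R emb T)" if "T \<in> DF M" for c T
    using emb_scale[OF that] coset_eq_iff[OF sR] by blast
  ultimately show ?thesis
    unfolding linear_iso_def T quot_simps(1)[OF sR] to[abs_def]
    by (simp add: subsp_def quot_simps[OF sR])
qed

section \<open>The pairing\<close>

text \<open>The sign that relates a monomial followed by its complementary monomial to the volume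
  form. It is 1 or -1, which makes the pairing nondegenerate.\<close>

definition sg :: "4 set \<Rightarrow> real" where
  "sg I = theta_wedge I (- I) $ {1, 2, 3, 4}"

lemma sg_square: "sg I * sg I = 1"
proof -
  have "{1, 2, 3, 4} = I \<union> - I" by (simp add: UNIV4[symmetric])
  then show ?thesis
    unfolding sg_def theta_wedge_def by (simp add: theta_nth flip: power_mult_distrib)
qed

lemma compl4: "- {} = {1, 2, 3, 4::4}" "- {1, 2, 3, 4::4} = {}" "- {1} = {2, 3, 4::4}" "- {2} = {1, 3, 4::4}"
  "- {1, 3, 4} = {2::4}" "- {2, 3, 4} = {1::4}" "- {1, 4} = {2, 3::4}" "- {2, 4} = {1, 3::4}"
  "- {2, 3} = {1, 4::4}" "- {1, 3} = {2, 4::4}"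
  by (simp_all only: set4_eq_iff) simp_all

lemma sg_simps: "sg {} = 1" "sg {1, 2, 3, 4} = 1" "sg {1} = 1" "sg {2} = -1"
  "sg {1, 3, 4} = 1" "sg {2, 3, 4} = -1"
proof -
  show "sg {} = 1" "sg {1, 2, 3, 4} = 1" "sg {1} = 1" "sg {2} = -1"
    "sg {1, 3, 4} = 1" "sg {2, 3, 4} = -1"
    unfolding sg_def compl4 theta_wedge_def by (simp_all add: theta_nth prec_def insert_commute)
qed

text \<open>A product of two monomials has a volume component only if their index sets are
  complementary.\<close>

lemma pairing_eq: "pairing T \<beta> = (\<Sum>I\<in>UNIV. sg I * T I (\<lambda>x. \<beta> x $ (- I)))"
proof -
  have w: "theta_wedge I J $ {1, 2, 3, 4} = (if J = - I then sg I else 0)" for I J :: "4 set"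
  proof -
    have "J = - I" if "I \<inter> J = {}" "{1, 2, 3, 4} = I \<union> J" using that by (auto simp: UNIV4[symmetric])
    then have "theta_wedge I J $ {1, 2, 3, 4} = 0" if "J \<noteq> - I"
      using that unfolding theta_wedge_def by (simp add: theta_nth) blast
    then show ?thesis by (simp add: sg_def)
  qed
  have "(wedge (\<theta> I) (\<theta> J)) $ {1, 2, 3, 4} * T I (\<lambda>x. \<beta> x $ J)
      = (if J = - I then sg I * T I (\<lambda>x. \<beta> x $ (- I)) else 0)" for I J
    unfolding wedge_theta w by simp
  then show ?thesis unfolding pairing_def by simp
qed

lemma linear_on_sum:
  assumes "linear_on V T" "subspace V" "finite A" "\<And>i. i \<in> A \<Longrightarrow> f i \<in> V"
  shows "T (\<Sum>i\<in>A. f i) = (\<Sum>i\<in>A. T (f i))"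
  using assms(3,4)
  by (induction A rule: finite_induct)
     (simp_all add: linear_on_0[OF assms(1,2)] linear_onD(1)[OF assms(1)] subspace_sum[OF assms(2)])

lemma pairing_monomial:
  assumes "T \<in> DF M"
  shows "pairing T (\<lambda>x. \<phi> x *\<^sub>R \<theta> (- I)) = sg I * T I \<phi>"
proof -
  have z: "T J (\<lambda>x. 0) = 0" for J
    using linear_on_0[OF _ subspace_test[OF subspace_UNIV], of "T J"] DF_Distr[OF assms, of J]
    by (simp add: Distr_iff zero_fun_def)
  have "sg J * T J (\<lambda>x. (\<phi> x *\<^sub>R \<theta> (- I)) $ (- J)) = (if J = I then sg I * T I \<phi> else 0)" for J
    by (simp add: theta_nth z)
  then show ?thesis by (simp add: pairing_eq)
qed

lemma pairing_add: "pairing (T + U) \<beta> = pairing T \<beta> + pairing U \<beta>"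
  by (simp add: pairing_eq sum.distrib algebra_simps)

lemma pairing_scale: "pairing (c *\<^sub>R T) \<beta> = c * pairing T \<beta>"
  by (simp add: pairing_eq scaleR_fun_def sum_distrib_left algebra_simps)

text \<open>Testing with a single complementary monomial isolates one coefficient up to
  sign.\<close>

lemma DF_eqI:
  assumes "T \<in> DF M" "U \<in> DF M"
    "\<And>I \<phi>. \<lbrakk>I \<in> M; \<phi> \<in> Ccinf\<rbrakk> \<Longrightarrow> pairing T (\<lambda>x. \<phi> x *\<^sub>R \<theta> (- I)) = pairing U (\<lambda>x. \<phi> x *\<^sub>R \<theta> (- I))"
  shows "T = U"
proof (intro ext)
  fix I \<phi>
  have "sg I \<noteq> 0" using sg_square[of I] by auto
  then have "T I \<phi> = U I \<phi>" if "I \<in> M" "\<phi> \<in> Ccinf"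
    using assms(3)[OF that] pairing_monomial[OF assms(1), of \<phi> I] pairing_monomial[OF assms(2), of \<phi> I] by simp
  then show "T I \<phi> = U I \<phi>"
    using assms(1,2) DF_Distr[OF assms(1), of I] DF_Distr[OF assms(2), of I]
    by (cases "I \<in> M"; cases "\<phi> \<in> Ccinf") (auto simp: DF_def Distr_iff)
qed

text \<open>Currents of bidegree (p, q) act on test forms of bidegree (p', q'). Naming the latter by
  equations lets each item insert numerals.\<close>

locale complementary =
  fixes p q p' q' :: int
  assumes p': "p' = 7 - p" and q': "q' = 4 - (p + q) - (7 - p)"
begin

lemma dims: "7 - p = p'" "4 - (p + q) - p' = q'"
  by (simp_all add: p' q')

lemma bideg': "J \<in> bideg p' q' \<longleftrightarrow> - J \<in> bideg p q"
  unfolding p' q' by (rule bideg_compl)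

lemma Omc_coef: "test (Lam p' q') = coef Ccinf (bideg p' q')"
  by (simp add: Lam_def test_span_theta)

lemma component_test: "\<beta> \<in> test (Lam p' q') \<Longrightarrow> (\<lambda>x. \<beta> x $ J) \<in> Ccinf"
  using subspace_0[OF subspace_test[OF subspace_UNIV]] unfolding Omc_coef coef_def
  by (cases "J \<in> bideg p' q'") (auto simp: zero_fun_def)

lemma monomial_test:
  assumes "\<phi> \<in> Ccinf" "I \<in> bideg p q"
  shows "(\<lambda>x. \<phi> x *\<^sub>R \<theta> (- I)) \<in> test (Lam p' q')"
proof -
  have "(\<lambda>x. \<phi> x *\<^sub>R \<theta> (- I)) \<in> coef Ccinf {- I}" using assms by (auto simp: coef_single)
  moreover have "coef Ccinf {- I} \<subseteq> coef Ccinf (bideg p' q')"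
    by (rule coef_mono[OF _ subspace_0[OF subspace_test[OF subspace_UNIV]]]) (simp add: bideg' assms)
  ultimately show ?thesis unfolding Omc_coef by blast
qed

lemma subspace_Lam: "subspace (Lam p' q')"
  by (simp add: Lam_def)

text \<open>Partials commute with taking a coefficient, which does not increase norms, so each
  summand inherits the \<open>L\<close> and \<open>\<delta>\<close> of its distribution.\<close>

lemma pairing_functional:
  assumes T: "T \<in> DF M"
  shows "linear_on (test (Lam p' q')) (pairing T) \<and> bounded_on_tests (Lam p' q') (pairing T)"
proof -
  let ?S = "Lam p' q'"
  have TD: "linear_on Ccinf (T I)" "bounded_on_tests UNIV (T I)" for I
    using DF_Distr[OF T, of I] by (auto simp: Distr_iff)
  have "(\<lambda>\<beta>. T I (\<lambda>x. \<beta> x $ J)) \<in> {u. linear_on (test ?S) u \<and> bounded_on_tests ?S u}" for I J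
  proof (intro CollectI conjI)
    show "linear_on (test ?S) (\<lambda>\<beta>. T I (\<lambda>x. \<beta> x $ J))"
      unfolding linear_on_def
    proof (intro conjI ballI allI)
      fix \<beta> \<gamma> assume "\<beta> \<in> test ?S" "\<gamma> \<in> test ?S"
      then show "T I (\<lambda>x. (\<beta> + \<gamma>) x $ J) = T I (\<lambda>x. \<beta> x $ J) + T I (\<lambda>x. \<gamma> x $ J)"
        using linear_onD(1)[OF TD(1) component_test component_test, of \<beta> \<gamma> I J J] by (simp add: plus_fun_def)
    next
      fix c \<beta> assume "\<beta> \<in> test ?S"
      then show "T I (\<lambda>x. (c *\<^sub>R \<beta>) x $ J) = c * T I (\<lambda>x. \<beta> x $ J)"
        using linear_onD(2)[OF TD(1) component_test, of \<beta> I c J] by (simp add: scaleR_fun_def)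
    qed
    show "bounded_on_tests ?S (\<lambda>\<beta>. T I (\<lambda>x. \<beta> x $ J))"
      unfolding bounded_on_tests_def
    proof (intro allI impI)
      fix K :: "pt set" assume K: "compact K"
      obtain L \<delta> where L: "finite L" "\<delta> > 0"
        "\<forall>\<phi>\<in>test_on K UNIV. small_on L \<delta> \<phi> \<longrightarrow> \<bar>T I \<phi>\<bar> \<le> 1"
        using TD(2)[of I] K unfolding bounded_on_tests_def by blast
      have "\<bar>T I (\<lambda>x. \<beta> x $ J)\<bar> \<le> 1"
        if \<beta>: "\<beta> \<in> test_on K ?S" "small_on L \<delta> \<beta>" for \<beta>
      proof -
        have s: "smooth \<beta>" "\<And>x. x \<notin> K \<Longrightarrow> \<beta> x = 0"
          using \<beta>(1) by (auto simp: test_on_iff[OF compact_imp_closed[OF K]])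
        have "(\<lambda>x. \<beta> x $ J) \<in> test_on K UNIV"
          using s smooth_linear[OF bounded_linear_vec_nth s(1)]
          by (simp add: test_on_iff[OF compact_imp_closed[OF K]])
        moreover have "norm (partials is (\<lambda>x. \<beta> x $ J) x) < \<delta>" if "is \<in> L" for "is" x
        proof -
          have "norm (partials is \<beta> x) < \<delta>" using \<beta>(2) that by blast
          then show ?thesis
            unfolding partials_linear[OF bounded_linear_vec_nth s(1)]
            using component_le_norm_cart[of "partials is \<beta> x" J] by simp
        qed
        ultimately show ?thesis using L(3) by blast
      qed
      then show "\<exists>L \<delta>. finite L \<and> \<delta> > 0 \<and> (\<forall>\<beta>\<in>test_on K ?S.
          small_on L \<delta> \<beta> \<longrightarrow> \<bar>T I (\<lambda>x. \<beta> x $ J)\<bar> \<le> 1)"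
        using L(1,2) by blast
    qed
  qed
  then have "(\<Sum>I\<in>UNIV. sg I *\<^sub>R (\<lambda>\<beta>. T I (\<lambda>x. \<beta> x $ (- I))))
      \<in> {u. linear_on (test ?S) u \<and> bounded_on_tests ?S u}"
    using subspace_functionals[OF subspace_Lam] by (intro subspace_sum subspace_scale) auto
  moreover have "pairing T = (\<Sum>I\<in>UNIV. sg I *\<^sub>R (\<lambda>\<beta>. T I (\<lambda>x. \<beta> x $ (- I))))"
    by (rule ext) (simp add: pairing_eq sum_fun_apply scaleR_fun_def)
  ultimately show ?thesis by simp
qed

text \<open>The coefficient at \<open>I\<close> is the functional restricted to multiples of the
  complementary monomial; the sign \<open>sg I\<close> occurs again in the pairing and cancels as
  its square is 1.\<close>

lemma functional_pairing:
  assumes u: "linear_on (test (Lam p' q')) u" "bounded_on_tests (Lam p' q') u"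
  shows "\<exists>T\<in>DF (bideg p q). \<forall>\<beta>\<in>test (Lam p' q'). pairing T \<beta> = u \<beta>"
proof -
  let ?S = "Lam p' q'"
  define T where "T I = (if I \<in> bideg p q then
      (\<lambda>\<phi>. if \<phi> \<in> Ccinf then sg I * u (\<lambda>x. \<phi> x *\<^sub>R \<theta> (- I)) else 0) else 0)" for I
  have "T I \<in> Distr" if I: "I \<in> bideg p q" for I
    unfolding Distr_iff
  proof (intro conjI allI impI)
    note sub = subspace_test[OF subspace_UNIV]
    show "linear_on Ccinf (T I)"
      unfolding linear_on_def
    proof (intro conjI ballI allI)
      fix \<phi> \<psi> assume "\<phi> \<in> Ccinf" "\<psi> \<in> Ccinf"
      then show "T I (\<phi> + \<psi>) = T I \<phi> + T I \<psi>"
        using linear_onD(1)[OF u(1) monomial_test monomial_test, OF _ I _ I, of \<phi> \<psi>] subspace_add[OF sub, of \<phi> \<psi>] I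
        by (simp add: T_def plus_fun_def scaleR_add_left distrib_left)
    next
      fix c \<phi> assume "\<phi> \<in> Ccinf"
      then show "T I (c *\<^sub>R \<phi>) = c * T I \<phi>"
        using linear_onD(2)[OF u(1) monomial_test, OF _ I, of \<phi> c] subspace_scale[OF sub, of \<phi> c] I
        by (simp add: T_def scaleR_fun_def)
    qed
    show "bounded_on_tests UNIV (T I)"
      unfolding bounded_on_tests_def
    proof (intro allI impI)
      fix K :: "pt set" assume K: "compact K"
      obtain L \<delta> where L: "finite L" "\<delta> > 0"
        "\<forall>\<beta>\<in>test_on K ?S. small_on L \<delta> \<beta> \<longrightarrow> \<bar>u \<beta>\<bar> \<le> 1"
        using u(2) K unfolding bounded_on_tests_def by blast
      have abs_sg: "\<bar>sg I\<bar> = 1" using sg_square[of I] by (auto simp: square_eq_1_iff)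
      have n\<theta>: "norm (\<theta> (- I)) = 1" by (simp add: \<theta>_def)
      have "\<bar>T I \<phi>\<bar> \<le> 1"
        if \<phi>: "\<phi> \<in> test_on K UNIV" "small_on L \<delta> \<phi>" for \<phi>
      proof -
        have t: "\<phi> \<in> Ccinf" using \<phi>(1) test_on_subset_test[OF K] by blast
        have s: "smooth \<phi>" "\<And>x. x \<notin> K \<Longrightarrow> \<phi> x = 0"
          using \<phi>(1) by (auto simp: test_on_iff[OF compact_imp_closed[OF K]])
        have "(\<lambda>x. \<phi> x *\<^sub>R \<theta> (- I)) \<in> test_on K ?S"
          using s smooth_monomial[OF s(1)] monomial_test[OF t I]
          by (auto simp: test_on_iff[OF compact_imp_closed[OF K]] test_iff)
        moreover have "norm (partials is (\<lambda>x. \<phi> x *\<^sub>R \<theta> (- I)) x) < \<delta>" if "is \<in> L" for "is" x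
          unfolding partials_linear[OF bounded_linear_scaleR_left s(1)] using \<phi>(2) that n\<theta> by simp
        ultimately have "\<bar>u (\<lambda>x. \<phi> x *\<^sub>R \<theta> (- I))\<bar> \<le> 1" using L(3) by blast
        then show ?thesis by (simp add: T_def abs_mult abs_sg)
      qed
      then show "\<exists>L \<delta>. finite L \<and> \<delta> > 0 \<and> (\<forall>\<phi>\<in>test_on K UNIV.
          small_on L \<delta> \<phi> \<longrightarrow> \<bar>T I \<phi>\<bar> \<le> 1)"
        using L(1,2) by blast
    qed
  qed (simp add: T_def)
  then have "T \<in> DF (bideg p q)" by (auto simp: DF_def T_def)
  moreover have "pairing T \<beta> = u \<beta>" if \<beta>: "\<beta> \<in> test ?S" for \<beta>
  proof -
    let ?f = "\<lambda>I x. \<beta> x $ (- I) *\<^sub>R \<theta> (- I)"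
    have f: "?f I \<in> test ?S \<and> sg I * T I (\<lambda>x. \<beta> x $ (- I)) = u (?f I)" for I
    proof (cases "I \<in> bideg p q")
      case True
      then show ?thesis
        using monomial_test[OF component_test[OF \<beta>] True] component_test[OF \<beta>]
        by (simp add: T_def sg_square mult.assoc[symmetric])
    next
      case False
      then have "\<beta> x $ (- I) = 0" for x
        using \<beta> by (simp add: Omc_coef coef_def bideg')
      then have "?f I = 0" by (simp add: zero_fun_def)
      then show ?thesis
        using False subspace_0[OF subspace_test[OF subspace_Lam]]
          linear_on_0[OF u(1) subspace_test[OF subspace_Lam]] by (simp add: T_def)
    qed
    have "\<beta> = (\<Sum>I\<in>UNIV. ?f I)"
    proof
      fix x
      \<comment> \<open>Reindexing by complements turns the expansion in monomials into the order of
        summation used by \<open>pairing_eq\<close>.\<close>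
      have "range uminus = (UNIV :: 4 set set)" by (rule surjI[of uminus uminus]) simp
      then have "\<beta> x = (\<Sum>J\<in>uminus ` UNIV. \<beta> x $ J *\<^sub>R \<theta> J)"
        using ext_expansion[of "\<beta> x"] by (simp only:)
      also have "\<dots> = (\<Sum>I\<in>UNIV. ?f I x)" by (subst sum.reindex) (auto simp: inj_on_def)
      finally show "\<beta> x = (\<Sum>I\<in>UNIV. ?f I) x" by (simp add: sum_fun_apply)
    qed
    then have "u \<beta> = (\<Sum>I\<in>UNIV. u (?f I))"
      using linear_on_sum[OF u(1) subspace_test[OF subspace_Lam], of UNIV ?f] f by simp
    then show ?thesis using f by (simp add: pairing_eq)
  qed
  ultimately show ?thesis by blast
qed

text \<open>\<open>V\<close> is a space of distributional forms that kill the boundaries, and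
  \<open>ext\<close> says that it is large enough: every form killing \<open>B\<close> agrees on the
  cycles with a member of \<open>V\<close>. Whether \<open>V\<close> is also small enough is left to
  the two rules below, one assuming injectivity and one dividing by the kernel.\<close>

context
  fixes r l :: nat and Z B :: "form set" and V :: "(4 set \<Rightarrow> distr) set"
  assumes Z: "Zr Omc l p' q' = Z" "subspace Z" and B: "Br Omc r p' q' = B" "subspace B" "B \<subseteq> Z"
    and V: "V \<subseteq> DF (bideg p q)" and vanish: "\<And>T b. \<lbrakk>T \<in> V; b \<in> B\<rbrakk> \<Longrightarrow> pairing T b = 0"
    and ext: "\<And>T. \<lbrakk>T \<in> DF (bideg p q); \<And>b. b \<in> B \<Longrightarrow> pairing T b = 0\<rbrakk> \<Longrightarrow>
      \<exists>U\<in>V. \<forall>z\<in>Z. pairing U z = pairing T z"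
begin

lemma Cur_eq: "Cur r l p q = dual (quot Z B) (quotient_topology (subtopology (LF_topology (Lam p' q')) Z) (coset B))"
  unfolding Cur_def Dtest_def Dtest_topology_def dims Z(1) B(1) ..

lemma rep:
  assumes u: "linear_on (test (Lam p' q')) u" "bounded_on_tests (Lam p' q') u" "\<And>b. b \<in> B \<Longrightarrow> u b = 0"
  shows "\<exists>T\<in>V. \<forall>z\<in>Z. pairing T z = u z"
proof -
  have Zt: "Z \<subseteq> test (Lam p' q')" unfolding Z(1)[symmetric] by (auto simp: Zr_def Omc_def)
  obtain T where T: "T \<in> DF (bideg p q)" "\<And>\<beta>. \<beta> \<in> test (Lam p' q') \<Longrightarrow> pairing T \<beta> = u \<beta>"
    using functional_pairing[OF u(1,2)] by blast
  have "pairing T b = 0" if "b \<in> B" for b using T(2)[of b] u(3) that B(3) Zt by auto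
  then obtain U where U: "U \<in> V" "\<forall>z\<in>Z. pairing U z = pairing T z" using ext[OF T(1)] by blast
  have "pairing U z = u z" if "z \<in> Z" for z using U(2) T(2)[of z] that Zt by auto
  then show ?thesis using U(1) by blast
qed

lemma Z_test: "Z \<subseteq> test (Lam p' q')"
  unfolding Z(1)[symmetric] by (auto simp: Zr_def Omc_def)

lemma pairing_V: "T \<in> V \<Longrightarrow> linear_on (test (Lam p' q')) (pairing T) \<and> bounded_on_tests (Lam p' q') (pairing T)"
  using V pairing_functional by blast

lemma represent:
  shows "(\<lambda>T. induced Z B (pairing T)) ` V = Cur r l p q"
    and "\<lbrakk>T \<in> V; U \<in> V\<rbrakk> \<Longrightarrow> induced Z B (pairing (T + U)) = induced Z B (pairing T) + induced Z B (pairing U)"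
    and "T \<in> V \<Longrightarrow> induced Z B (pairing (c *\<^sub>R T)) = c *\<^sub>R induced Z B (pairing T)"
    and "\<lbrakk>T \<in> V; z \<in> Z\<rbrakk> \<Longrightarrow> induced Z B (pairing T) (coset B z) = pairing T z"
    and "\<lbrakk>T \<in> V; U \<in> V\<rbrakk> \<Longrightarrow>
      induced Z B (pairing T) = induced Z B (pairing U) \<longleftrightarrow> (\<forall>z\<in>Z. pairing T z = pairing U z)"
proof -
  note R = represent_dual[where P = V and ev = pairing,
      OF subspace_Lam Z(2) Z_test B(2,3) pairing_V pairing_add pairing_scale vanish rep]
  show "(\<lambda>T. induced Z B (pairing T)) ` V = Cur r l p q"
    unfolding Cur_eq by (rule R(1))
  show "\<lbrakk>T \<in> V; U \<in> V\<rbrakk> \<Longrightarrow> induced Z B (pairing (T + U)) = induced Z B (pairing T) + induced Z B (pairing U)"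
    by (rule R(2))
  show "T \<in> V \<Longrightarrow> induced Z B (pairing (c *\<^sub>R T)) = c *\<^sub>R induced Z B (pairing T)"
    by (rule R(3))
  show "\<lbrakk>T \<in> V; z \<in> Z\<rbrakk> \<Longrightarrow> induced Z B (pairing T) (coset B z) = pairing T z"
    by (rule R(4))
  show "\<lbrakk>T \<in> V; U \<in> V\<rbrakk> \<Longrightarrow>
      induced Z B (pairing T) = induced Z B (pairing U) \<longleftrightarrow> (\<forall>z\<in>Z. pairing T z = pairing U z)"
    by (rule R(5))
qed

lemma represents_currentsI:
  assumes inj: "\<And>T U. \<lbrakk>T \<in> V; U \<in> V; \<And>z. z \<in> Z \<Longrightarrow> pairing T z = pairing U z\<rbrakk> \<Longrightarrow> T = U"
  shows "represents_currents V r l p q"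
proof -
  note rep = represent
  let ?\<Xi> = "\<lambda>T. induced Z B (pairing T)"
  have "inj_on ?\<Xi> V" by (rule inj_onI) (use rep(5) inj in blast)
  then have "bij_betw ?\<Xi> V (Cur r l p q)" unfolding bij_betw_def using rep(1) by blast
  then have "linear_iso (subsp V) (subsp (Cur r l p q)) ?\<Xi>"
    unfolding linear_iso_def subsp_def rvs.simps using rep(2,3) by blast
  moreover have "\<forall>T\<in>V. \<forall>\<beta>\<in>Z. ?\<Xi> T (coset B \<beta>) = pairing T \<beta>" using rep(4) by blast
  ultimately show ?thesis
    unfolding represents_currents_def dims Z(1) B(1) by blast
qed

lemma quot_represents_currentsI:
  assumes sV: "subspace V" and W: "W = {T \<in> V. \<forall>z\<in>Z. pairing T z = 0}"
  shows "quot_represents_currents V W r l p q"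
proof -
  note rep = represent
  let ?\<Xi> = "\<lambda>T. induced Z B (pairing T)"
  have diff: "pairing (T - U) z = pairing T z - pairing U z" for T U z
    using pairing_add[of T "(-1) *\<^sub>R U" z] pairing_scale[of "-1" U z] by simp
  have sW: "subspace W"
    unfolding W subspace_def using sV pairing_add pairing_scale pairing_scale[of 0 0]
    by (auto simp: subspace_def)
  have "\<exists>\<Phi>. linear_iso (quot V W) (subsp (Cur r l p q)) \<Phi> \<and> (\<forall>T\<in>V. \<Phi> (coset W T) = ?\<Xi> T)"
  proof (rule linear_iso_quot_lift[OF sW rep(1)])
    show "T + U \<in> V \<and> ?\<Xi> (T + U) = ?\<Xi> T + ?\<Xi> U" if "T \<in> V" "U \<in> V" for T U
      using rep(2)[OF that] subspace_add[OF sV that] by blast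
    show "c *\<^sub>R T \<in> V \<and> ?\<Xi> (c *\<^sub>R T) = c *\<^sub>R ?\<Xi> T" if "T \<in> V" for c T
      using rep(3)[OF that] subspace_scale[OF sV that] by blast
    show "?\<Xi> T = ?\<Xi> U \<longleftrightarrow> T - U \<in> W" if "T \<in> V" "U \<in> V" for T U
      unfolding rep(5)[OF that] W using subspace_diff[OF sV that] by (simp add: diff)
  qed
  then show ?thesis
    unfolding quot_represents_currents_def dims Z(1) B(1) using rep(4) by metis
qed

end

end

section \<open>The individual isomorphisms\<close>

lemma DF_mono: "M \<subseteq> N \<Longrightarrow> DF M \<subseteq> DF N"
  using subspace_0[OF subspace_Distr] by (fastforce simp: DF_def)

lemma DF_zero: "\<lbrakk>T \<in> DF M; I \<notin> M\<rbrakk> \<Longrightarrow> T I = 0"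
  by (simp add: DF_def)

text \<open>Linearity on \<open>V\<close> suffices; the fields \<open>X i\<close> are shown to be
  additive for smooth functions only.\<close>

lemma subspace_image_on:
  assumes "subspace V" "\<And>x y. \<lbrakk>x \<in> V; y \<in> V\<rbrakk> \<Longrightarrow> h (x + y) = h x + h y"
    "\<And>c x. x \<in> V \<Longrightarrow> h (c *\<^sub>R x) = c *\<^sub>R h x"
  shows "subspace (h ` V)"
proof (rule subspaceI)
  show "0 \<in> h ` V"
    using assms(3)[of 0 0] subspace_0[OF assms(1)] by (auto intro!: image_eqI[of _ _ 0])
  show "u + v \<in> h ` V" if "u \<in> h ` V" "v \<in> h ` V" for u v
    using that assms(2)[symmetric] subspace_add[OF assms(1)] by fastforce
  show "c *\<^sub>R u \<in> h ` V" if "u \<in> h ` V" for c u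
    using that assms(3)[symmetric] subspace_scale[OF assms(1)] by fastforce
qed

lemma Ccinf_smooth: "f \<in> Ccinf \<Longrightarrow> smooth f"
  by (simp add: test_iff)

lemma X_function_add:
  assumes "f \<in> Ccinf" "g \<in> Ccinf"
  shows "X i (f + g) = X i f + X i g"
  using X_add[OF Ccinf_smooth Ccinf_smooth, OF assms] by (simp add: plus_fun_def)

lemma X_function_scale: "f \<in> Ccinf \<Longrightarrow> X i (c *\<^sub>R f) = c *\<^sub>R X i f"
  using X_scaleR[OF Ccinf_smooth] by (simp add: scaleR_fun_def)

lemma subspace_Ccinf: "subspace Ccinf"
  by (rule subspace_test[OF subspace_UNIV])

text \<open>With compact supports the second-order condition of \<open>Zr_3_1\<close> amounts to
  exactness: \<open>horizontal_potential\<close> in one direction, \<open>gradient_closed\<close> in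
  the other.\<close>

lemma Zr_Omc_3_1: "Zr Omc 3 1 0 = (\<lambda>u x. X 1 u x *\<^sub>R \<theta> {1} + X 2 u x *\<^sub>R \<theta> {2}) ` Ccinf"
proof -
  have "\<alpha> \<in> (\<lambda>u x. X 1 u x *\<^sub>R \<theta> {1} + X 2 u x *\<^sub>R \<theta> {2}) ` Ccinf" if "\<alpha> \<in> Zr Omc 3 1 0" for \<alpha>
  proof -
    obtain a b where "\<alpha> = (\<lambda>x. a x *\<^sub>R \<theta> {1} + b x *\<^sub>R \<theta> {2})" "a \<in> Ccinf" "b \<in> Ccinf"
      "\<forall>x. X 2 (X 2 a) x - X 2 (X 1 b) x + X 3 b x = 0"
      using \<open>\<alpha> \<in> Zr Omc 3 1 0\<close> unfolding Omc.Zr_3_1 by blast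
    moreover from this obtain u where "u \<in> Ccinf" "a = X 1 u" "b = X 2 u"
      using horizontal_potential[of a b] by blast
    ultimately show ?thesis by blast
  qed
  moreover have "(\<lambda>x. X 1 u x *\<^sub>R \<theta> {1} + X 2 u x *\<^sub>R \<theta> {2}) \<in> Zr Omc 3 1 0" if u: "u \<in> Ccinf" for u
    unfolding Omc.Zr_3_1
  proof (rule CollectI, rule exI[of _ "X 1 u"], rule exI[of _ "X 2 u"], intro conjI)
    show "\<forall>x. X 2 (X 2 (X 1 u)) x - X 2 (X 1 (X 2 u)) x + X 3 (X 2 u) x = 0"
      using gradient_closed[OF Ccinf_smooth[OF u]] by blast
  qed (simp_all only: X_test u)
  ultimately show ?thesis by blast
qed

lemma subspace_Zr_Omc_3_1: "subspace (Zr Omc 3 1 0)"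
  unfolding Zr_Omc_3_1
  by (rule subspace_image_on[OF subspace_Ccinf])
     (simp_all only: X_function_add X_function_scale X_test, simp_all add: fun_eq_iff scaleR_fun_def algebra_simps)

lemma Br_Omc_3_6: "Br Omc 3 6 (-3) =
    (\<lambda>f x. (- X 1 (X 2 f) x - X 3 f x) *\<^sub>R \<theta> {1, 3, 4} + (- X 2 (X 2 f) x) *\<^sub>R \<theta> {2, 3, 4}) ` Ccinf"
  unfolding Omc.Br_3_6 by blast

lemma subspace_Br_Omc_3_6: "subspace (Br Omc 3 6 (-3))"
  unfolding Br_Omc_3_6
  by (rule subspace_image_on[OF subspace_Ccinf])
     (simp_all only: X_function_add X_function_scale X_test, simp_all add: fun_eq_iff scaleR_fun_def algebra_simps)

lemma subspace_singleton_0: "subspace {0}"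
  by (simp add: subspace_def)

context complementary
begin

lemma pairing_binomial:
  assumes T: "T \<in> DF M" and I: "I \<in> bideg p q" "J \<in> bideg p q" and a: "a \<in> Ccinf" "b \<in> Ccinf"
  shows "pairing T (\<lambda>x. a x *\<^sub>R \<theta> (- I) + b x *\<^sub>R \<theta> (- J)) = sg I * T I a + sg J * T J b"
proof -
  have "linear_on (test (Lam p' q')) (pairing T)" using pairing_functional[OF T] by blast
  from linear_onD(1)[OF this monomial_test[OF a(1) I(1)] monomial_test[OF a(2) I(2)]]
  show ?thesis by (simp add: plus_fun_def pairing_monomial[OF T])
qed

lemma pairing_0: "T \<in> DF M \<Longrightarrow> pairing T 0 = 0"
  using linear_on_0[OF _ subspace_test[OF subspace_Lam]] pairing_functional by blast

lemma represents_currents_full: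
  assumes "Zr Omc l p' q' = Omc p' q'" "Br Omc r p' q' = {0}"
  shows "represents_currents (DF (bideg p q)) r l p q"
proof (rule represents_currentsI[OF assms(1) _ assms(2)])
  show "subspace (Omc p' q')" "{0} \<subseteq> Omc p' q'" unfolding Omc_def
    using subspace_test[OF subspace_Lam] subspace_0[OF subspace_test[OF subspace_Lam]] by auto
  show "pairing T b = 0" if "T \<in> DF (bideg p q)" "b \<in> {0}" for T b
    using that pairing_0 by simp
  show "T = U" if "T \<in> DF (bideg p q)" "U \<in> DF (bideg p q)" "\<And>z. z \<in> Omc p' q' \<Longrightarrow> pairing T z = pairing U z" for T U
    using that monomial_test unfolding Omc_def by (intro DF_eqI[of T "bideg p q" U]) auto
qed (auto simp: subspace_singleton_0)

end

text \<open>The differential equation is the transpose of the formula for boundaries in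
  \<open>Br_Omc_3_6\<close>. Transposing reverses the order of the fields with one sign for each, so
  \<open>Xd 2 (Xd 1 T)\<close> tests \<open>T\<close> on \<open>X 1 (X 2 f)\<close> while
  \<open>Xd 3\<close> changes sign.\<close>

lemma horizontal_currents:
  "represents_currents {T \<in> DF (bideg 1 0).
     Xd 2 (Xd 1 (T {2})) - Xd 3 (T {2}) = Xd 2 (Xd 2 (T {1}))} 3 1 1 0"
proof -
  interpret complementary 1 0 6 "-3" by unfold_locales auto
  let ?b = "\<lambda>f x. (- X 1 (X 2 f) x - X 3 f x) *\<^sub>R \<theta> {1, 3, 4} + (- X 2 (X 2 f) x) *\<^sub>R \<theta> {2, 3, 4}"
  let ?V = "{T \<in> DF (bideg 1 0). Xd 2 (Xd 1 (T {2})) - Xd 3 (T {2}) = Xd 2 (Xd 2 (T {1}))}"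
  have pairing_b: "pairing T (?b f) = T {2} (X 1 (X 2 f)) + T {2} (X 3 f) - T {1} (X 2 (X 2 f))"
    if T: "T \<in> DF (bideg 1 0)" and f: "f \<in> Ccinf" for T f
  proof -
    have lin: "linear_on Ccinf (T I)" for I using DF_Distr[OF T] by (simp add: Distr_iff)
    have "T {2} (- X 1 (X 2 f) - X 3 f) = - T {2} (X 1 (X 2 f)) - T {2} (X 3 f)"
      using linear_on_diff[OF lin subspace_Ccinf subspace_neg[OF subspace_Ccinf]] linear_on_minus[OF lin] X_test f
      by simp
    moreover have "T {1} (- X 2 (X 2 f)) = - T {1} (X 2 (X 2 f))"
      using linear_on_minus[OF lin] X_test f by blast
    \<comment> \<open>The monomials are written as complements, \<open>{1, 3, 4}\<close> of
      \<open>{2}\<close> and \<open>{2, 3, 4}\<close> of \<open>{1}\<close>, the form in which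
      \<open>pairing_binomial\<close> reads off coefficients.\<close>
    moreover have "pairing T (\<lambda>x. (- X 1 (X 2 f) - X 3 f) x *\<^sub>R \<theta> (- {2}) + (- X 2 (X 2 f)) x *\<^sub>R \<theta> (- {1}))
        = sg {2} * T {2} (- X 1 (X 2 f) - X 3 f) + sg {1} * T {1} (- X 2 (X 2 f))"
      using f by (intro pairing_binomial[OF T] subspace_diff[OF subspace_Ccinf] subspace_neg[OF subspace_Ccinf] X_test)
        (simp_all add: bideg_simps)
    ultimately show ?thesis by (simp add: compl4 sg_simps)
  qed
  have V_iff: "T \<in> ?V \<longleftrightarrow> (\<forall>b\<in>Br Omc 3 6 (-3). pairing T b = 0)" if T: "T \<in> DF (bideg 1 0)" for T
  proof -
    have h: "(Xd 2 (Xd 1 (T {2})) - Xd 3 (T {2})) f = Xd 2 (Xd 2 (T {1})) f \<longleftrightarrow> f \<notin> Ccinf \<or> pairing T (?b f) = 0" for f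
    proof (cases "f \<in> Ccinf")
      case True
      then show ?thesis using X_test[OF True, of 2] unfolding pairing_b[OF T True] by (auto simp: Xd_def)
    qed (simp add: Xd_def)
    show ?thesis
      unfolding mem_Collect_eq fun_eq_iff[of "Xd 2 (Xd 1 (T {2})) - Xd 3 (T {2})"] h Br_Omc_3_6 ball_simps
      using T by blast
  qed
  show ?thesis
  proof (rule represents_currentsI[OF Omc.Zr_1_6 _ refl subspace_Br_Omc_3_6])
    show "subspace (Omc 6 (-3))" by (rule Omc.subspace_F)
    show "Br Omc 3 6 (-3) \<subseteq> Omc 6 (-3)" by (auto simp: Br_def)
    show "pairing T b = 0" if "T \<in> ?V" "b \<in> Br Omc 3 6 (-3)" for T b
      using that V_iff[of T] by blast
    show "\<exists>U\<in>?V. \<forall>z\<in>Omc 6 (-3). pairing U z = pairing T z"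
      if "T \<in> DF (bideg 1 0)" "\<And>b. b \<in> Br Omc 3 6 (-3) \<Longrightarrow> pairing T b = 0" for T
      using that V_iff[of T] by blast
    show "T = U" if "T \<in> ?V" "U \<in> ?V" "\<And>z. z \<in> Omc 6 (-3) \<Longrightarrow> pairing T z = pairing U z" for T U
      using that monomial_test unfolding Omc_def by (intro DF_eqI[of T "bideg 1 0" U]) auto
  qed auto
qed

text \<open>Every test form is a cycle, and the boundaries are the multiples of
  \<open>\<theta> {1, 3}\<close>, whose complement is \<open>{2, 4}\<close>. Killing them means
  having no \<open>\<theta> {2, 4}\<close> coefficient.\<close>

lemma currents_4_2: "represents_currents (DF {{1, 4}}) 2 3 4 (-2)"
proof -
  interpret complementary 4 "-2" 3 "-1" by unfold_locales auto
  have sub: "coef Ccinf {{1, 3}} \<subseteq> Omc 3 (-1)"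
    unfolding Omc_eq_coef bideg_simps by (intro coef_mono subspace_0[OF subspace_Ccinf]) auto
  have p13: "pairing T (\<lambda>x. \<phi> x *\<^sub>R \<theta> {1, 3}) = sg {2, 4} * T {2, 4} \<phi>" if "T \<in> DF M" for T M \<phi>
    using pairing_monomial[OF that, of \<phi> "{2, 4}"] by (simp add: compl4)
  show ?thesis
  proof (rule represents_currentsI[OF Omc.Zr_3_3 Omc.subspace_F Omc.Br_2_3 subspace_coef[OF subspace_Ccinf] sub])
    show "DF {{1, 4}} \<subseteq> DF (bideg 4 (-2))" by (rule DF_mono) (simp add: bideg_simps)
    show "pairing T b = 0" if "T \<in> DF {{1, 4}}" "b \<in> coef Ccinf {{1, 3}}" for T b
      using that p13[OF that(1)] DF_zero[OF that(1), of "{2, 4}"] by (auto simp: coef_single set4_eq_iff)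
    show "\<exists>U\<in>DF {{1, 4}}. \<forall>z\<in>Omc 3 (-1). pairing U z = pairing T z"
      if T: "T \<in> DF (bideg 4 (-2))" "\<And>b. b \<in> coef Ccinf {{1, 3}} \<Longrightarrow> pairing T b = 0" for T
    proof
      have "T {2, 4} \<phi> = 0" for \<phi>
      proof (cases "\<phi> \<in> Ccinf")
        case True
        then have "(\<lambda>x. \<phi> x *\<^sub>R \<theta> {1, 3}) \<in> coef Ccinf {{1, 3}}" by (simp add: coef_def theta_nth)
        then have "sg {2, 4} * T {2, 4} \<phi> = 0" using T(2) p13[OF T(1)] by metis
        then show ?thesis using sg_square[of "{2, 4}"] by auto
      next
        case False
        then show ?thesis using DF_Distr[OF T(1), of "{2, 4}"] by (simp add: Distr_iff)
      qed
      then have "T {2, 4} = 0" by (simp add: fun_eq_iff)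
      then show "T \<in> DF {{1, 4}}" using T(1) by (auto simp: DF_def bideg_simps)
    qed simp
    show "T = U" if "T \<in> DF {{1, 4}}" "U \<in> DF {{1, 4}}" "\<And>z. z \<in> Omc 3 (-1) \<Longrightarrow> pairing T z = pairing U z" for T U
    proof (rule DF_eqI[OF that(1,2) that(3)])
      show "(\<lambda>x. \<phi> x *\<^sub>R \<theta> (- I)) \<in> Omc 3 (-1)" if "I \<in> {{1, 4}}" "\<phi> \<in> Ccinf" for I \<phi>
        using monomial_test[OF that(2), of I] that(1) by (simp add: Omc_def bideg_simps)
    qed
  qed
qed

text \<open>Dual to the previous situation: there are no boundaries, but the cycles involve
  \<open>\<theta> {1, 4}\<close> only, so they see just the coefficient at \<open>{2, 3}\<close> and
  the other one may be truncated.\<close>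

lemma currents_3_1: "represents_currents (DF {{2, 3}}) 3 2 3 (-1)"
proof -
  interpret complementary 3 "-1" 4 "-2" by unfold_locales auto
  have p14: "pairing T (\<lambda>x. \<phi> x *\<^sub>R \<theta> {1, 4}) = sg {2, 3} * T {2, 3} \<phi>" if "T \<in> DF M" for T M \<phi>
    using pairing_monomial[OF that, of \<phi> "{2, 3}"] by (simp add: compl4)
  show ?thesis
  proof (rule represents_currentsI[OF Omc.Zr_2_4 subspace_coef[OF subspace_Ccinf] Omc.Br_3_4 subspace_singleton_0])
    show "{0} \<subseteq> coef Ccinf {{1, 4}}" using subspace_0[OF subspace_coef[OF subspace_Ccinf]] by blast
    show "DF {{2, 3}} \<subseteq> DF (bideg 3 (-1))" by (rule DF_mono) (simp add: bideg_simps)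
    show "pairing T b = 0" if "T \<in> DF {{2, 3}}" "b \<in> {0}" for T b
      using pairing_0[OF that(1)] that(2) by simp
    show "\<exists>U\<in>DF {{2, 3}}. \<forall>z\<in>coef Ccinf {{1, 4}}. pairing U z = pairing T z"
      if T: "T \<in> DF (bideg 3 (-1))" for T
    proof
      let ?U = "\<lambda>I. if I = {2, 3} then T I else 0"
      show U: "?U \<in> DF {{2, 3}}" using DF_Distr[OF T] by (simp add: DF_def)
      show "\<forall>z\<in>coef Ccinf {{1, 4}}. pairing ?U z = pairing T z"
        using p14[OF T] p14[OF U] by (auto simp: coef_single)
    qed
    show "T = U" if TU: "T \<in> DF {{2, 3}}" "U \<in> DF {{2, 3}}"
      "\<And>z. z \<in> coef Ccinf {{1, 4}} \<Longrightarrow> pairing T z = pairing U z" for T U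
    proof (rule DF_eqI[OF TU])
      show "(\<lambda>x. \<phi> x *\<^sub>R \<theta> (- I)) \<in> coef Ccinf {{1, 4}}" if "I \<in> {{2, 3}}" "\<phi> \<in> Ccinf" for I \<phi>
        using that by (simp add: coef_def theta_nth compl4)
    qed
  qed
qed

text \<open>Only zero is a boundary, so the kernel of the pairing on cycles is all that is divided
  out. By \<open>Zr_Omc_3_1\<close> the cycles are gradients of test functions, and vanishing on
  these is the stated equation in transposed form.\<close>

lemma currents_6_3: "quot_represents_currents (DF (bideg 6 (-3)))
   {T \<in> DF (bideg 6 (-3)). Xd 2 (T {1, 3, 4}) = Xd 1 (T {2, 3, 4})} 1 3 6 (-3)"
proof -
  interpret complementary 6 "-3" 1 0 by unfold_locales auto
  have pairing_z: "pairing T (\<lambda>x. X 1 u x *\<^sub>R \<theta> {1} + X 2 u x *\<^sub>R \<theta> {2})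
      = T {1, 3, 4} (X 2 u) - T {2, 3, 4} (X 1 u)" if "T \<in> DF (bideg 6 (-3))" "u \<in> Ccinf" for T u
    using pairing_binomial[OF that(1), of "{2, 3, 4}" "{1, 3, 4}" "X 1 u" "X 2 u"] X_test[OF that(2)]
    by (simp add: bideg_simps compl4 sg_simps)
  have W: "{T \<in> DF (bideg 6 (-3)). Xd 2 (T {1, 3, 4}) = Xd 1 (T {2, 3, 4})} =
      {T \<in> DF (bideg 6 (-3)). \<forall>z\<in>Zr Omc 3 1 0. pairing T z = 0}"
  proof -
    have "Xd 2 (T {1, 3, 4}) = Xd 1 (T {2, 3, 4}) \<longleftrightarrow> (\<forall>z\<in>Zr Omc 3 1 0. pairing T z = 0)"
      if T: "T \<in> DF (bideg 6 (-3))" for T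
    proof -
      have "Xd 2 (T {1, 3, 4}) = Xd 1 (T {2, 3, 4}) \<longleftrightarrow>
          (\<forall>u\<in>Ccinf. T {1, 3, 4} (X 2 u) = T {2, 3, 4} (X 1 u))"
        unfolding Xd_def fun_eq_iff by (simp add: Ball_def)
      also have "\<dots> \<longleftrightarrow> (\<forall>z\<in>Zr Omc 3 1 0. pairing T z = 0)"
        unfolding Zr_Omc_3_1 by (simp add: pairing_z[OF T])
      finally show ?thesis .
    qed
    then show ?thesis by blast
  qed
  show ?thesis
  proof (rule quot_represents_currentsI[OF refl subspace_Zr_Omc_3_1 Omc.Br_1_1 subspace_singleton_0])
    show "{0} \<subseteq> Zr Omc 3 1 0" using subspace_0[OF subspace_Zr_Omc_3_1] by simp
    show "pairing T b = 0" if "T \<in> DF (bideg 6 (-3))" "b \<in> {0}" for T b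
      using pairing_0[OF that(1)] that(2) by simp
  qed (use W subspace_DF in auto)
qed

lemma dual_restrict:
  assumes S: "subspace S" and u: "linear_on (test S) u" "bounded_on_tests S u"
  shows "(\<lambda>\<beta>. if \<beta> \<in> test S then u \<beta> else 0) \<in> dual (subsp (test S)) (LF_topology S)"
  unfolding dual_LF_iff[OF S]
proof (intro conjI)
  show "linear_on (test S) (\<lambda>\<beta>. if \<beta> \<in> test S then u \<beta> else 0)"
    using u(1) subspace_add[OF subspace_test[OF S]] subspace_scale[OF subspace_test[OF S]]
    by (simp add: linear_on_def)
  have "\<bar>if \<beta> \<in> test S then u \<beta> else 0\<bar> \<le> 1 \<longleftrightarrow> \<bar>u \<beta>\<bar> \<le> 1" if "compact K" "\<beta> \<in> test_on K S" for K \<beta>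
    using test_on_subset_test[OF that(1)] that(2) by auto
  then show "bounded_on_tests S (\<lambda>\<beta>. if \<beta> \<in> test S then u \<beta> else 0)"
    using u(2) unfolding bounded_on_tests_def by simp
qed simp

text \<open>The pairing is used with bidegree (0, 0), where the only monomial is the constant; a
  distribution is regarded as the coefficient at the empty index set.\<close>

lemma top_degree_dual:
  "\<exists>\<Phi>. linear_iso (subsp Distr) (subsp (dual (subsp (Omc 7 (-3))) (LF_topology (Lam 7 (-3))))) \<Phi> \<and>
     (\<forall>T\<in>Distr. \<forall>\<phi>\<in>Ccinf. \<Phi> T (\<lambda>x. \<phi> x *\<^sub>R \<theta> {1, 2, 3, 4}) = T \<phi>)"
proof -
  interpret complementary 0 0 7 "-3" by unfold_locales auto
  let ?S = "Lam 7 (-3)"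
  let ?D = "dual (subsp (test ?S)) (LF_topology ?S)"
  have b0: "bideg 0 0 = {{}}" by (rule bideg_eqI) (simp add: bideg_iff set4_eq_iff of_bool_def)
  define emb where "emb T I = (if I = {} then T else 0)" for T :: distr and I :: "4 set"
  define \<Phi> where "\<Phi> T \<beta> = (if \<beta> \<in> test ?S then pairing (emb T) \<beta> else 0)" for T \<beta>
  have emb: "emb T \<in> DF {{}}" if "T \<in> Distr" for T using that by (simp add: DF_def emb_def)
  have val: "\<Phi> T (\<lambda>x. \<phi> x *\<^sub>R \<theta> {1, 2, 3, 4}) = T \<phi>" if "T \<in> Distr" "\<phi> \<in> Ccinf" for T \<phi>
    using pairing_monomial[OF emb[OF that(1)], of \<phi> "{}", unfolded compl4(1)]
      monomial_test[OF that(2), of "{}", unfolded compl4(1)]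
    by (simp add: \<Phi>_def b0 sg_simps emb_def)
  have "bij_betw \<Phi> Distr ?D"
    unfolding bij_betw_def
  proof
    show "inj_on \<Phi> Distr"
    proof (rule inj_onI, rule ext)
      fix T U \<phi> assume TU: "T \<in> Distr" "U \<in> Distr" "\<Phi> T = \<Phi> U"
      show "T \<phi> = U \<phi>"
      proof (cases "\<phi> \<in> Ccinf")
        case True
        then show ?thesis using val[OF TU(1) True] val[OF TU(2) True] TU(3) by simp
      qed (use TU in \<open>simp add: Distr_iff\<close>)
    qed
    show "\<Phi> ` Distr = ?D"
    proof
      show "\<Phi> ` Distr \<subseteq> ?D"
        using dual_restrict[OF subspace_Lam] pairing_functional[OF emb] unfolding \<Phi>_def by blast
      show "?D \<subseteq> \<Phi> ` Distr"
      proof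
        fix u assume "u \<in> ?D"
        then have u: "linear_on (test ?S) u" "bounded_on_tests ?S u" "\<And>\<beta>. \<beta> \<notin> test ?S \<Longrightarrow> u \<beta> = 0"
          using dual_LF_iff[OF subspace_Lam] by blast+
        obtain T where T: "T \<in> DF {{}}" "\<And>\<beta>. \<beta> \<in> test ?S \<Longrightarrow> pairing T \<beta> = u \<beta>"
          using functional_pairing[OF u(1,2)] unfolding b0 by blast
        have "emb (T {}) = T" using T(1) by (auto simp: emb_def DF_def fun_eq_iff)
        then have "\<Phi> (T {}) = u" using T(2) u(3) by (intro ext) (simp add: \<Phi>_def)
        then show "u \<in> \<Phi> ` Distr" using DF_Distr[OF T(1)] by blast
      qed
    qed
  qed
  moreover have "\<Phi> (T + U) = \<Phi> T + \<Phi> U" for T U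
  proof -
    have "emb (T + U) = emb T + emb U" by (auto simp: emb_def fun_eq_iff)
    then show ?thesis by (intro ext) (simp add: \<Phi>_def pairing_add)
  qed
  moreover have "\<Phi> (c *\<^sub>R T) = c *\<^sub>R \<Phi> T" for c T
  proof -
    have "emb (c *\<^sub>R T) = c *\<^sub>R emb T" by (auto simp: emb_def fun_eq_iff scaleR_fun_def)
    then show ?thesis by (intro ext) (simp add: \<Phi>_def pairing_scale scaleR_fun_def[of c "\<Phi> _"])
  qed
  ultimately have "linear_iso (subsp Distr) (subsp ?D) \<Phi>"
    by (simp add: linear_iso_def subsp_def)
  then show ?thesis unfolding Omc_def using val by blast
qed

lemma function_dual:
  "\<exists>\<Phi>. linear_iso (subsp (DF {I. card I = 4})) (subsp (dual (subsp Ccinf) (LF_topology UNIV))) \<Phi> \<and>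
     (\<forall>T\<in>DF {I. card I = 4}. \<forall>\<phi>\<in>Ccinf. \<Phi> T \<phi> = pairing T (\<lambda>x. \<phi> x *\<^sub>R \<theta> {}))"
proof -
  have M: "{I. card I = 4} = {{1, 2, 3, 4::4}}"
  proof -
    have "card (UNIV :: 4 set) = 4" by simp
    then have "card I = 4 \<longleftrightarrow> I = UNIV" for I :: "4 set"
      by (metis card_subset_eq finite subset_UNIV)
    then show ?thesis by (auto simp: UNIV4[symmetric])
  qed
  let ?\<Phi> = "\<lambda>T::4 set \<Rightarrow> distr. T {1, 2, 3, 4}"
  have "bij_betw ?\<Phi> (DF {{1, 2, 3, 4}}) Distr"
  proof (rule bij_betw_byWitness[where f' = "\<lambda>T I. if I = {1, 2, 3, 4} then T else 0"])
    show "\<forall>T\<in>DF {{1, 2, 3, 4}}. (\<lambda>I. if I = {1, 2, 3, 4} then T {1, 2, 3, 4} else 0) = T"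
      by (auto simp: DF_def fun_eq_iff)
  qed (auto simp: DF_def)
  then have "linear_iso (subsp (DF {{1, 2, 3, 4}})) (subsp Distr) ?\<Phi>"
    by (simp add: linear_iso_def subsp_def scaleR_fun_def[of _ "_ :: 4 set \<Rightarrow> distr"])
  moreover have "T {1, 2, 3, 4} \<phi> = pairing T (\<lambda>x. \<phi> x *\<^sub>R \<theta> {})" if "T \<in> DF {{1, 2, 3, 4}}" for T \<phi>
    using pairing_monomial[OF that, of \<phi> "{1, 2, 3, 4}", unfolded compl4(2)] by (simp add: sg_simps)
  ultimately show ?thesis unfolding M Distr_def by blast
qed

theorem lemma4p5:
  shows
    "(\<exists>\<Phi>. linear_iso (subsp Distr) (subsp (dual (subsp (Omc 7 (-3))) (LF_topology (Lam 7 (-3))))) \<Phi> \<and>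
          (\<forall>T\<in>Distr. \<forall>\<phi>\<in>Ccinf. \<Phi> T (\<lambda>x. \<phi> x *\<^sub>R \<theta> {1, 2, 3, 4}) = T \<phi>)) \<and>
     represents_currents
       {T \<in> DF (bideg 1 0).
          Xd 2 (Xd 1 (T {2})) - Xd 3 (T {2}) = Xd 2 (Xd 2 (T {1}))} 3 1 1 0 \<and>
     (represents_currents (DF {{1, 4}}) 2 3 4 (-2) \<and>
      linear_iso (subsp (DF {{1, 4}})) (tensor_E 2 3 4 (-2)) (to_tensor_E 2 3 4 (-2) {{1, 4}})) \<and>
     (represents_currents (DF (bideg 6 (-3))) 1 2 6 (-3) \<and>
      linear_iso (subsp (DF (bideg 6 (-3)))) (tensor_E 1 2 6 (-3))
        (to_tensor_E 1 2 6 (-3) (bideg 6 (-3)))) \<and>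
     (\<exists>\<Phi>. linear_iso (subsp (DF {I. card I = 4})) (subsp (dual (subsp Ccinf) (LF_topology UNIV))) \<Phi> \<and>
          (\<forall>T\<in>DF {I. card I = 4}. \<forall>\<phi>\<in>Ccinf. \<Phi> T \<phi> = pairing T (\<lambda>x. \<phi> x *\<^sub>R \<theta> {}))) \<and>
     (represents_currents (DF (bideg 1 0)) 2 1 1 0 \<and>
      linear_iso (subsp (DF (bideg 1 0))) (tensor_E 2 1 1 0)
        (to_tensor_E 2 1 1 0 (bideg 1 0))) \<and>
     (represents_currents (DF {{2, 3}}) 3 2 3 (-1) \<and>
      linear_iso (subsp (DF {{2, 3}})) (tensor_E 3 2 3 (-1)) (to_tensor_E 3 2 3 (-1) {{2, 3}})) \<and>
     quot_represents_currents (DF (bideg 6 (-3)))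
       {T \<in> DF (bideg 6 (-3)). Xd 2 (T {1, 3, 4}) = Xd 1 (T {2, 3, 4})} 1 3 6 (-3)"
proof (intro conjI)
  show "linear_iso (subsp (DF {{1, 4}})) (tensor_E 2 3 4 (-2)) (to_tensor_E 2 3 4 (-2) {{1, 4}})"
    by (rule tensor_iso[where N = "{}"]) (simp_all add: Om.Zr_2_4 Om.Br_3_4 coef_empty)
  show "linear_iso (subsp (DF (bideg 6 (-3)))) (tensor_E 1 2 6 (-3)) (to_tensor_E 1 2 6 (-3) (bideg 6 (-3)))"
    by (rule tensor_iso[where N = "{}"])
       (simp_all add: Om.Zr_1_6[unfolded One_nat_def] Om.Br_2_6 coef_empty Om_eq_coef)
  show "linear_iso (subsp (DF (bideg 1 0))) (tensor_E 2 1 1 0) (to_tensor_E 2 1 1 0 (bideg 1 0))"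
    by (rule tensor_iso[where N = "{}"])
       (simp_all add: Om.Zr_2_1 Om.Br_1_1[unfolded One_nat_def] coef_empty Om_eq_coef)
  show "linear_iso (subsp (DF {{2, 3}})) (tensor_E 3 2 3 (-1)) (to_tensor_E 3 2 3 (-1) {{2, 3}})"
    \<comment> \<open>Of the four tensor identities only this one has nonzero boundaries.\<close>
    by (rule tensor_iso[where N = "{{1, 3}}"])
       (simp_all add: Om.Zr_3_3 Om.Br_2_3 Om_eq_coef bideg_simps insert_commute set4_eq_iff)
  show "represents_currents (DF (bideg 6 (-3))) 1 2 6 (-3)"
    \<comment> \<open>Currents of bidegree (6,-3) act on test forms of bidegree (1,0), and
      conversely in the next case; hence the interchange of bidegrees and of the two orders.\<close>
    by (rule complementary.represents_currents_full[OF _ Omc.Zr_2_1 Omc.Br_1_1]) (simp add: complementary_def)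
  show "represents_currents (DF (bideg 1 0)) 2 1 1 0"
    by (rule complementary.represents_currents_full[OF _ Omc.Zr_1_6 Omc.Br_2_6]) (simp add: complementary_def)
qed (rule top_degree_dual horizontal_currents currents_4_2 function_dual currents_3_1 currents_6_3)+

end
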